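(* Let $\bullet\in\{*,\mathrm{sh}\}$. For every nonnegative integer $n$, the following identity holds in $\mathcal{Z}[[t]]/t^3$ (with the convention $\zeta(1)=0$): \[ \zeta_{\mathcal{S}_3}^{\bullet}(\{3,1\}^n) =\frac{2(-4)^n}{(4n+2)!}\pi^{4n}+(-1)^{n+1}\sum_{n_0,n_1\ge0,\; n_0+n_1=2n}\frac{(-1)^{n_0}2^{n_0-n_1+2}}{(2n_0+2)!}\pi^{2n_0}\zeta(2n_1+1)\,t +(-1)^n\sum_{n_0,n_1,n_2\ge0,\; n_0+n_1+n_2=2n}\frac{(-1)^{n_0}2^{n_0-n_1-n_2+2}}{(2n_0+2)!}\pi^{2n_0}\zeta(2n_1+1)\zeta(2n_2+1)\,t^2 . \]
   Context: An index is a finite (possibly empty) sequence of positive integers; it is admissible if it is empty or its last component is greater than $1$. $\{a,b\}^n$ denotes the $n$-fold repetition of $a,b$ (e.g. $\{a,b\}^2=(a,b,a,b)$). For an admissible index, $\zeta(k_1,\dots,k_r)=\sum_{1\le n_1<\dots<n_r}\frac{1}{n_1^{k_1}\cdots n_r^{k_r}}$, with $\zeta(\emptyset)=1$. $\mathcal{Z}\subset\mathbb{R}$ is the $\mathbb{Q}$-span of all these values (a $\mathbb{Q}$-algebra). Harmonic regularization $\zeta^*$: on the $\mathbb{Q}$-vector space $\mathcal{I}$ freely generated by all indices, define the bilinear product $*$ by $\boldsymbol{k}*\emptyset=\emptyset*\boldsymbol{k}=\boldsymbol{k}$ and $(\boldsymbol{k},k)*(\boldsymbol{l},l)=(\boldsymbol{k}*(\boldsymbol{l},l),k)+(\boldsymbol{k}*\boldsymbol{l},k+l)+((\boldsymbol{k},k)*\boldsymbol{l},l)$.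 Then $\zeta^*:\mathcal{I}\to\mathbb{R}$ is the unique $\mathbb{Q}$-linear map that is multiplicative for $*$, equals $\zeta$ on admissible indices, and satisfies $\zeta^*(1)=0$. Shuffle regularization $\zeta^{\mathrm{sh}}$: identify the index $(k_1,\dots,k_r)$ with the word $yx^{k_1-1}\cdots yx^{k_r-1}$ in $\mathbb{Q}+y\mathbb{Q}\langle x,y\rangle$, equipped with the shuffle product. Then $\zeta^{\mathrm{sh}}$ is the unique $\mathbb{Q}$-linear map that is multiplicative for the shuffle product, equals $\zeta$ on admissible indices, and satisfies $\zeta^{\mathrm{sh}}(1)=0$. Both maps take values in $\mathcal{Z}$. For $\bullet\in\{*,\mathrm{sh}\}$, an index $(k_1,\dots,k_r)$ and $m\ge0$ put \[\zeta_m^{\bullet}(k_1,\dots,k_r)=\sum_{l_1,\dots,l_r\ge0,\; l_1+\dots+l_r=m}\zeta^{\bullet}(k_1+l_1,\dots,k_r+l_r)\prod_{i=1}^r\binom{k_i+l_i-1}{l_i}\] (so $\zeta_0^\bullet(\emptyset)=1$ and $\zeta_m^\bullet(\emptyset)=0$ for $m\ge1$), and \[\zeta_{\widehat{\mathcal{S}}}^{\bullet}(k_1,\dots,k_r)=\sum_{i=0}^r(-1)^{k_{i+1}+\dots+k_r}\zeta^{\bullet}(k_1,\dots,k_i)\sum_{m\ge0}\zeta_m^{\bullet}(k_r,\dots,k_{i+1})t^m\in\mathcal{Z}[[t]].\] For $m\ge1$, $\zeta_{\mathcal{S}_m}^{\bullet}(\boldsymbol{k})$ is the image of $\zeta_{\widehat{\mathcal{S}}}^{\bullet}(\boldsymbol{k})$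 in $\mathcal{Z}[[t]]/t^m$. On the right-hand side of the claim, $\zeta(k)$ for $k\ge2$ is the Riemann zeta value, and $\zeta(1)$ is interpreted as $0$. *)

theory Defs
  imports
    "HOL-Analysis.Analysis"
    "HOL-Library.Poly_Mapping"
    "HOL-Computational_Algebra.Formal_Power_Series"
    "HOL-Algebra.QuotRing"
begin

section \<open>Indices and multiple zeta values\<close>

definition indices :: "nat list set" where
  "indices = {ks. \<forall>k\<in>set ks. 1 \<le> k}"

definition admissible :: "nat list \<Rightarrow> bool" where
  "admissible ks \<longleftrightarrow> ks \<in> indices \<and> (ks = [] \<or> 1 < last ks)"

text \<open>The order of summation is \<open>1 \<le> n\<^sub>1 < \<dots> < n\<^sub>r\<close>, so convergence is governed by the last component.\<close>

definition mzv :: "nat list \<Rightarrow> real" where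
  "mzv ks = (\<Sum>\<^sub>\<infinity>ns\<in>{ns. length ns = length ks \<and> sorted_wrt (<) ns \<and> (\<forall>n\<in>set ns. 1 \<le> n)}.
               1 / (\<Prod>i<length ks. real (ns ! i) ^ (ks ! i)))"

definition mzv_span :: "real set" where
  "mzv_span = module.span (\<lambda>(c::rat) (x::real). of_rat c * x) {mzv ks |ks. admissible ks}"


section \<open>Free rational vector spaces and bilinear products\<close>

text \<open>The vector space over \<open>\<rat>\<close> with basis \<open>B\<close> is the set of finitely supported maps
  \<^typ>\<open>'w \<Rightarrow>\<^sub>0 rat\<close> with support in \<open>B\<close>.\<close>

definition free_space :: "'w set \<Rightarrow> ('w \<Rightarrow>\<^sub>0 rat) set" where
  "free_space B = {p. Poly_Mapping.keys p \<subseteq> B}"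

definition basis_vec :: "'w \<Rightarrow> 'w \<Rightarrow>\<^sub>0 rat" where
  "basis_vec w = Poly_Mapping.single w 1"

definition scale_vec :: "rat \<Rightarrow> ('w \<Rightarrow>\<^sub>0 rat) \<Rightarrow> 'w \<Rightarrow>\<^sub>0 rat" where
  "scale_vec c p = Poly_Mapping.map ((*) c) p"

definition lift_linear :: "('w \<Rightarrow> 'v) \<Rightarrow> ('w \<Rightarrow>\<^sub>0 rat) \<Rightarrow> 'v \<Rightarrow>\<^sub>0 rat" where
  "lift_linear f p = (\<Sum>w\<in>Poly_Mapping.keys p. scale_vec (Poly_Mapping.lookup p w) (basis_vec (f w)))"

definition lift_bilinear ::
    "('w \<Rightarrow> 'w \<Rightarrow> 'w \<Rightarrow>\<^sub>0 rat) \<Rightarrow> ('w \<Rightarrow>\<^sub>0 rat) \<Rightarrow> ('w \<Rightarrow>\<^sub>0 rat) \<Rightarrow> 'w \<Rightarrow>\<^sub>0 rat" where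
  "lift_bilinear m p q =
     (\<Sum>u\<in>Poly_Mapping.keys p. \<Sum>v\<in>Poly_Mapping.keys q.
        scale_vec (Poly_Mapping.lookup p u * Poly_Mapping.lookup q v) (m u v))"

function harmonic_product :: "nat list \<Rightarrow> nat list \<Rightarrow> nat list \<Rightarrow>\<^sub>0 rat" where
  "harmonic_product ks [] = basis_vec ks"
| "harmonic_product [] (ls @ [l]) = basis_vec (ls @ [l])"
| "harmonic_product (ks @ [k]) (ls @ [l]) =
     lift_linear (\<lambda>w. w @ [k]) (harmonic_product ks (ls @ [l]))
   + lift_linear (\<lambda>w. w @ [k + l]) (harmonic_product ks ls)
   + lift_linear (\<lambda>w. w @ [l]) (harmonic_product (ks @ [k]) ls)"
  subgoal for P x
    by (cases x; cases "fst x" rule: rev_cases; cases "snd x" rule: rev_cases) auto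
  by auto
termination
  by (relation "Wellfounded.measure (\<lambda>(ks, ls). length ks + length ls)") auto

datatype letter = X | Y

fun shuffle_product :: "letter list \<Rightarrow> letter list \<Rightarrow> letter list \<Rightarrow>\<^sub>0 rat" where
  "shuffle_product u [] = basis_vec u"
| "shuffle_product [] (b # v) = basis_vec (b # v)"
| "shuffle_product (a # u) (b # v) =
     lift_linear ((#) a) (shuffle_product u (b # v))
   + lift_linear ((#) b) (shuffle_product (a # u) v)"

definition index_word :: "nat list \<Rightarrow> letter list" where
  "index_word ks = concat (map (\<lambda>k. Y # replicate (k - 1) X) ks)"

text \<open>The monomial basis of \<open>\<rat> + y\<rat>\<langle>x,y\<rangle>\<close>.\<close>

definition index_words :: "letter list set" where
  "index_words = {w. w = [] \<or> hd w = Y}"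


section \<open>Regularized multiple zeta values\<close>

text \<open>The unique linear map on the space with basis \<open>B\<close> that is multiplicative for the product
  \<open>m\<close>, extends \<^const>\<open>mzv\<close> and vanishes at the index \<open>(1)\<close>; \<open>e\<close> identifies indices with elements
  of \<open>B\<close>. Since the map only lives on \<^term>\<open>free_space B\<close>, it is made extensional
  so that it is unique as a HOL function.\<close>

definition is_regularization ::
    "'w set \<Rightarrow> ('w \<Rightarrow> 'w \<Rightarrow> 'w \<Rightarrow>\<^sub>0 rat) \<Rightarrow> (nat list \<Rightarrow> 'w) \<Rightarrow> (('w \<Rightarrow>\<^sub>0 rat) \<Rightarrow> real) \<Rightarrow> bool" where
  "is_regularization B m e Z \<longleftrightarrow>
     Z \<in> free_space B \<rightarrow>\<^sub>E UNIV \<and>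
     (\<forall>p\<in>free_space B. \<forall>q\<in>free_space B. Z (p + q) = Z p + Z q) \<and>
     (\<forall>c. \<forall>p\<in>free_space B. Z (scale_vec c p) = of_rat c * Z p) \<and>
     (\<forall>p\<in>free_space B. \<forall>q\<in>free_space B. Z (lift_bilinear m p q) = Z p * Z q) \<and>
     (\<forall>ks. admissible ks \<longrightarrow> Z (basis_vec (e ks)) = mzv ks) \<and>
     Z (basis_vec (e [1])) = 0"

definition zeta_harmonic :: "nat list \<Rightarrow> real" where
  "zeta_harmonic ks =
     (THE Z. is_regularization indices harmonic_product (\<lambda>ks. ks) Z) (basis_vec ks)"

definition zeta_shuffle :: "nat list \<Rightarrow> real" where
  "zeta_shuffle ks =
     (THE Z. is_regularization index_words shuffle_product index_word Z) (basis_vec (index_word ks))"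

datatype regularization = Harmonic | Shuffle

fun zeta_reg :: "regularization \<Rightarrow> nat list \<Rightarrow> real" where
  "zeta_reg Harmonic = zeta_harmonic"
| "zeta_reg Shuffle = zeta_shuffle"


section \<open>Symmetric multiple zeta values\<close>

definition zeta_reg_shift :: "regularization \<Rightarrow> nat \<Rightarrow> nat list \<Rightarrow> real" where
  "zeta_reg_shift b m ks =
     (\<Sum>ls\<in>{ls. length ls = length ks \<and> sum_list ls = m}.
        zeta_reg b (map2 (+) ks ls) *
        (\<Prod>i<length ks. real ((ks ! i + ls ! i - 1) choose (ls ! i))))"

definition zeta_S_hat :: "regularization \<Rightarrow> nat list \<Rightarrow> real fps" where
  "zeta_S_hat b ks =
     (\<Sum>i\<le>length ks.
        fps_const ((- 1) ^ sum_list (drop i ks) * zeta_reg b (take i ks)) *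
        Abs_fps (\<lambda>m. zeta_reg_shift b m (rev (drop i ks))))"

definition mzv_fps_ring :: "real fps ring" where
  "mzv_fps_ring =
     \<lparr>carrier = {f. \<forall>n. fps_nth f n \<in> mzv_span}, mult = (*), one = 1, zero = 0, add = (+)\<rparr>"

definition t_ideal :: "nat \<Rightarrow> real fps set" where
  "t_ideal m = PIdl\<^bsub>mzv_fps_ring\<^esub> (fps_X ^ m)"

definition mod_t :: "nat \<Rightarrow> real fps \<Rightarrow> real fps set" where
  "mod_t m f = t_ideal m +>\<^bsub>mzv_fps_ring\<^esub> f"

definition zeta_S :: "regularization \<Rightarrow> nat \<Rightarrow> nat list \<Rightarrow> real fps set" where
  "zeta_S b m ks = mod_t m (zeta_S_hat b ks)"

text \<open>Riemann zeta values at positive integers, with the convention \<open>\<zeta>(1) = 0\<close>.\<close>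

definition riemann_zeta :: "nat \<Rightarrow> real" where
  "riemann_zeta k = (if k = 1 then 0 else suminf (\<lambda>n. 1 / real (Suc n) ^ k))"

end

theory Submission
  imports Defs "HOL-Computational_Algebra.Formal_Laurent_Series"
begin

unbundle no vec_syntax
unbundle fps_syntax

text \<open>The \<open>t\<^sup>m\<close>-coefficient of the symmetric multiple zeta value of an index is the regularized
  iterated integral of its word followed by \<open>y x\<^sup>m\<close> along a loop at \<open>0\<close> around \<open>1\<close>, so it is read
  off the logarithm of the monodromy at \<open>1\<close>. For \<open>{3,1}\<^sup>n\<close> the words are factors of
  \<open>\<dots>yyxxyyxx\<dots>\<close>; their generating series solve a four-dimensional linear system, which is the
  tensor product of the two-dimensional system of the alternating words \<open>\<dots>yxyx\<dots>\<close> with its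
  conjugate. Hence the coefficients of \<open>1\<close>, \<open>t\<close>, \<open>t\<^sup>2\<close> are products of two series of alternating
  words, that is, of the indices \<open>{2}\<^sup>j\<close> and of their first order deformations. These are evaluated by
  the product \<open>\<Prod> (1 + s/(n - t)\<^sup>2)\<close> and Euler's sine product. The harmonic and shuffle
  regularizations agree on all indices that occur, because each of them is admissible
  or becomes so when its last entry is removed.\<close>

section \<open>Linear extensions\<close>

text \<open>The single terms of the defining sum are never evaluated. All cancellation takes place
  at a fixed \<open>0 < z < 1\<close>, where the Wronskian removes the mixed products; only then
  \<open>z\<close> tends to 1, by passing to constant terms of expansions in -log(1 - z), an
  operation compatible with products. The limit therefore has to be known for alternating words
  alone. Both regularizations are given by a characterization only, so each has to be constructed:
  as the constant term of truncated sums expanded in harmonic numbers, and of polylogarithms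
  expanded in -log(1 - z). At the other end the form dz/z is singular, so a solution of a
  differential system has no initial value at 0. It is pinned down by its asymptotics modulo terms
  smaller than every power of log z. The Leibniz rule gives the four equations of the tensor product
  the factors 1, -2s, s and 2. Their product -4 s^2 belongs to one period of four letters, which is
  why \<open>n\<close> periods sit at s^(2n) and carry (-4)^n.\<close>

abbreviation "keys \<equiv> Poly_Mapping.keys"

abbreviation "lookup \<equiv> Poly_Mapping.lookup"

definition lin_ext :: "('w \<Rightarrow> real) \<Rightarrow> ('w \<Rightarrow>\<^sub>0 rat) \<Rightarrow> real" where
  "lin_ext f p = (\<Sum>w\<in>keys p. of_rat (lookup p w) * f w)"

lemma lin_ext_superset:
  assumes "finite A" "keys p \<subseteq> A"
  shows "lin_ext f p = (\<Sum>w\<in>A. of_rat (lookup p w) * f w)"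
  unfolding lin_ext_def using assms by (intro sum.mono_neutral_left) (auto simp: in_keys_iff)

lemma lin_ext_add: "lin_ext f (p + q) = lin_ext f p + lin_ext f q"
proof -
  let ?A = "keys p \<union> keys q"
  have "keys (p + q) \<subseteq> ?A" by (rule Poly_Mapping.keys_add)
  then show ?thesis
    by (simp add: lin_ext_superset[of ?A] lookup_add of_rat_add distrib_right sum.distrib)
qed

lemma lin_ext_zero [simp]: "lin_ext f 0 = 0"
  by (simp add: lin_ext_def)

lemma lookup_scale_vec [simp]: "lookup (scale_vec c p) w = c * lookup p w"
  by (simp add: scale_vec_def Poly_Mapping.map.rep_eq when_def)

lemma keys_scale_vec: "keys (scale_vec c p) \<subseteq> keys p"
  by (auto simp: in_keys_iff)

lemma lin_ext_scale_vec: "lin_ext f (scale_vec c p) = of_rat c * lin_ext f p"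
  by (subst lin_ext_superset[OF _ keys_scale_vec])
     (simp_all add: lin_ext_def of_rat_mult sum_distrib_left mult.assoc)

lemma lin_ext_basis_vec [simp]: "lin_ext f (basis_vec w) = f w"
  by (simp add: lin_ext_def basis_vec_def)

lemma lin_ext_sum: "lin_ext f (sum g A) = (\<Sum>a\<in>A. lin_ext f (g a))"
  by (induction A rule: infinite_finite_induct) (simp_all add: lin_ext_add)

lemma lin_ext_lift_linear: "lin_ext f (lift_linear g p) = lin_ext (\<lambda>w. f (g w)) p"
  by (simp add: lift_linear_def lin_ext_sum lin_ext_scale_vec lin_ext_def[of _ p])

lemma lin_ext_lift_bilinear:
  "lin_ext f (lift_bilinear m p q) =
     (\<Sum>u\<in>keys p. \<Sum>v\<in>keys q.
        of_rat (lookup p u) * of_rat (lookup q v) * lin_ext f (m u v))"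
  by (simp add: lift_bilinear_def lin_ext_sum lin_ext_scale_vec of_rat_mult)

lemma lin_ext_lift_bilinear_mult:
  assumes "\<And>u v. u \<in> keys p \<Longrightarrow> v \<in> keys q \<Longrightarrow> lin_ext f (m u v) = f u * f v"
  shows "lin_ext f (lift_bilinear m p q) = lin_ext f p * lin_ext f q"
proof -
  have "lin_ext f (lift_bilinear m p q) = (\<Sum>u\<in>keys p. \<Sum>v\<in>keys q.
        (of_rat (lookup p u) * f u) * (of_rat (lookup q v) * f v))"
    unfolding lin_ext_lift_bilinear using assms by (intro sum.cong refl) simp
  then show ?thesis by (simp add: lin_ext_def sum_product)
qed

lemma keys_lift_linear: "keys (lift_linear g p) \<subseteq> g ` keys p"
proof -
  have "keys (lift_linear g p) \<subseteq>
      (\<Union>w\<in>keys p. keys (scale_vec (lookup p w) (basis_vec (g w))))"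
    unfolding lift_linear_def by (rule Poly_Mapping.keys_sum)
  also have "\<dots> \<subseteq> (\<Union>w\<in>keys p. {g w})"
    using keys_scale_vec by (intro UN_mono) (fastforce simp: basis_vec_def)+
  finally show ?thesis by auto
qed

lemma keys_lift_bilinear:
  "keys (lift_bilinear m p q) \<subseteq>
     (\<Union>u\<in>keys p. \<Union>v\<in>keys q. keys (m u v))"
proof -
  have "keys (lift_bilinear m p q) \<subseteq> (\<Union>u\<in>keys p.
     keys (\<Sum>v\<in>keys q.
        scale_vec (lookup p u * lookup q v) (m u v)))"
    unfolding lift_bilinear_def by (rule Poly_Mapping.keys_sum)
  also have "\<dots> \<subseteq> (\<Union>u\<in>keys p. \<Union>v\<in>keys q.
        keys (scale_vec (lookup p u * lookup q v) (m u v)))"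
    by (intro UN_mono order_refl Poly_Mapping.keys_sum)
  also have "\<dots> \<subseteq> (\<Union>u\<in>keys p. \<Union>v\<in>keys q. keys (m u v))"
    by (intro UN_mono order_refl keys_scale_vec)
  finally show ?thesis .
qed

section \<open>The rational span of the multiple zeta values\<close>

interpretation rat_real: vector_space "\<lambda>(c::rat) (x::real). of_rat c * x"
  by unfold_locales (simp_all add: algebra_simps of_rat_add of_rat_mult)

lemma mzv_span_base: "admissible ks \<Longrightarrow> mzv ks \<in> mzv_span"
  unfolding mzv_span_def by (rule rat_real.span_base) auto

lemma mzv_span_add: "x \<in> mzv_span \<Longrightarrow> y \<in> mzv_span \<Longrightarrow> x + y \<in> mzv_span"
  unfolding mzv_span_def by (rule rat_real.span_add)

lemma mzv_span_zero [simp]: "0 \<in> mzv_span"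
  unfolding mzv_span_def by (rule rat_real.span_zero)

lemma mzv_span_scale: "x \<in> mzv_span \<Longrightarrow> of_rat c * x \<in> mzv_span"
  unfolding mzv_span_def by (rule rat_real.span_scale)

lemma mzv_span_sum: "(\<And>a. a \<in> A \<Longrightarrow> f a \<in> mzv_span) \<Longrightarrow> sum f A \<in> mzv_span"
  unfolding mzv_span_def by (rule rat_real.span_sum)

lemma mzv_span_lin_ext:
  "(\<And>w. w \<in> keys p \<Longrightarrow> f w \<in> mzv_span) \<Longrightarrow> lin_ext f p \<in> mzv_span"
  unfolding lin_ext_def by (intro mzv_span_sum mzv_span_scale)

section \<open>Regularized values\<close>

text \<open>Plain convergence to 0 would not survive multiplication by the divergent scale
  \<open>L\<close>. Smallness against all powers of \<open>L\<close> does, and this makes constant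
  terms multiplicative in \<open>has_reg_mult\<close>.\<close>

definition negligible_wrt :: "'p filter \<Rightarrow> ('p \<Rightarrow> real) \<Rightarrow> ('p \<Rightarrow> real) \<Rightarrow> bool" where
  "negligible_wrt F L g \<longleftrightarrow> (\<forall>j. ((\<lambda>x. g x * L x ^ j) \<longlongrightarrow> 0) F)"

text \<open>\<open>c\<close> is the constant term of an asymptotic expansion of \<open>f\<close>
  that is a polynomial in \<open>L\<close>. Sending \<open>L\<close> itself to 0 is the
  normalization of both regularizations at the index (1).\<close>

definition has_reg :: "'p filter \<Rightarrow> ('p \<Rightarrow> real) \<Rightarrow> ('p \<Rightarrow> real) \<Rightarrow> real \<Rightarrow> bool" where
  "has_reg F L f c \<longleftrightarrow> (\<exists>P. poly P 0 = c \<and> negligible_wrt F L (\<lambda>x. f x - poly P (L x)))"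

lemma negligible_wrt_zero [simp]: "negligible_wrt F L (\<lambda>x. 0)"
  by (simp add: negligible_wrt_def)

lemma negligible_wrt_tendsto: "negligible_wrt F L g \<Longrightarrow> (g \<longlongrightarrow> 0) F"
  unfolding negligible_wrt_def by (drule spec[of _ 0]) simp

lemma negligible_wrt_add:
  "negligible_wrt F L f \<Longrightarrow> negligible_wrt F L g \<Longrightarrow> negligible_wrt F L (\<lambda>x. f x + g x)"
  unfolding negligible_wrt_def distrib_right by (auto intro: tendsto_add_zero)

lemma negligible_wrt_mult_poly:
  assumes "negligible_wrt F L f"
  shows "negligible_wrt F L (\<lambda>x. f x * poly P (L x))"
proof (induction P)
  case (pCons a P)
  have "((\<lambda>x. a * (f x * L x ^ j) + f x * poly P (L x) * L x ^ Suc j) \<longlongrightarrow> a * 0 + 0) F" for j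
    using assms pCons.IH unfolding negligible_wrt_def by (intro tendsto_add tendsto_mult tendsto_const) (auto simp del: power_Suc)
  moreover have "(\<lambda>x. f x * poly (pCons a P) (L x) * L x ^ j)
      = (\<lambda>x. a * (f x * L x ^ j) + f x * poly P (L x) * L x ^ Suc j)" for j
    by (rule ext) (simp add: algebra_simps)
  ultimately show ?case
    unfolding negligible_wrt_def by (simp only: mult_zero_right add_0_left simp_thms)
qed simp

lemma negligible_wrt_mult:
  assumes "negligible_wrt F L f" "(g \<longlongrightarrow> c) F"
  shows "negligible_wrt F L (\<lambda>x. f x * g x)"
proof -
  have "((\<lambda>x. (f x * L x ^ j) * g x) \<longlongrightarrow> 0 * c) F" for j
    using assms unfolding negligible_wrt_def by (intro tendsto_mult) auto
  then show ?thesis by (simp add: negligible_wrt_def mult_ac)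
qed

lemma negligible_wrt_exp_bound:
  assumes L: "filterlim L at_top F" and "d > 0"
    and bound: "eventually (\<lambda>x. \<bar>g x\<bar> \<le> C * exp (- d * L x)) F"
  shows "negligible_wrt F L g"
  unfolding negligible_wrt_def
proof
  fix j
  have dL: "filterlim (\<lambda>x. d * L x) at_top F"
    using L \<open>d > 0\<close> by (intro filterlim_tendsto_pos_mult_at_top[OF tendsto_const])
  have "((\<lambda>x. (d * L x) ^ j / exp (d * L x)) \<longlongrightarrow> 0) F"
    by (rule filterlim_compose[OF tendsto_power_div_exp_0 dL])
  then have "((\<lambda>x. (C / d ^ j) * ((d * L x) ^ j / exp (d * L x))) \<longlongrightarrow> (C / d ^ j) * 0) F"
    by (intro tendsto_intros)
  then have lim: "((\<lambda>x. C * exp (- d * L x) * L x ^ j) \<longlongrightarrow> 0) F"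
    using \<open>d > 0\<close> by (simp add: power_mult_distrib exp_minus field_simps)
  have "eventually (\<lambda>x. L x \<ge> 0) F"
    using L by (simp add: filterlim_at_top)
  with bound have "eventually (\<lambda>x. norm (g x * L x ^ j) \<le> C * exp (- d * L x) * L x ^ j) F"
    by eventually_elim (auto simp: abs_mult intro!: mult_right_mono)
  then show "((\<lambda>x. g x * L x ^ j) \<longlongrightarrow> 0) F"
    using lim by (rule Lim_null_comparison)
qed

lemma has_reg_const: "has_reg F L (\<lambda>x. c) c"
  unfolding has_reg_def by (rule exI[of _ "[:c:]"]) simp

lemma has_reg_self: "has_reg F L L 0"
  unfolding has_reg_def by (rule exI[of _ "[:0, 1:]"]) simp

lemma has_reg_negligible: "negligible_wrt F L (\<lambda>x. f x - c) \<Longrightarrow> has_reg F L f c"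
  unfolding has_reg_def by (rule exI[of _ "[:c:]"]) simp

lemma has_reg_cong:
  assumes "eventually (\<lambda>x. f x = g x) F"
  shows "has_reg F L f c \<longleftrightarrow> has_reg F L g c"
proof -
  have "((\<lambda>x. (f x - poly P (L x)) * L x ^ j) \<longlongrightarrow> 0) F
      \<longleftrightarrow> ((\<lambda>x. (g x - poly P (L x)) * L x ^ j) \<longlongrightarrow> 0) F" for P j
    using assms by (intro tendsto_cong) (auto elim: eventually_mono)
  then show ?thesis by (simp add: has_reg_def negligible_wrt_def)
qed

lemma has_reg_add:
  assumes "has_reg F L f a" "has_reg F L g b"
  shows "has_reg F L (\<lambda>x. f x + g x) (a + b)"
proof -
  obtain P Q where *: "poly P 0 = a" "negligible_wrt F L (\<lambda>x. f x - poly P (L x))"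
    "poly Q 0 = b" "negligible_wrt F L (\<lambda>x. g x - poly Q (L x))"
    using assms unfolding has_reg_def by blast
  have "negligible_wrt F L (\<lambda>x. f x + g x - poly (P + Q) (L x))"
    using negligible_wrt_add[OF *(2,4)] by (simp add: algebra_simps)
  with * show ?thesis unfolding has_reg_def by (intro exI[of _ "P + Q"]) simp
qed

lemma has_reg_mult:
  assumes "has_reg F L f a" "has_reg F L g b"
  shows "has_reg F L (\<lambda>x. f x * g x) (a * b)"
proof -
  obtain P Q where *: "poly P 0 = a" "negligible_wrt F L (\<lambda>x. f x - poly P (L x))"
    "poly Q 0 = b" "negligible_wrt F L (\<lambda>x. g x - poly Q (L x))"
    using assms unfolding has_reg_def by blast
  have "negligible_wrt F L (\<lambda>x. (f x - poly P (L x)) * (g x - poly Q (L x))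
      + ((f x - poly P (L x)) * poly Q (L x) + (g x - poly Q (L x)) * poly P (L x)))"
    by (intro negligible_wrt_add negligible_wrt_mult_poly
          negligible_wrt_mult[OF *(2) negligible_wrt_tendsto[OF *(4)]] *(2,4))
  then have "negligible_wrt F L (\<lambda>x. f x * g x - poly (P * Q) (L x))"
    by (simp add: algebra_simps)
  with * show ?thesis unfolding has_reg_def by (intro exI[of _ "P * Q"]) simp
qed

lemma has_reg_cmult: "has_reg F L f a \<Longrightarrow> has_reg F L (\<lambda>x. c * f x) (c * a)"
  by (intro has_reg_mult has_reg_const)

lemma has_reg_diff:
  "has_reg F L f a \<Longrightarrow> has_reg F L g b \<Longrightarrow> has_reg F L (\<lambda>x. f x - g x) (a - b)"
  using has_reg_add[of F L f a "\<lambda>x. (-1) * g x" "(-1) * b"] has_reg_cmult[of F L g b "-1"] by simp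

lemma has_reg_sum:
  "(\<And>i. i \<in> A \<Longrightarrow> has_reg F L (f i) (c i)) \<Longrightarrow> has_reg F L (\<lambda>x. \<Sum>i\<in>A. f i x) (\<Sum>i\<in>A. c i)"
  by (induction A rule: infinite_finite_induct) (simp_all add: has_reg_add has_reg_const)

lemma has_reg_lin_ext:
  "(\<And>w. w \<in> keys p \<Longrightarrow> has_reg F L (f w) (c w)) \<Longrightarrow>
     has_reg F L (\<lambda>x. lin_ext (\<lambda>w. f w x) p) (lin_ext c p)"
  unfolding lin_ext_def by (intro has_reg_sum has_reg_cmult)

text \<open>A polynomial evaluated along \<open>L\<close> tending to infinity can have a finite
  limit only if it is constant. Applied to a difference, this shows that the constant term is well
  defined.\<close>

lemma has_reg_unique:
  assumes "F \<noteq> bot" "filterlim L at_top F" "has_reg F L f a" "(f \<longlongrightarrow> b) F"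
  shows "a = b"
proof -
  obtain P where P: "poly P 0 = a" "negligible_wrt F L (\<lambda>x. f x - poly P (L x))"
    using assms(3) unfolding has_reg_def by blast
  have "((\<lambda>x. f x - (f x - poly P (L x))) \<longlongrightarrow> b - 0) F"
    by (intro tendsto_diff assms negligible_wrt_tendsto[OF P(2)])
  then have lim: "((\<lambda>x. poly P (L x)) \<longlongrightarrow> b) F" by simp
  have "degree P = 0"
  proof (rule ccontr)
    assume "degree P \<noteq> 0"
    then have "filterlim (poly P) at_infinity at_top"
      using filterlim_poly_at_infinity[of P] at_top_le_at_infinity
      by (auto intro: filterlim_mono)
    with assms(2) have "filterlim (\<lambda>x. poly P (L x)) at_infinity F"
      by (rule filterlim_compose[rotated])
    then show False using lim assms(1) not_tendsto_and_filterlim_at_infinity by blast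
  qed
  then obtain k where "P = [:k:]" by (auto elim: degree_eq_zeroE)
  with lim P(1) assms(1) show ?thesis by (simp add: tendsto_const_iff)
qed

lemma has_reg_unique':
  assumes "F \<noteq> bot" "filterlim L at_top F" "has_reg F L f a" "has_reg F L f b"
  shows "a = b"
  using has_reg_unique[OF assms(1,2) has_reg_diff[OF assms(3,4)], of 0] by simp


section \<open>Existence and uniqueness of regularizations\<close>

text \<open>The level counts trailing ones: multiplying by the index \<open>(1)\<close> raises it by one, up to terms of
  lower level, which determines a regularization from its values at admissible indices.\<close>

locale regularization_model =
  fixes B :: "'w set" and m :: "'w \<Rightarrow> 'w \<Rightarrow> 'w \<Rightarrow>\<^sub>0 rat" and e :: "nat list \<Rightarrow> 'w"
    and lev :: "'w \<Rightarrow> nat"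
    and F :: "'p filter" and L :: "'p \<Rightarrow> real" and \<Phi> :: "'w \<Rightarrow> 'p \<Rightarrow> real"
  assumes nontriv: "F \<noteq> bot" and L_at_top: "filterlim L at_top F"
    and keys_m: "\<And>u v. u \<in> B \<Longrightarrow> v \<in> B \<Longrightarrow> keys (m u v) \<subseteq> B"
    and \<Phi>_mult: "\<And>u v. u \<in> B \<Longrightarrow> v \<in> B \<Longrightarrow>
          eventually (\<lambda>x. lin_ext (\<lambda>w. \<Phi> w x) (m u v) = \<Phi> u x * \<Phi> v x) F"
    and e_B: "\<And>ks. admissible ks \<Longrightarrow> e ks \<in> B"
    and e_one: "e [1] \<in> B"
    and \<Phi>_one: "eventually (\<lambda>x. \<Phi> (e [1]) x = L x) F"
    and \<Phi>_adm: "\<And>ks. admissible ks \<Longrightarrow> has_reg F L (\<Phi> (e ks)) (mzv ks)"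
    and lev_zero: "\<And>w. w \<in> B \<Longrightarrow> lev w = 0 \<Longrightarrow> \<exists>ks. admissible ks \<and> w = e ks"
    and lev_Suc: "\<And>w s. w \<in> B \<Longrightarrow> lev w = Suc s \<Longrightarrow>
          \<exists>u\<in>B. lev u \<le> s \<and> lookup (m u (e [1])) w \<noteq> 0 \<and>
             (\<forall>v\<in>keys (m u (e [1])). v \<noteq> w \<longrightarrow> lev v \<le> s)"
begin

definition regv :: "'w \<Rightarrow> real" where
  "regv w = (THE c. has_reg F L (\<Phi> w) c)"

lemma regv_eq: "has_reg F L (\<Phi> w) c \<Longrightarrow> regv w = c"
  unfolding regv_def using has_reg_unique'[OF nontriv L_at_top] by blast

text \<open>With \<open>p = m u (e [1])\<close> this isolates the single word of highest level. The
  same equation yields existence of the expansion, uniqueness of the regularization and membership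
  of its values in \<open>mzv_span\<close>.\<close>

lemma solve_top:
  assumes "w \<in> keys p"
  shows "f w = (lin_ext f p -
     (\<Sum>v\<in>keys p - {w}. of_rat (lookup p v) * f v)) /
       of_rat (lookup p w)"
  using assms by (simp add: lin_ext_def sum.remove[of _ w] in_keys_iff)

text \<open>A word of positive level is the top word of a product by \<open>e [1]\<close>. The other
  factor \<open>u\<close> and all remaining words of that product have lower level, so a property
  passes upwards once it is stable under solving the product for its top word.\<close>

lemma lev_induct [consumes 1, case_names admissible step]:
  assumes "w \<in> B"
    and adm: "\<And>ks. admissible ks \<Longrightarrow> P (e ks)"
    and step: "\<And>w u. w \<in> B \<Longrightarrow> u \<in> B \<Longrightarrow> P u \<Longrightarrow> w \<in> keys (m u (e [1])) \<Longrightarrow>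
       (\<And>v. v \<in> keys (m u (e [1])) \<Longrightarrow> v \<noteq> w \<Longrightarrow> P v) \<Longrightarrow> P w"
  shows "P w"
  using assms(1)
proof (induction "lev w" arbitrary: w rule: less_induct)
  case less
  show ?case
  proof (cases "lev w")
    case 0
    with lev_zero less.prems adm show ?thesis by blast
  next
    case (Suc s)
    then obtain u where u: "u \<in> B" "lev u \<le> s" "lookup (m u (e [1])) w \<noteq> 0"
      "\<And>v. v \<in> keys (m u (e [1])) \<Longrightarrow> v \<noteq> w \<Longrightarrow> lev v \<le> s"
      using lev_Suc less.prems by blast
    show ?thesis
    proof (rule step[OF less.prems u(1)])
      show "P u" using less.hyps u(1,2) Suc by auto
      show "w \<in> keys (m u (e [1]))" using u(3) by (simp add: in_keys_iff)
      show "P v" if "v \<in> keys (m u (e [1]))" "v \<noteq> w" for v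
        using less.hyps u(4)[OF that] keys_m[OF u(1) e_one] Suc that(1) by auto
    qed
  qed
qed

lemma has_reg_regv:
  assumes "w \<in> B" shows "has_reg F L (\<Phi> w) (regv w)"
proof -
  have "\<exists>c. has_reg F L (\<Phi> w) c"
    using assms
  proof (induction w rule: lev_induct)
    case (step w u)
    define p where "p = m u (e [1])"
    have "\<forall>v\<in>keys p - {w}. \<exists>c. has_reg F L (\<Phi> v) c"
      using step by (auto simp: p_def)
    then obtain c where c: "\<And>v. v \<in> keys p - {w} \<Longrightarrow> has_reg F L (\<Phi> v) (c v)"
      by metis
    from step obtain a where a: "has_reg F L (\<Phi> u) a" by blast
    \<comment> \<open>The factor \<open>a * 0\<close> is the constant term of
      \<open>\<Phi> u x * L x\<close>, because \<open>L\<close> has constant term 0.\<close>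
    have 1: "has_reg F L (\<lambda>x. (1 / of_rat (lookup p w)) * (\<Phi> u x * L x -
       (\<Sum>v\<in>keys p - {w}. of_rat (lookup p v) * \<Phi> v x)))
       ((1 / of_rat (lookup p w)) * (a * 0 -
       (\<Sum>v\<in>keys p - {w}. of_rat (lookup p v) * c v)))"
      by (intro has_reg_cmult has_reg_diff has_reg_mult has_reg_sum a c has_reg_self)
    have "eventually (\<lambda>x. \<Phi> w x = (1 / of_rat (lookup p w)) * (\<Phi> u x * L x -
       (\<Sum>v\<in>keys p - {w}. of_rat (lookup p v) * \<Phi> v x))) F"
      using \<Phi>_mult[OF \<open>u \<in> B\<close> e_one] \<Phi>_one
    proof eventually_elim
      case (elim x)
      show ?case
        by (subst solve_top[of w p]) (use elim step in \<open>simp_all add: p_def\<close>)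
    qed
    from has_reg_cong[OF this] 1 show ?case by blast
  qed (use \<Phi>_adm in blast)
  then show ?thesis using regv_eq by auto
qed

lemma regv_admissible: "admissible ks \<Longrightarrow> regv (e ks) = mzv ks"
  by (rule regv_eq[OF \<Phi>_adm])

lemma regv_one: "regv (e [1]) = 0"
  by (rule regv_eq) (simp only: has_reg_cong[OF \<Phi>_one] has_reg_self)

lemma regv_mult:
  assumes "u \<in> B" "v \<in> B"
  shows "lin_ext regv (m u v) = regv u * regv v"
proof -
  have "has_reg F L (\<lambda>x. lin_ext (\<lambda>w. \<Phi> w x) (m u v)) (lin_ext regv (m u v))"
    using keys_m[OF assms] by (intro has_reg_lin_ext has_reg_regv) auto
  moreover have "has_reg F L (\<lambda>x. lin_ext (\<lambda>w. \<Phi> w x) (m u v)) (regv u * regv v)"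
    unfolding has_reg_cong[OF \<Phi>_mult[OF assms]] by (intro has_reg_mult has_reg_regv assms)
  ultimately show ?thesis using has_reg_unique'[OF nontriv L_at_top] by blast
qed

lemma regv_unique:
  assumes "w \<in> B"
    and "\<And>ks. admissible ks \<Longrightarrow> f (e ks) = mzv ks" "f (e [1]) = 0"
    and mult: "\<And>u v. u \<in> B \<Longrightarrow> v \<in> B \<Longrightarrow> lin_ext f (m u v) = f u * f v"
  shows "f w = regv w"
  using assms(1)
proof (induction w rule: lev_induct)
  case (admissible ks)
  then show ?case by (simp add: assms regv_admissible)
next
  case (step w u)
  then show ?case
    by (simp add: solve_top[of w "m u (e [1])" f] solve_top[of w "m u (e [1])" regv]
        mult regv_mult e_one regv_one assms del: One_nat_def)
qed

lemma regv_in_span: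
  assumes "w \<in> B" shows "regv w \<in> mzv_span"
  using assms
proof (induction w rule: lev_induct)
  case (admissible ks)
  then show ?case by (simp add: regv_admissible mzv_span_base)
next
  case (step w u)
  define p where "p = m u (e [1])"
  have "(\<Sum>v\<in>keys p - {w}. of_rat (lookup p v) * regv v) \<in> mzv_span"
    using step by (intro mzv_span_sum mzv_span_scale) (auto simp: p_def)
  from mzv_span_scale[OF this, of "- 1 / lookup p w"] show ?case
    using step by (subst solve_top[of w p regv])
      (simp_all add: p_def regv_mult e_one regv_one of_rat_divide of_rat_minus del: One_nat_def)
qed

section \<open>From values on words to linear maps on the free space\<close>

lemma mem_free_space_iff: "p \<in> free_space B \<longleftrightarrow> keys p \<subseteq> B"
  by (simp add: free_space_def)

lemma add_free_space: "p \<in> free_space B \<Longrightarrow> q \<in> free_space B \<Longrightarrow> p + q \<in> free_space B"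
  unfolding mem_free_space_iff using Poly_Mapping.keys_add[of p q] by blast

lemma scale_vec_free_space: "p \<in> free_space B \<Longrightarrow> scale_vec c p \<in> free_space B"
  unfolding mem_free_space_iff using keys_scale_vec by fast

lemma basis_vec_free_space: "basis_vec w \<in> free_space B \<longleftrightarrow> w \<in> B"
  by (simp add: mem_free_space_iff basis_vec_def)

lemma lift_bilinear_free_space:
  assumes "p \<in> free_space B" "q \<in> free_space B"
  shows "lift_bilinear m p q \<in> free_space B"
  using assms keys_m keys_lift_bilinear[of m p q] unfolding mem_free_space_iff by blast

lemma linear_eq_lin_ext:
  assumes add: "\<And>p q. p \<in> free_space B \<Longrightarrow> q \<in> free_space B \<Longrightarrow> Z (p + q) = Z p + Z q"
    and scale: "\<And>c p. p \<in> free_space B \<Longrightarrow> Z (scale_vec c p) = of_rat c * Z p"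
    and "p \<in> free_space B"
  shows "Z p = lin_ext (\<lambda>w. Z (basis_vec w)) p"
proof -
  define g where "g w = scale_vec (lookup p w) (basis_vec w)" for w
  have zero: "(0 :: 'w \<Rightarrow>\<^sub>0 rat) \<in> free_space B" by (simp add: mem_free_space_iff)
  have g: "g w \<in> free_space B" if "w \<in> keys p" for w
    using that assms(3) unfolding g_def mem_free_space_iff[of p]
    by (intro scale_vec_free_space) (auto simp: basis_vec_free_space)
  have sum: "sum g A \<in> free_space B \<and> Z (sum g A) = (\<Sum>w\<in>A. Z (g w))"
    if "finite A" "A \<subseteq> keys p" for A
    using that
  proof (induction A rule: finite_induct)
    case empty
    show ?case using add[OF zero zero] zero by simp
  next
    case (insert w A)
    then show ?case using add[of "g w" "sum g A"] g[of w] add_free_space by auto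
  qed
  have "p = sum g (keys p)"
  proof (rule poly_mapping_eqI)
    fix w
    show "lookup p w = lookup (sum g (keys p)) w"
      by (simp add: g_def lookup_sum basis_vec_def lookup_single when_def in_keys_iff
          mult_delta_right sum.delta)
  qed
  then have "Z p = (\<Sum>w\<in>keys p. Z (g w))" using sum[of "keys p"] by simp
  also have "\<dots> = lin_ext (\<lambda>w. Z (basis_vec w)) p"
    unfolding lin_ext_def g_def using assms(3)
unfolding mem_free_space_iff[of p]
    by (intro sum.cong refl scale) (auto simp: basis_vec_free_space)
  finally show ?thesis .
qed

text \<open>The linear extension of \<open>regv\<close>, cut off outside
  \<open>free_space B\<close>, is a regularization. Any other one is determined on basis vectors by
  \<open>regv_unique\<close>, hence everywhere on the free space by linearity and outside it by
  extensionality.\<close>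

theorem the_regularization:
  assumes "w \<in> B"
  shows "(THE Z. is_regularization B m e Z) (basis_vec w) = regv w"
proof -
  define R where "R = restrict (lin_ext regv) (free_space B)"
  have R: "is_regularization B m e R"
    unfolding is_regularization_def
  proof (intro conjI ballI allI impI)
    have R: "R p = lin_ext regv p" if "p \<in> free_space B" for p
      using that by (simp add: R_def)
    show "R \<in> free_space B \<rightarrow>\<^sub>E UNIV" by (simp add: R_def)
    show "R (basis_vec (e [1])) = 0"
      by (simp add: R basis_vec_free_space e_one regv_one del: One_nat_def)
    show "R (basis_vec (e ks)) = mzv ks" if "admissible ks" for ks
      using that by (simp add: R basis_vec_free_space e_B regv_admissible)
    fix p assume p: "p \<in> free_space B"
    show "R (scale_vec c p) = of_rat c * R p" for c
      using p by (simp add: R scale_vec_free_space lin_ext_scale_vec)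
    fix q assume q: "q \<in> free_space B"
    show "R (p + q) = R p + R q"
      using p q by (simp add: R add_free_space lin_ext_add)
    have "lin_ext regv (lift_bilinear m p q) = lin_ext regv p * lin_ext regv q"
      using p q unfolding mem_free_space_iff by (intro lin_ext_lift_bilinear_mult regv_mult) auto
    then show "R (lift_bilinear m p q) = R p * R q"
      using p q by (simp add: R lift_bilinear_free_space)
  qed
  moreover have "Z = R" if Z: "is_regularization B m e Z" for Z
  proof (rule PiE_ext[of Z "free_space B" "\<lambda>_. UNIV"])
    show "Z \<in> free_space B \<rightarrow>\<^sub>E UNIV" "R \<in> free_space B \<rightarrow>\<^sub>E UNIV"
      using Z R by (simp_all add: is_regularization_def)
    fix p assume p: "p \<in> free_space B"
    have lin: "Z q = lin_ext (\<lambda>w. Z (basis_vec w)) q" if "q \<in> free_space B" for q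
      using Z that by (intro linear_eq_lin_ext) (auto simp: is_regularization_def)
    have basis: "lift_bilinear m (basis_vec u) (basis_vec v) = m u v" for u v
      by (rule poly_mapping_eqI) (simp add: lift_bilinear_def basis_vec_def)
    have "Z (basis_vec v) = regv v" if "v \<in> B" for v
    proof (rule regv_unique[OF that])
      fix u v assume uv: "u \<in> B" "v \<in> B"
      then have "Z (lift_bilinear m (basis_vec u) (basis_vec v)) = Z (basis_vec u) * Z (basis_vec v)"
        using Z by (simp add: is_regularization_def basis_vec_free_space)
      then show "lin_ext (\<lambda>w. Z (basis_vec w)) (m u v) = Z (basis_vec u) * Z (basis_vec v)"
        unfolding basis using lin[of "m u v"] keys_m[OF uv] by (simp add: mem_free_space_iff)
    qed (use Z in \<open>auto simp: is_regularization_def\<close>)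
    with p have "lin_ext (\<lambda>w. Z (basis_vec w)) p = lin_ext regv p"
      unfolding lin_ext_def mem_free_space_iff by (intro sum.cong) auto
    with p show "Z p = R p"
      unfolding lin[OF p] by (simp add: R_def)
  qed
  ultimately have "(THE Z. is_regularization B m e Z) = R" by (intro the_equality)
  then show ?thesis using assms by (simp add: R_def basis_vec_free_space)
qed

end


section \<open>Coefficients of multiple polylogarithms\<close>

text \<open>\<open>fps_X\<close> plays the part of t, by which all summation variables are shifted:
  \<open>Y\<close> opens a new variable n above the previous ones, and each letter divides by n - t.
  So \<open>word_coeff w n\<close> sums 1/((n_1 - t)^k_1 ... (n_r - t)^k_r) over the tuples with
  largest entry n.\<close>

definition word_step :: "letter \<Rightarrow> (nat \<Rightarrow> real fps) \<Rightarrow> nat \<Rightarrow> real fps" where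
  "word_step a f n = (case a of X \<Rightarrow> f n | Y \<Rightarrow> (\<Sum>k<n. f k)) * inverse (fps_const (real n) - fps_X)"

text \<open>The indicator of 0 acts as a fictitious variable n_0 = 0 below n_1, so that a leading
  \<open>Y\<close> contributes exactly for \<open>n\<close> at least 1.\<close>

definition word_coeff :: "letter list \<Rightarrow> nat \<Rightarrow> real fps" where
  "word_coeff w = fold word_step w (\<lambda>n. if n = 0 then 1 else 0)"

lemma word_coeff_Nil: "word_coeff [] n = (if n = 0 then 1 else 0)"
  by (simp add: word_coeff_def)

lemma word_coeff_snoc: "word_coeff (w @ [a]) = word_step a (word_coeff w)"
  by (simp add: word_coeff_def)

lemma index_words_Nil [simp]: "[] \<in> index_words"
  by (simp add: index_words_def)

lemma index_words_snoc: "w @ [a] \<in> index_words \<longleftrightarrow> (w \<in> index_words \<and> (w \<noteq> [] \<or> a = Y))"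
  by (cases w) (auto simp: index_words_def)

lemma index_words_Cons: "a # w \<in> index_words \<longleftrightarrow> a = Y"
  by (auto simp: index_words_def)

lemma index_words_induct [consumes 1, case_names Nil X Y]:
  assumes "w \<in> index_words"
    and "P []"
    and "\<And>w. w \<in> index_words \<Longrightarrow> w \<noteq> [] \<Longrightarrow> P w \<Longrightarrow> P (w @ [X])"
    and "\<And>w. w \<in> index_words \<Longrightarrow> P w \<Longrightarrow> P (w @ [Y])"
  shows "P w"
  using assms(1)
proof (induction w rule: rev_induct)
  case (snoc a w)
  then show ?case using assms(3,4) by (cases a) (auto simp: index_words_snoc)
qed (use assms in simp)

lemma word_coeff_zero: "w \<in> index_words \<Longrightarrow> w \<noteq> [] \<Longrightarrow> word_coeff w 0 = 0"
  by (induction w rule: index_words_induct) (auto simp: word_coeff_snoc word_step_def)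

lemma word_step_mult:
  "n > 0 \<Longrightarrow> word_step a f n * (fps_const (real n) - fps_X) =
     (case a of X \<Rightarrow> f n | Y \<Rightarrow> (\<Sum>k<n. f k))"
  by (simp add: word_step_def mult.assoc inverse_mult_eq_1)

lemma word_step_nth:
  assumes "n > 0"
  shows "real n * word_step a f n $ b =
     (case a of X \<Rightarrow> f n $ b | Y \<Rightarrow> (\<Sum>k<n. f k $ b)) +
     (if b = 0 then 0 else word_step a f n $ (b - 1))"
proof -
  have "(word_step a f n * (fps_const (real n) - fps_X)) $ b =
      real n * word_step a f n $ b - (if b = 0 then 0 else word_step a f n $ (b - 1))"
    by (simp add: right_diff_distrib)
  then show ?thesis
    unfolding word_step_mult[OF assms] by (cases a) (simp_all add: fps_sum_nth)
qed

lemma word_step_nth':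
  assumes "n > 0"
  shows "word_step a f n $ b =
     ((case a of X \<Rightarrow> f n $ b | Y \<Rightarrow> (\<Sum>k<n. f k $ b)) +
     (if b = 0 then 0 else word_step a f n $ (b - 1))) / real n"
  using word_step_nth[OF assms, of a f b] assms by (simp add: field_simps)

section \<open>Growth of the coefficients in the largest summation variable\<close>

lemma word_step_bounded:
  assumes nonneg: "\<And>b n. 0 \<le> f n $ b" and bdd: "\<And>b. \<exists>K. \<forall>n. f n $ b \<le> K"
    and zero: "word_step a f 0 = 0"
  shows "(\<forall>n. 0 \<le> word_step a f n $ b) \<and> (\<exists>K. \<forall>n. word_step a f n $ b \<le> K)"
proof (induction b rule: less_induct)
  case (less b)
  define B where "B n = (case a of X \<Rightarrow> f n $ b | Y \<Rightarrow> (\<Sum>k<n. f k $ b))" for n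
  define P where "P n = (if b = 0 then 0 else word_step a f n $ (b - 1))" for n
  obtain K where K: "\<And>n. f n $ b \<le> K" using bdd by blast
  obtain K' where P: "\<And>n. 0 \<le> P n" "\<And>n. P n \<le> K'"
    using less[of "b - 1"] by (cases "b = 0") (auto simp: P_def)
  \<comment> \<open>A sum of \<open>n\<close> terms is at most \<open>n * K\<close>, and the
    division by \<open>n\<close> in \<open>word_step_nth'\<close> restores a bound that does not
    depend on \<open>n\<close>.\<close>
  have B: "0 \<le> B n" "B n \<le> real n * K" if "n > 0" for n
  proof -
    have "K \<le> real n * K"
      using that order_trans[OF nonneg K] mult_right_mono[of 1 "real n" K] by simp
    then show "0 \<le> B n" "B n \<le> real n * K"
      using nonneg K[of n] sum_bounded_above[of "{..<n}" "\<lambda>k. f k $ b" K] K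
      by (auto simp: B_def sum_nonneg split: letter.split intro: order_trans[OF K])
  qed
  have "0 \<le> word_step a f n $ b \<and> word_step a f n $ b \<le> \<bar>K\<bar> + K'" for n
  proof (cases "n = 0")
    case True
    then show ?thesis using zero P[of 0] by simp
  next
    case False
    then have "word_step a f n $ b = (B n + P n) / real n"
      using word_step_nth'[of n a f b] by (simp add: B_def P_def)
    moreover have "P n \<le> real n * K'"
      using False P[of n] mult_right_mono[of 1 "real n" K'] by simp
    with False B[of n] have "B n + P n \<le> (K + K') * real n" by (simp add: algebra_simps)
    then have "(B n + P n) / real n \<le> K + K'" using False by (simp add: pos_divide_le_eq)
    ultimately show ?thesis using False B[of n] P[of n] by simp
  qed
  then show ?case by blast
qed

lemma word_coeff_nonneg_bounded:
  assumes "w \<in> index_words"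
  shows "(\<forall>n. 0 \<le> word_coeff w n $ b) \<and> (\<exists>K. \<forall>n. word_coeff w n $ b \<le> K)"
  using assms
proof (induction w arbitrary: b rule: index_words_induct)
  case Nil
  show ?case by (auto simp: word_coeff_Nil intro!: exI[of _ 1])
next
  case (X w)
  then show ?case
    using word_coeff_zero[of "w @ [letter.X]"] unfolding word_coeff_snoc index_words_snoc
    by (intro word_step_bounded) blast+
next
  case (Y w)
  then show ?case
    using word_coeff_zero[of "w @ [letter.Y]"] unfolding word_coeff_snoc index_words_snoc
    by (intro word_step_bounded) blast+
qed

lemma word_coeff_nonneg: "w \<in> index_words \<Longrightarrow> 0 \<le> word_coeff w n $ b"
  using word_coeff_nonneg_bounded by blast

lemma word_coeff_bounded:
  assumes "w \<in> index_words"
  obtains K where "K \<ge> 0" "\<And>n. word_coeff w n $ b \<le> K"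
  using word_coeff_nonneg_bounded[OF assms, of b] by (metis order_trans)

lemma sum_inverse_sqrt_le: "(\<Sum>k<n. 1 / sqrt (real k)) \<le> 2 * sqrt (real n)"
proof -
  have "(\<Sum>k<Suc m. 1 / sqrt (real k)) \<le> 2 * sqrt (real m)" for m
  proof (induction m)
    case (Suc m)
    define s r where "s = sqrt (real (Suc m))" and "r = sqrt (real m)"
    have s: "s > 0" "s * s = r * r + 1" by (simp_all add: s_def r_def)
    have "0 \<le> (s - r) * (s - r)" by simp
    then have "1 / s \<le> 2 * (s - r)" using s by (simp add: field_simps)
    with Suc show ?case by (simp add: s_def r_def)
  qed simp
  from this[of "n - 1"] show ?thesis
    by (cases n) (auto intro: order_trans simp del: sum.lessThan_Suc)
qed

text \<open>The coefficients are of size at most a power of log n over n. The cruder rate n^(-1/2)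
  is chosen because it reproduces itself: summing 1/sqrt k over k < n gives at most 2 sqrt n, and a
  new \<open>Y\<close> divides by n.\<close>

lemma word_coeff_sqrt_bound:
  assumes "w \<in> index_words" "w \<noteq> []"
  shows "\<exists>K. \<forall>n. word_coeff w n $ 0 \<le> K / sqrt (real n)"
  using assms
proof (induction w rule: index_words_induct)
  case (X w)
  then obtain K where K: "\<And>n. word_coeff w n $ 0 \<le> K / sqrt (real n)" by blast
  have "word_coeff (w @ [letter.X]) n $ 0 \<le> K / sqrt (real n)" for n
  proof (cases "n = 0")
    case True
    then show ?thesis using word_coeff_zero[of "w @ [letter.X]"] X by (simp add: index_words_snoc)
  next
    case False
    have "word_coeff w n $ 0 / real n \<le> word_coeff w n $ 0 / 1"
      using False X by (intro divide_left_mono word_coeff_nonneg) auto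
    with K[of n] False show ?thesis by (simp add: word_coeff_snoc word_step_nth')
  qed
  then show ?case by blast
next
  case (Y w)
  obtain K where K: "\<And>n. (\<Sum>k<n. word_coeff w k $ 0) \<le> K * sqrt (real n)"
  proof (cases "w = []")
    case True
    have "(\<Sum>k<n. word_coeff w k $ 0) \<le> 1 * sqrt (real n)" for n
      by (induction n) (auto simp: word_coeff_Nil True intro: order_trans)
    then show ?thesis using that by blast
  next
    case False
    then obtain K where K: "\<And>n. word_coeff w n $ 0 \<le> K / sqrt (real n)" using Y by blast
    have "0 \<le> K" using K[of 1] word_coeff_nonneg[OF Y(1), of 1 0] by simp
    have "(\<Sum>k<n. word_coeff w k $ 0) \<le> (2 * K) * sqrt (real n)" for n
    proof -
      have "(\<Sum>k<n. word_coeff w k $ 0) \<le> (\<Sum>k<n. K * (1 / sqrt (real k)))"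
        by (intro sum_mono) (use K in simp)
      also have "\<dots> \<le> K * (2 * sqrt (real n))"
        unfolding sum_distrib_left[symmetric]
        by (intro mult_left_mono sum_inverse_sqrt_le \<open>0 \<le> K\<close>)
      finally show ?thesis by simp
    qed
    then show ?thesis using that by blast
  qed
  have "word_coeff (w @ [letter.Y]) n $ 0 \<le> K / sqrt (real n)" for n
  proof (cases "n = 0")
    case True
    then show ?thesis using word_coeff_zero[of "w @ [letter.Y]"] Y by (simp add: index_words_snoc)
  next
    case False
    have "K * sqrt (real n) / real n = K / sqrt (real n)"
      using False by (simp add: field_simps)
    with K[of n] False show ?thesis
      by (simp add: word_coeff_snoc word_step_nth' divide_right_mono flip: \<open>K * sqrt (real n) / real n = K / sqrt (real n)\<close>)
  qed
  then show ?case by blast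
qed auto

text \<open>A final \<open>X\<close> gains another factor 1/n. The exponent -3/2 equals -1 - 2d with
  d = 1/4, which leaves room for a rate of convergence besides convergence itself.\<close>

lemma word_coeff_X_bound:
  assumes "w \<in> index_words" "w \<noteq> []"
  shows "\<exists>K. \<forall>n>0. \<bar>word_coeff (w @ [X]) n $ 0\<bar> \<le> K * real n powr (- 3 / 2)"
proof -
  obtain K where K: "\<And>n. word_coeff w n $ 0 \<le> K / sqrt (real n)"
    using word_coeff_sqrt_bound[OF assms] by blast
  have "\<bar>word_coeff (w @ [X]) n $ 0\<bar> \<le> K * real n powr (- 3 / 2)" if "n > 0" for n
  proof -
    have "real n powr (- 3 / 2) = 1 / (sqrt (real n) * real n)"
    proof -
      have "real n powr (- 3 / 2) = real n powr (- (1/2)) * real n powr (- 1)"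
        by (subst powr_add[symmetric]) simp
      also have "real n powr (- (1/2)) = inverse (sqrt (real n))"
        unfolding powr_minus using powr_half_sqrt[of "real n"] by simp
      also have "real n powr (- 1) = inverse (real n)"
        unfolding powr_minus by simp
      finally show ?thesis by (simp add: field_simps)
    qed
    moreover have "0 \<le> word_coeff (w @ [X]) n $ 0"
      using assms by (intro word_coeff_nonneg) (auto simp: index_words_snoc)
    moreover have "word_coeff (w @ [X]) n $ 0 \<le> K / sqrt (real n) / real n"
      using that divide_right_mono[OF K[of n], of "real n"] by (simp add: word_coeff_snoc word_step_nth')
    ultimately show ?thesis by simp
  qed
  then show ?thesis by blast
qed

section \<open>Rates of convergence\<close>

text \<open>Both rates follow from the convergence of \<open>\<Sum> \<bar>a\<^sub>n\<bar> n\<^sup>d\<close>, the second one through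
  \<open>1 - z\<^sup>n \<le> (n (1 - z))\<^sup>d\<close>.\<close>

lemma one_minus_power_le:
  assumes "0 < z" "z < 1" "0 < d" "d \<le> (1::real)" "n > 0"
  shows "1 - z ^ n \<le> real n powr d * (1 - z) powr d"
proof -
  define x where "x = real n * (1 - z)"
  have "x > 0" using assms by (simp add: x_def)
  have b: "1 - z ^ n \<le> x"
    using Bernoulli_inequality[of "z - 1" n] assms by (simp add: x_def algebra_simps)
  have "1 - z ^ n \<le> x powr d"
  proof (cases "x \<le> 1")
    case True
    then have "x powr 1 \<le> x powr d" using \<open>x > 0\<close> assms by (intro powr_mono') auto
    with b \<open>x > 0\<close> show ?thesis by simp
  next
    case False
    then have "1 \<le> x powr d" using assms by (intro ge_one_powr_ge_zero) auto
    moreover have "0 \<le> z ^ n" using assms by simp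
    ultimately show ?thesis by linarith
  qed
  then show ?thesis using assms by (simp add: x_def powr_mult)
qed

lemma convergence_rates:
  fixes a :: "nat \<Rightarrow> real"
  assumes bound: "\<And>n. n > 0 \<Longrightarrow> \<bar>a n\<bar> \<le> K * real n powr (- 1 - 2 * d)" and d: "0 < d" "d \<le> 1"
  obtains C where "summable a"
    "\<And>N. N > 0 \<Longrightarrow> \<bar>(\<Sum>n<N. a n) - suminf a\<bar> \<le> C * real N powr (- d)"
    "\<And>z. 0 < z \<Longrightarrow> z < 1 \<Longrightarrow> summable (\<lambda>n. a n * z ^ n) \<and>
         \<bar>suminf (\<lambda>n. a n * z ^ n) - suminf a\<bar> \<le> C * (1 - z) powr d"
proof -
  define g where "g n = \<bar>a n\<bar> * real n powr d" for n
  have "summable (\<lambda>n. K * real n powr (- 1 - d))"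
    using d by (intro summable_mult) (simp add: summable_real_powr_iff)
  moreover have "norm (g n) \<le> K * real n powr (- 1 - d)" if "n > 0" for n
  proof -
    have "g n \<le> (K * real n powr (- 1 - 2 * d)) * real n powr d"
      unfolding g_def using bound[OF that] by (intro mult_right_mono) auto
    also have "\<dots> = K * (real n powr (- 1 - 2 * d) * real n powr d)" by (simp only: mult.assoc)
    also have "real n powr (- 1 - 2 * d) * real n powr d = real n powr (- 1 - d)"
      by (subst powr_add[symmetric]) (rule arg_cong[where f = "(powr) (real n)"], simp)
    finally show ?thesis by (simp add: g_def)
  qed
  ultimately have g: "summable g"
    by (intro summable_comparison_test[of g "\<lambda>n. K * real n powr (- 1 - d)"] exI[of _ 1]) simp_all
  have a: "summable (\<lambda>n. \<bar>a n\<bar>)"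
  proof (rule summable_comparison_test_ev[OF _ g])
    have "norm \<bar>a n\<bar> \<le> g n" if "n \<ge> 1" for n
    proof -
      have "1 \<le> real n powr d" using that d by (intro ge_one_powr_ge_zero) auto
      from mult_left_mono[OF this, of "\<bar>a n\<bar>"] show ?thesis by (simp add: g_def)
    qed
    then show "\<forall>\<^sub>F n in sequentially. norm \<bar>a n\<bar> \<le> g n" by (auto simp: eventually_at_top_linorder)
  qed
  have g0: "g n \<ge> 0" for n by (simp add: g_def)
  show ?thesis
  proof (rule that[of "suminf g"])
    show a': "summable a" using a summable_rabs_cancel by blast
    show "\<bar>(\<Sum>n<N. a n) - suminf a\<bar> \<le> suminf g * real N powr (- d)" if "N > 0" for N
    proof -
      have "(\<Sum>n<N. a n) - suminf a = - suminf (\<lambda>n. a (n + N))"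
        using suminf_split_initial_segment[OF a', of N] by simp
      then have "\<bar>(\<Sum>n<N. a n) - suminf a\<bar> \<le> suminf (\<lambda>n. \<bar>a (n + N)\<bar>)"
        using summable_rabs[of "\<lambda>n. a (n + N)"] a by (simp add: summable_iff_shift[of "\<lambda>n. \<bar>a n\<bar>"])
      also have "\<dots> \<le> suminf (\<lambda>n. g (n + N) * real N powr (- d))"
      proof (rule suminf_le)
        show "\<bar>a (n + N)\<bar> \<le> g (n + N) * real N powr (- d)" for n
        proof -
          have "real N powr d \<le> real (n + N) powr d" using d by (intro powr_mono2) auto
          then have "1 \<le> real (n + N) powr d * real N powr (- d)"
            using that by (simp add: powr_minus field_simps)
          from mult_left_mono[OF this, of "\<bar>a (n + N)\<bar>"] show ?thesis by (simp add: g_def mult.assoc)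
        qed
      qed (use a g in \<open>auto simp: summable_iff_shift[of "\<lambda>n. \<bar>a n\<bar>"] summable_iff_shift[of g] intro!: summable_mult2\<close>)
      also have "\<dots> = suminf (\<lambda>n. g (n + N)) * real N powr (- d)"
        using g by (intro suminf_mult2[symmetric]) (simp add: summable_iff_shift[of g])
      also have "\<dots> \<le> suminf g * real N powr (- d)"
        using suminf_split_initial_segment[OF g, of N] g0
        by (intro mult_right_mono) (auto simp: sum_nonneg)
      finally show ?thesis .
    qed
    show "summable (\<lambda>n. a n * z ^ n) \<and> \<bar>suminf (\<lambda>n. a n * z ^ n) - suminf a\<bar> \<le> suminf g * (1 - z) powr d"
      if z: "0 < z" "z < 1" for z
    proof
      show sz: "summable (\<lambda>n. a n * z ^ n)"
      proof (rule summable_comparison_test'[OF a, of 0])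
        show "norm (a n * z ^ n) \<le> \<bar>a n\<bar>" for n
          using z mult_left_mono[of "z ^ n" 1 "\<bar>a n\<bar>"] by (simp add: abs_mult power_le_one)
      qed
      have le: "norm (a n * z ^ n - a n) \<le> g n * (1 - z) powr d" for n
      proof (cases "n = 0")
        case False
        have "\<bar>z ^ n - 1\<bar> \<le> real n powr d * (1 - z) powr d"
          using one_minus_power_le[OF z d, of n] False z power_le_one[of z n] by simp
        from mult_left_mono[OF this, of "\<bar>a n\<bar>"] show ?thesis
          by (simp add: g_def mult.assoc flip: abs_mult) (simp add: algebra_simps)
      qed (simp add: g_def)
      have sg: "summable (\<lambda>n. g n * (1 - z) powr d)" by (intro summable_mult2 g)
      have "suminf (\<lambda>n. a n * z ^ n) - suminf a = suminf (\<lambda>n. a n * z ^ n - a n)"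
        by (rule suminf_diff[OF sz a'])
      also have "norm \<dots> \<le> suminf (\<lambda>n. norm (a n * z ^ n - a n))"
        by (intro summable_norm summable_comparison_test'[OF sg, of 0]) (use le in simp)
      also have "\<dots> \<le> suminf (\<lambda>n. g n * (1 - z) powr d)"
        by (intro suminf_le le sg summable_comparison_test'[OF sg, of 0]) (use le in simp)
      also have "\<dots> = suminf g * (1 - z) powr d"
        by (intro suminf_mult2[symmetric] g)
      finally show "\<bar>suminf (\<lambda>n. a n * z ^ n) - suminf a\<bar> \<le> suminf g * (1 - z) powr d" by simp
    qed
  qed
qed


section \<open>Words and indices\<close>

lemma index_word_Nil [simp]: "index_word [] = []"
  by (simp add: index_word_def)

lemma index_word_snoc: "index_word (ks @ [k]) = index_word ks @ Y # replicate (k - 1) X"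
  by (simp add: index_word_def)

lemma index_word_append: "index_word (ks @ ls) = index_word ks @ index_word ls"
  by (simp add: index_word_def)

lemma index_word_in_index_words [simp]: "index_word ks \<in> index_words"
  by (cases ks) (simp_all add: index_word_def index_words_Cons)

lemma index_word_eq_Nil [simp]: "index_word ks = [] \<longleftrightarrow> ks = []"
  by (cases ks) (simp_all add: index_word_def)

lemma indices_Nil [simp]: "[] \<in> indices"
  by (simp add: indices_def)

lemma indices_append [simp]: "ks @ ls \<in> indices \<longleftrightarrow> ks \<in> indices \<and> ls \<in> indices"
  by (auto simp: indices_def)

lemma indices_single [simp]: "[k] \<in> indices \<longleftrightarrow> 1 \<le> k"
  by (simp add: indices_def)

text \<open>An appended \<open>X\<close> raises the last entry by one and an appended
  \<open>Y\<close> adds an entry 1; hence a word that is empty or ends in \<open>X\<close> comes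
  from an admissible index.\<close>

lemma index_words_imp_index_word:
  assumes "w \<in> index_words"
  shows "\<exists>ks\<in>indices. w = index_word ks \<and> (w = [] \<or> last w = X \<longrightarrow> admissible ks)"
  using assms
proof (induction w rule: index_words_induct)
  case (X w)
  then obtain ks where ks: "ks \<in> indices" "w = index_word ks" by blast
  with X obtain ls l where ls: "ks = ls @ [l]" by (cases ks rule: rev_cases) auto
  with ks have "l \<ge> 1" by simp
  then have "w @ [letter.X] = index_word (ls @ [Suc l])"
    using ks ls by (cases l) (simp_all add: index_word_snoc replicate_append_same)
  then show ?case using ks ls \<open>l \<ge> 1\<close> by (intro bexI[of _ "ls @ [Suc l]"]) (auto simp: admissible_def)
next
  case (Y w)
  then obtain ks where "ks \<in> indices" "w = index_word ks" by blast
  then show ?case by (intro bexI[of _ "ks @ [1]"]) (simp_all add: index_word_snoc)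
qed (auto simp: admissible_def intro!: bexI[of _ "[]"])

section \<open>The harmonic product and truncated sums\<close>

text \<open>The bound \<open>N\<close> is strict for the largest variable. For the empty index only
  the fictitious variable 0 is seen, so the value is 1 as soon as \<open>N > 0\<close> but 0 for
  \<open>N = 0\<close>.\<close>

definition harm_sum :: "nat list \<Rightarrow> nat \<Rightarrow> real" where
  "harm_sum ks N = (\<Sum>n<N. word_coeff (index_word ks) n $ 0)"

lemma word_coeff_replicate_X:
  "word_coeff (w @ replicate j X) n = word_coeff w n * inverse (fps_const (real n) - fps_X) ^ j"
proof (induction j)
  case (Suc j)
  have *: "w @ replicate (Suc j) X = (w @ replicate j X) @ [X]"
    by (simp add: replicate_append_same)
  show ?case unfolding * word_coeff_snoc by (simp add: word_step_def Suc)
qed simp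

lemma word_coeff_index_snoc_fps:
  assumes "k \<ge> 1"
  shows "word_coeff (index_word (ks @ [k])) n =
     (\<Sum>j<n. word_coeff (index_word ks) j) * inverse (fps_const (real n) - fps_X) ^ k"
proof -
  have eq: "index_word (ks @ [k]) = (index_word ks @ [Y]) @ replicate (k - 1) X"
    by (simp add: index_word_snoc)
  have "word_coeff (index_word (ks @ [k])) n =
      (\<Sum>j<n. word_coeff (index_word ks) j) * inverse (fps_const (real n) - fps_X) ^ Suc (k - 1)"
    unfolding eq word_coeff_replicate_X word_coeff_snoc by (simp add: word_step_def)
  then show ?thesis using assms by simp
qed

lemma word_coeff_index_snoc:
  "k \<ge> 1 \<Longrightarrow> word_coeff (index_word (ks @ [k])) n $ 0 = harm_sum ks n / real n ^ k"
  by (simp add: word_coeff_index_snoc_fps harm_sum_def fps_sum_nth fps_nth_power_0 power_inverse divide_inverse)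

lemma harm_sum_Nil: "harm_sum [] N = (if N = 0 then 0 else 1)"
proof -
  have "word_coeff [] n $ 0 = (if n = 0 then 1 else 0)" for n by (simp add: word_coeff_Nil)
  then show ?thesis by (simp add: harm_sum_def)
qed

lemma harm_sum_zero [simp]: "harm_sum ks 0 = 0"
  by (simp add: harm_sum_def)

lemma harm_sum_snoc:
  "k \<ge> 1 \<Longrightarrow> harm_sum (ks @ [k]) N = (\<Sum>n<N. harm_sum ks n / real n ^ k)"
  by (simp add: harm_sum_def[of "ks @ [k]"] word_coeff_index_snoc)

lemma keys_harmonic_product:
  "u \<in> indices \<Longrightarrow> v \<in> indices \<Longrightarrow> keys (harmonic_product u v) \<subseteq> indices"
proof (induction u v rule: harmonic_product.induct)
  case (3 ks k ls l)
  then have IH: "keys (harmonic_product ks (ls @ [l])) \<subseteq> indices"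
    "keys (harmonic_product ks ls) \<subseteq> indices"
    "keys (harmonic_product (ks @ [k]) ls) \<subseteq> indices" by simp_all
  have *: "keys (lift_linear (\<lambda>w. w @ [j]) p) \<subseteq> indices"
    if "keys p \<subseteq> indices" "1 \<le> j" for p j
    using keys_lift_linear[of "\<lambda>w. w @ [j]" p] that by fastforce
  show ?case
    unfolding harmonic_product.simps
    by (intro order_trans[OF Poly_Mapping.keys_add] Un_least * IH) (use 3 in auto)
qed (auto simp: basis_vec_def)

text \<open>For nonempty factors every index in the product ends in k, l or k + l, all greater than
  1. This is what closes \<open>mzv_span\<close> under multiplication.\<close>

lemma keys_harmonic_product_admissible:
  assumes "admissible u" "admissible v"
  shows "w \<in> keys (harmonic_product u v) \<Longrightarrow> admissible w"
proof -
  assume w: "w \<in> keys (harmonic_product u v)"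
  then have iw: "w \<in> indices" using keys_harmonic_product[of u v] assms by (auto simp: admissible_def)
  show ?thesis
  proof (cases "u = [] \<or> v = []")
    case True
    with w assms show ?thesis by (cases u rule: rev_cases; cases v rule: rev_cases) (auto simp: basis_vec_def)
  next
    case False
    then obtain ks k ls l where eq: "u = ks @ [k]" "v = ls @ [l]" by (metis rev_exhaust)
    define A B C where "A = lift_linear (\<lambda>w. w @ [k]) (harmonic_product ks (ls @ [l]))"
      and "B = lift_linear (\<lambda>w. w @ [k + l]) (harmonic_product ks ls)"
      and "C = lift_linear (\<lambda>w. w @ [l]) (harmonic_product (ks @ [k]) ls)"
    have "w \<in> keys (A + B + C)"
      using w by (simp add: eq A_def B_def C_def)
    then have "w \<in> keys A \<union> keys B \<union> keys C"
      using Poly_Mapping.keys_add[of "A + B" C] Poly_Mapping.keys_add[of A B] by auto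
    moreover have "keys A \<subseteq> range (\<lambda>w. w @ [k])" "keys B \<subseteq> range (\<lambda>w. w @ [k + l])"
      "keys C \<subseteq> range (\<lambda>w. w @ [l])"
      unfolding A_def B_def C_def by (rule order_trans[OF keys_lift_linear image_mono[OF subset_UNIV]])+
    ultimately have "w \<in> range (\<lambda>w. w @ [k]) \<union> range (\<lambda>w. w @ [k + l]) \<union> range (\<lambda>w. w @ [l])"
      by auto
    with iw assms show ?thesis unfolding eq admissible_def by auto
  qed
qed

text \<open>The recursion of the product is the discrete Leibniz rule: the increment of a product fg
  from \<open>N\<close> to \<open>Suc N\<close> is the sum of two terms with one increment each and
  a term with both, and the latter has the merged entry k + l.\<close>

lemma lin_ext_harm_sum:
  assumes "u \<in> indices" "v \<in> indices"
  shows "lin_ext (\<lambda>w. harm_sum w N) (harmonic_product u v) = harm_sum u N * harm_sum v N"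
  using assms
proof (induction u v arbitrary: N rule: harmonic_product.induct)
  case (3 ks k ls l)
  have k: "k \<ge> 1" "l \<ge> 1" using 3 by simp_all
  have step: "lin_ext (\<lambda>w. harm_sum (w @ [j]) (Suc N)) p =
     lin_ext (\<lambda>w. harm_sum (w @ [j]) N) p + lin_ext (\<lambda>w. harm_sum w N) p / real N ^ j"
    if "j \<ge> 1" for j N p
    using that by (simp add: harm_sum_snoc lin_ext_def distrib_left sum.distrib sum_divide_distrib)
  show ?case
  proof (induction N)
    case 0
    show ?case by (simp add: lin_ext_def)
  next
    case (Suc N)
    have "lin_ext (\<lambda>w. harm_sum w (Suc N)) (harmonic_product (ks @ [k]) (ls @ [l])) =
       lin_ext (\<lambda>w. harm_sum w N) (harmonic_product (ks @ [k]) (ls @ [l])) +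
       harm_sum ks N * harm_sum (ls @ [l]) N / real N ^ k +
       harm_sum ks N * harm_sum ls N / real N ^ (k + l) +
       harm_sum (ks @ [k]) N * harm_sum ls N / real N ^ l"
      using k 3 by (simp add: lin_ext_add lin_ext_lift_linear step)
    also have "\<dots> = harm_sum (ks @ [k]) (Suc N) * harm_sum (ls @ [l]) (Suc N)"
      unfolding Suc using k by (simp add: harm_sum_snoc algebra_simps power_add)
    finally show ?case .
  qed
qed (simp_all add: harm_sum_Nil)

lemma lookup_eq_lin_ext:
  "of_rat (lookup p w) = lin_ext (\<lambda>v. if v = w then 1 else 0) p"
  by (simp add: lin_ext_def mult_delta_right in_keys_iff)

section \<open>Products by a single divergent letter\<close>

definition trailing :: "'a \<Rightarrow> 'a list \<Rightarrow> nat" where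
  "trailing a w = length (takeWhile (\<lambda>x. x = a) (rev w))"

lemma trailing_Nil [simp]: "trailing a [] = 0"
  by (simp add: trailing_def)

lemma trailing_snoc [simp]: "trailing a (w @ [b]) = (if b = a then Suc (trailing a w) else 0)"
  by (simp add: trailing_def)

text \<open>The hypotheses are the part of the recursion for products by the index \<open>(1)\<close>, respectively by
  the word \<open>y\<close>, that the harmonic and the shuffle product have in common.\<close>

lemma lin_ext_trailing_product:
  fixes q :: "'a list \<Rightarrow> 'a list \<Rightarrow>\<^sub>0 rat"
  assumes Nil: "q [] = basis_vec [a]"
    and snoc: "\<And>u b f. P (u @ [b]) \<Longrightarrow> (\<And>w. trailing a w = 0 \<Longrightarrow> f w = 0) \<Longrightarrow>
        lin_ext f (q (u @ [b])) = lin_ext (\<lambda>w. f (w @ [b])) (q u) + f (u @ [b, a])"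
    and P: "\<And>u b. P (u @ [b]) \<Longrightarrow> P u" "P u"
    and f: "\<And>w. trailing a w \<le> trailing a u \<Longrightarrow> f w = 0"
  shows "lin_ext f (q u) = real (Suc (trailing a u)) * f (u @ [a])"
  using P(2) f
proof (induction u arbitrary: f rule: rev_induct)
  case (snoc b u)
  have eq: "lin_ext f (q (u @ [b])) = lin_ext (\<lambda>w. f (w @ [b])) (q u) + f (u @ [b, a])"
    using snoc.prems by (intro assms(2)) auto
  show ?case
  proof (cases "b = a")
    case True
    have "lin_ext (\<lambda>w. f (w @ [b])) (q u) = real (Suc (trailing a u)) * f ((u @ [a]) @ [b])"
      using snoc.prems P(1) True by (intro snoc.IH) auto
    with eq True show ?thesis by (simp add: algebra_simps)
  next
    case False
    with snoc.prems have "lin_ext (\<lambda>w. f (w @ [b])) (q u) = 0" by (simp add: lin_ext_def)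
    with eq False show ?thesis by simp
  qed
qed (simp add: Nil)

text \<open>The coefficient of a word is the value of \<open>lin_ext\<close> at its indicator
  function. For words with more trailing letters than \<open>u\<close>, the hypothesis applies to
  this indicator and leaves only \<open>u @ [a]\<close>. This supplies \<open>lev_Suc\<close> for
  both products.\<close>

lemma trailing_product:
  fixes q :: "'a list \<Rightarrow> 'a list \<Rightarrow>\<^sub>0 rat"
  assumes "\<And>f. (\<And>w. trailing a w \<le> trailing a u \<Longrightarrow> f w = 0) \<Longrightarrow>
     lin_ext f (q u) = real (Suc (trailing a u)) * f (u @ [a])"
  shows "lookup (q u) (u @ [a]) \<noteq> 0"
    and "v \<in> keys (q u) \<Longrightarrow> v \<noteq> u @ [a] \<Longrightarrow> trailing a v \<le> trailing a u"
proof -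
  have *: "of_rat (lookup (q u) w) =
      real (Suc (trailing a u)) * (if u @ [a] = w then 1 else 0)" if "trailing a w > trailing a u" for w
    unfolding lookup_eq_lin_ext using that by (intro assms) auto
  have "of_rat (lookup (q u) (u @ [a])) \<noteq> (0 :: real)"
    by (subst *) simp_all
  then show "lookup (q u) (u @ [a]) \<noteq> 0" by auto
  show "trailing a v \<le> trailing a u" if "v \<in> keys (q u)" "v \<noteq> u @ [a]"
    using *[of v] that by (auto simp: in_keys_iff not_le[symmetric])
qed

lemma harmonic_product_one:
  assumes "u \<in> indices" "\<And>w. trailing 1 w \<le> trailing 1 u \<Longrightarrow> f w = 0"
  shows "lin_ext f (harmonic_product u [1]) = real (Suc (trailing 1 u)) * f (u @ [1])"
proof (rule lin_ext_trailing_product[where P = "\<lambda>u. u \<in> indices"])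
  show "harmonic_product [] [1] = basis_vec [1]"
    using harmonic_product.simps(2)[of "[]" 1] by simp
  fix u :: "nat list" and b and f :: "nat list \<Rightarrow> real"
  assume u: "u @ [b] \<in> indices" and f: "\<And>w. trailing 1 w = 0 \<Longrightarrow> f w = (0::real)"
  \<comment> \<open>Entries of an index are positive, so the merged entry \<open>b + 1\<close>
    differs from 1 and the contraction term has no trailing one.\<close>
  have "f (u @ [b + 1]) = 0" using u by (intro f) simp
  then show "lin_ext f (harmonic_product (u @ [b]) [1]) =
      lin_ext (\<lambda>w. f (w @ [b])) (harmonic_product u [1]) + f (u @ [b, 1])"
    using harmonic_product.simps(3)[of u b "[]" 1] by (simp add: lin_ext_add lin_ext_lift_linear)
qed (use assms in auto)

section \<open>Multiple zeta values as limits of truncated sums\<close>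

definition tuples_below :: "nat \<Rightarrow> nat \<Rightarrow> nat list set" where
  "tuples_below r N = {ns. length ns = r \<and> sorted_wrt (<) ns \<and> (\<forall>n\<in>set ns. 1 \<le> n \<and> n < N)}"

lemma tuples_below_zero [simp]: "tuples_below 0 N = {[]}"
  by (auto simp: tuples_below_def)

lemma tuples_below_Suc:
  "tuples_below (Suc r) N = (\<lambda>(n, ns). ns @ [n]) ` (SIGMA n:{1..<N}. tuples_below r n)"
proof (intro equalityI subsetI)
  fix ns assume ns: "ns \<in> tuples_below (Suc r) N"
  then obtain ms n where "ns = ms @ [n]" by (cases ns rule: rev_cases) (auto simp: tuples_below_def)
  with ns show "ns \<in> (\<lambda>(n, ns). ns @ [n]) ` (SIGMA n:{1..<N}. tuples_below r n)"
    by (auto simp: tuples_below_def sorted_wrt_append intro!: image_eqI[of _ _ "(n, ms)"])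
qed (fastforce simp: tuples_below_def sorted_wrt_append)

lemma finite_tuples_below [simp]: "finite (tuples_below r N)"
  by (induction r arbitrary: N) (auto simp: tuples_below_Suc)

definition mzv_term :: "nat list \<Rightarrow> nat list \<Rightarrow> real" where
  "mzv_term ks ns = 1 / (\<Prod>i<length ks. real (ns ! i) ^ (ks ! i))"

lemma mzv_term_snoc:
  "length ns = length ks \<Longrightarrow> mzv_term (ks @ [k]) (ns @ [n]) = mzv_term ks ns / real n ^ k"
  by (simp add: mzv_term_def nth_append)

lemma sum_mzv_term:
  assumes "ks \<in> indices" "N > 0"
  shows "(\<Sum>ns\<in>tuples_below (length ks) N. mzv_term ks ns) = harm_sum ks N"
  using assms
proof (induction ks arbitrary: N rule: rev_induct)
  case Nil
  then show ?case by (simp add: harm_sum_Nil mzv_term_def)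
next
  case (snoc k ks)
  have inj: "inj_on (\<lambda>(n, ns). ns @ [n]) (SIGMA n:{1..<N}. tuples_below (length ks) n)"
    by (auto simp: inj_on_def)
  have "(\<Sum>ns\<in>tuples_below (length (ks @ [k])) N. mzv_term (ks @ [k]) ns) =
     (\<Sum>(n, ns)\<in>(SIGMA n:{1..<N}. tuples_below (length ks) n). mzv_term (ks @ [k]) (ns @ [n]))"
    using sum.reindex[OF inj, of "mzv_term (ks @ [k])"]
    by (simp add: tuples_below_Suc comp_def case_prod_unfold)
  also have "\<dots> = (\<Sum>n\<in>{1..<N}. \<Sum>ns\<in>tuples_below (length ks) n. mzv_term (ks @ [k]) (ns @ [n]))"
    by (rule sum.Sigma[symmetric]) auto
  also have "\<dots> = (\<Sum>n\<in>{1..<N}. harm_sum ks n / real n ^ k)"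
  proof (rule sum.cong[OF refl])
    fix n assume "n \<in> {1..<N}"
    then have "(\<Sum>ns\<in>tuples_below (length ks) n. mzv_term ks ns) = harm_sum ks n"
      using snoc by auto
    then show "(\<Sum>ns\<in>tuples_below (length ks) n. mzv_term (ks @ [k]) (ns @ [n])) = harm_sum ks n / real n ^ k"
      by (simp add: mzv_term_snoc tuples_below_def flip: sum_divide_distrib)
  qed
  also have "\<dots> = (\<Sum>n<N. harm_sum ks n / real n ^ k)"
    by (intro sum.mono_neutral_left) (auto simp: Suc_le_eq)
  also have "\<dots> = harm_sum (ks @ [k]) N"
    using snoc by (simp add: harm_sum_snoc)
  finally show ?case .
qed

text \<open>\<open>mzv\<close> is an unordered sum. Its terms are nonnegative with bounded finite
  partial sums, so it converges, and the finite sets \<open>tuples_below r N\<close> eventually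
  contain every finite set of tuples; the limit may be taken along them.\<close>

lemma mzv_eq_lim:
  assumes ks: "ks \<in> indices" and lim: "harm_sum ks \<longlonglongrightarrow> l"
  shows "mzv ks = l"
proof -
  define S where "S = {ns. length ns = length ks \<and> sorted_wrt (<) ns \<and> (\<forall>n\<in>set ns. (1::nat) \<le> n)}"
  have mono: "mono (harm_sum ks)"
    unfolding harm_sum_def by (intro monoI sum_mono2) (auto intro: word_coeff_nonneg)
  have le: "harm_sum ks N \<le> l" for N
    by (rule incseq_le[OF mono lim])
  have finite_sub: "\<exists>N>0. \<forall>M\<ge>N. A \<subseteq> tuples_below (length ks) M" if "finite A" "A \<subseteq> S" for A
  proof -
    define N where "N = Suc (Max (insert 0 (\<Union>(set ` A))))"
    have "n < N" if "ns \<in> A" "n \<in> set ns" for n ns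
      unfolding N_def using that \<open>finite A\<close> by (intro le_imp_less_Suc Max_ge) auto
    then have "A \<subseteq> tuples_below (length ks) M" if "M \<ge> N" for M
      using \<open>A \<subseteq> S\<close> that unfolding S_def tuples_below_def by fastforce
    then show ?thesis by (intro exI[of _ N]) (auto simp: N_def)
  qed
  have nonneg: "0 \<le> mzv_term ks ns" for ns by (simp add: mzv_term_def prod_nonneg)
  have "mzv_term ks summable_on S"
  proof (rule nonneg_bounded_partial_sums_imp_summable_on)
    show "\<forall>\<^sub>F A in finite_subsets_at_top S. sum (mzv_term ks) A \<le> l"
    proof (rule eventually_finite_subsets_at_top_weakI)
      fix A assume A: "finite A" "A \<subseteq> S"
      obtain N where N: "N > 0" "A \<subseteq> tuples_below (length ks) N"
        using finite_sub[OF A] by auto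
      have "sum (mzv_term ks) A \<le> (\<Sum>ns\<in>tuples_below (length ks) N. mzv_term ks ns)"
        using N nonneg by (intro sum_mono2) auto
      also have "\<dots> \<le> l" using le N by (simp add: sum_mzv_term[OF ks])
      finally show "sum (mzv_term ks) A \<le> l" .
    qed
  qed (use nonneg in auto)
  then have "(mzv_term ks has_sum mzv ks) S"
    unfolding mzv_def S_def mzv_term_def[symmetric] by (rule has_sum_infsum)
  then have "(sum (mzv_term ks) \<longlongrightarrow> mzv ks) (finite_subsets_at_top S)"
    by (simp add: has_sum_def)
  moreover have "filterlim (tuples_below (length ks)) (finite_subsets_at_top S) sequentially"
    unfolding filterlim_finite_subsets_at_top
  proof (intro allI impI)
    fix A assume A: "finite A \<and> A \<subseteq> S"
    obtain N where N: "\<And>M. M \<ge> N \<Longrightarrow> A \<subseteq> tuples_below (length ks) M"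
      using finite_sub[of A] A by auto
    show "\<forall>\<^sub>F M in sequentially. finite (tuples_below (length ks) M) \<and>
        A \<subseteq> tuples_below (length ks) M \<and> tuples_below (length ks) M \<subseteq> S"
      using N unfolding eventually_at_top_linorder
      by (intro exI[of _ N] allI impI conjI finite_tuples_below) (auto simp: tuples_below_def S_def)
  qed
  ultimately have "(\<lambda>N. sum (mzv_term ks) (tuples_below (length ks) N)) \<longlonglongrightarrow> mzv ks"
    by (rule filterlim_compose)
  then have "harm_sum ks \<longlonglongrightarrow> mzv ks"
    by (rule Lim_transform_eventually)
       (auto simp: sum_mzv_term[OF ks] eventually_at_top_linorder intro!: exI[of _ 1])
  with lim show ?thesis using LIMSEQ_unique by blast
qed

lemma admissible_rates:
  assumes "admissible ks" "ks \<noteq> []"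
  obtains C where
    "\<And>N. N > 0 \<Longrightarrow> \<bar>harm_sum ks N - mzv ks\<bar> \<le> C * real N powr (- (1/4))"
    "\<And>z. 0 < z \<Longrightarrow> z < 1 \<Longrightarrow> summable (\<lambda>n. word_coeff (index_word ks) n $ 0 * z ^ n) \<and>
         \<bar>suminf (\<lambda>n. word_coeff (index_word ks) n $ 0 * z ^ n) - mzv ks\<bar> \<le> C * (1 - z) powr (1/4)"
proof -
  from assms obtain ls l where ls: "ks = ls @ [l]" "l > 1" "ls \<in> indices"
    by (cases ks rule: rev_cases) (auto simp: admissible_def)
  have "index_word ks = index_word (ls @ [l - 1]) @ [X]"
    using ls by (cases "l - 1") (simp_all add: index_word_snoc replicate_append_same)
  then obtain K where K: "\<And>n. n > 0 \<Longrightarrow> \<bar>word_coeff (index_word ks) n $ 0\<bar> \<le> K * real n powr (- 3 / 2)"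
    using word_coeff_X_bound[of "index_word (ls @ [l - 1])"] by auto
  obtain C where C: "summable (\<lambda>n. word_coeff (index_word ks) n $ 0)"
    "\<And>N. N > 0 \<Longrightarrow> \<bar>harm_sum ks N - suminf (\<lambda>n. word_coeff (index_word ks) n $ 0)\<bar> \<le> C * real N powr (- (1/4))"
    "\<And>z. 0 < z \<Longrightarrow> z < 1 \<Longrightarrow> summable (\<lambda>n. word_coeff (index_word ks) n $ 0 * z ^ n) \<and>
         \<bar>suminf (\<lambda>n. word_coeff (index_word ks) n $ 0 * z ^ n) - suminf (\<lambda>n. word_coeff (index_word ks) n $ 0)\<bar>
           \<le> C * (1 - z) powr (1/4)"
    unfolding harm_sum_def
    by (rule convergence_rates[of "\<lambda>n. word_coeff (index_word ks) n $ 0" K "1/4"]) (use K in auto)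
  have "harm_sum ks \<longlonglongrightarrow> suminf (\<lambda>n. word_coeff (index_word ks) n $ 0)"
    unfolding harm_sum_def by (rule summable_LIMSEQ[OF C(1)])
  then have "mzv ks = suminf (\<lambda>n. word_coeff (index_word ks) n $ 0)"
    using assms by (intro mzv_eq_lim) (auto simp: admissible_def)
  then show ?thesis using C(2,3) by (intro that[of C]) simp_all
qed

lemma mzv_Nil [simp]: "mzv [] = 1"
proof (rule mzv_eq_lim)
  show "harm_sum [] \<longlonglongrightarrow> 1"
    by (rule tendsto_eventually) (auto simp: harm_sum_Nil eventually_at_top_linorder intro!: exI[of _ 1])
qed simp

section \<open>Harmonic numbers as the divergent scale\<close>

lemma harm_sum_one: "harm_sum [1] (Suc N) = harm N"
  using harm_sum_snoc[of 1 "[]" "Suc N"]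
  by (simp add: harm_altdef harm_sum_Nil sum.lessThan_Suc_shift divide_inverse del: sum.lessThan_Suc)

lemma harm_sum_one_le: "N > 0 \<Longrightarrow> harm_sum [1] N \<le> 1 + ln (real N)"
proof (cases N)
  case (Suc M)
  show ?thesis
  proof (cases "M = 0")
    case False
    then have "harm M - ln (real M) \<le> harm 1 - ln (real 1)"
      by (intro euler_mascheroni_sequence_decreasing) auto
    then have "harm M \<le> 1 + ln (real M)" by (simp add: harm_def)
    also have "\<dots> \<le> 1 + ln (real N)" using False Suc by simp
    finally show ?thesis using Suc by (simp add: harm_sum_one del: One_nat_def)
  qed (simp add: Suc harm_sum_one harm_def del: One_nat_def)
qed simp

lemma harm_sum_one_at_top: "filterlim (harm_sum [1]) at_top sequentially"
proof -
  have "filterlim (\<lambda>N. harm_sum [1] (Suc N)) at_top sequentially"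
    unfolding harm_sum_one by (rule harm_at_top)
  then show ?thesis by (subst (asm) filterlim_sequentially_Suc)
qed

text \<open>Harmonic numbers are at most 1 + ln N, so N^(-d) is at most e^d exp(-d L) for the scale
  L of harmonic numbers; an exponential beats every power of L.\<close>

lemma negligible_powr:
  assumes d: "0 < d" and f: "\<And>N. N > 0 \<Longrightarrow> \<bar>f N\<bar> \<le> C * real N powr (- d)"
  shows "negligible_wrt sequentially (harm_sum [1]) f"
proof (rule negligible_wrt_exp_bound[OF harm_sum_one_at_top d, where C = "C * exp d"])
  have "\<bar>f 1\<bar> \<le> C" using f[of 1] by simp
  then have "0 \<le> C" by linarith
  have "\<bar>f N\<bar> \<le> C * exp d * exp (- d * harm_sum [1] N)" if "N > 0" for N
  proof -
    have "real N powr (- d) = exp (- (d * ln (real N)))" using that by (simp add: powr_def)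
    also have "\<dots> \<le> exp (d + - (d * harm_sum [1] N))"
      using mult_left_mono[OF harm_sum_one_le[OF that], of d] d by (simp add: distrib_left)
    finally have "C * real N powr (- d) \<le> C * exp (d + - (d * harm_sum [1] N))"
      using \<open>0 \<le> C\<close> by (rule mult_left_mono)
    also have "\<dots> = C * exp d * exp (- d * harm_sum [1] N)"
      by (simp only: exp_add mult.assoc mult_minus_left)
    finally show ?thesis using f[OF that] by simp
  qed
  then show "\<forall>\<^sub>F N in sequentially. \<bar>f N\<bar> \<le> C * exp d * exp (- d * harm_sum [1] N)"
    by (auto simp: eventually_at_top_linorder intro!: exI[of _ 1])
qed

lemma has_reg_harm_sum:
  assumes "admissible ks"
  shows "has_reg sequentially (harm_sum [1]) (harm_sum ks) (mzv ks)"
proof (cases "ks = []")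
  case True
  have "eventually (\<lambda>N. harm_sum ks N = 1) sequentially"
    by (auto simp: True harm_sum_Nil eventually_at_top_linorder intro!: exI[of _ 1])
  then show ?thesis using True by (simp add: has_reg_cong has_reg_const)
next
  case False
  obtain C where C: "\<And>N. N > 0 \<Longrightarrow> \<bar>harm_sum ks N - mzv ks\<bar> \<le> C * real N powr (- (1/4))"
    using admissible_rates[OF assms False] by metis
  then show ?thesis by (intro has_reg_negligible negligible_powr[of "1/4"]) auto
qed

interpretation harmonic: regularization_model indices harmonic_product "\<lambda>ks. ks" "trailing 1"
  sequentially "harm_sum [Suc 0]" harm_sum
proof
  show "\<exists>ks. admissible ks \<and> w = ks" if "w \<in> indices" "trailing 1 w = 0" for w :: "nat list"
    using that by (cases w rule: rev_cases) (auto simp: admissible_def split: if_splits)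
  show "\<exists>u\<in>indices. trailing 1 u \<le> s \<and> lookup (harmonic_product u [1]) w \<noteq> 0 \<and>
      (\<forall>v\<in>keys (harmonic_product u [1]). v \<noteq> w \<longrightarrow> trailing 1 v \<le> s)"
    if w: "w \<in> indices" "trailing 1 w = Suc s" for w s
  proof -
    obtain u where u: "w = u @ [1]" using w by (cases w rule: rev_cases) (auto split: if_splits)
    with w have "u \<in> indices" "trailing 1 u = s" by (simp_all split: if_splits)
    then show ?thesis
      unfolding u using trailing_product[of 1 u "\<lambda>u. harmonic_product u [1]"] harmonic_product_one[of u]
      by (intro bexI[of _ u]) auto
  qed
qed (auto simp: harm_sum_one_at_top[simplified] keys_harmonic_product lin_ext_harm_sum has_reg_harm_sum[simplified]
       dest: keys_harmonic_product[THEN subsetD] simp: admissible_def)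


section \<open>Iterated integrals\<close>

definition shifted_li :: "nat \<Rightarrow> letter list \<Rightarrow> real \<Rightarrow> real" where
  "shifted_li b w z = suminf (\<lambda>n. word_coeff w n $ b * z ^ n)"

lemma summable_word_coeff:
  assumes "w \<in> index_words" "norm z < 1"
  shows "summable (\<lambda>n. word_coeff w n $ b * z ^ n)"
proof -
  obtain K where K: "K \<ge> 0" "\<And>n. word_coeff w n $ b \<le> K" using word_coeff_bounded[OF assms(1)] by metis
  show ?thesis
  proof (rule summable_comparison_test')
    show "summable (\<lambda>n. K * norm z ^ n)" using assms by (intro summable_mult summable_geometric) simp
    show "norm (word_coeff w n $ b * z ^ n) \<le> K * norm z ^ n" for n
      using K word_coeff_nonneg[OF assms(1), of n b]
      by (simp add: abs_mult power_abs mult_right_mono)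
  qed
qed

lemma shifted_li_deriv:
  assumes "w \<in> index_words" "0 < z" "z < 1"
  shows "\<exists>D. (shifted_li b w has_real_derivative D) (at z) \<and>
     (\<lambda>n. real n * word_coeff w n $ b * z ^ n) sums (z * D)"
proof -
  define c where "c n = word_coeff w n $ b" for n
  define D where "D = suminf (\<lambda>n. diffs c n * z ^ n)"
  have sm: "summable (\<lambda>n. c n * x ^ n)" if "norm x < 1" for x
    unfolding c_def using summable_word_coeff[OF assms(1) that] .
  have der: "((\<lambda>x. suminf (\<lambda>n. c n * x ^ n)) has_field_derivative D) (at z)"
    unfolding D_def using assms by (intro termdiffs_strong'[of 1]) (use sm in auto)
  have "summable (\<lambda>n. diffs c n * z ^ n)"
    using assms by (intro termdiff_converges[of z 1]) (use sm in auto)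
  from diffs_equiv[OF this] have "(\<lambda>n. z * (real n * c n * z ^ (n - Suc 0))) sums (z * D)"
    unfolding D_def by (rule sums_mult)
  moreover have "z * (real n * c n * z ^ (n - Suc 0)) = real n * c n * z ^ n" for n
    by (cases n) simp_all
  ultimately show ?thesis using der unfolding c_def shifted_li_def by auto
qed

text \<open>The coefficient of t^b in t times the shifted polylogarithm: the amount by which
  multiplication by n differs from multiplication by n - t.\<close>

definition pred_li :: "nat \<Rightarrow> letter list \<Rightarrow> real \<Rightarrow> real" where
  "pred_li b w z = (if b = 0 then 0 else shifted_li (b - 1) w z)"

lemma pred_li_sums:
  assumes "w \<in> index_words" "norm z < 1"
  shows "(\<lambda>n. (if b = 0 then 0 else word_coeff w n $ (b - 1)) * z ^ n) sums pred_li b w z"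
  using summable_sums[OF summable_word_coeff[OF assms, of "b - 1"]]
  by (simp add: pred_li_def shifted_li_def)

lemma shifted_li_deriv_X:
  assumes "w \<in> index_words" "w \<noteq> []" "0 < z" "z < 1"
  shows "(shifted_li b (w @ [X]) has_real_derivative
           (shifted_li b w z + pred_li b (w @ [X]) z) / z) (at z)"
proof -
  have iw: "w @ [X] \<in> index_words" using assms by (simp add: index_words_snoc)
  obtain D where D: "(shifted_li b (w @ [X]) has_real_derivative D) (at z)"
    "(\<lambda>n. real n * word_coeff (w @ [X]) n $ b * z ^ n) sums (z * D)"
    using shifted_li_deriv[OF iw assms(3,4)] by blast
  have eq: "real n * word_coeff (w @ [X]) n $ b = word_coeff w n $ b +
      (if b = 0 then 0 else word_coeff (w @ [X]) n $ (b - 1))" for n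
    using word_coeff_zero[OF iw] word_coeff_zero[OF assms(1,2)] word_step_nth[of n X "word_coeff w" b]
    by (cases "n = 0") (simp_all add: word_coeff_snoc)
  have "(\<lambda>n. word_coeff w n $ b * z ^ n +
      (if b = 0 then 0 else word_coeff (w @ [X]) n $ (b - 1)) * z ^ n) sums
      (shifted_li b w z + pred_li b (w @ [X]) z)"
    unfolding shifted_li_def using assms
    by (intro sums_add pred_li_sums iw summable_sums summable_word_coeff) auto
  then have "(\<lambda>n. real n * word_coeff (w @ [X]) n $ b * z ^ n) sums
      (shifted_li b w z + pred_li b (w @ [X]) z)"
    unfolding eq distrib_right .
  with D(2) have "z * D = shifted_li b w z + pred_li b (w @ [X]) z" by (rule sums_unique2)
  then have "D = (shifted_li b w z + pred_li b (w @ [X]) z) / z" using assms by (simp add: field_simps)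
  with D(1) show ?thesis by simp
qed

lemma shifted_li_deriv_Y:
  assumes "w \<in> index_words" "0 < z" "z < 1"
  shows "(shifted_li b (w @ [Y]) has_real_derivative
           (z / (1 - z) * shifted_li b w z + pred_li b (w @ [Y]) z) / z) (at z)"
proof -
  have iw: "w @ [Y] \<in> index_words" using assms by (simp add: index_words_snoc)
  obtain D where D: "(shifted_li b (w @ [Y]) has_real_derivative D) (at z)"
    "(\<lambda>n. real n * word_coeff (w @ [Y]) n $ b * z ^ n) sums (z * D)"
    using shifted_li_deriv[OF iw assms(2,3)] by blast
  define s where "s n = (\<Sum>k<n. word_coeff w k $ b)" for n
  have eq: "s n * z ^ n = real n * word_coeff (w @ [Y]) n $ b * z ^ n -
      (if b = 0 then 0 else word_coeff (w @ [Y]) n $ (b - 1)) * z ^ n" for n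
    using word_coeff_zero[OF iw] word_step_nth[of n Y "word_coeff w" b]
    by (cases "n = 0") (simp_all add: word_coeff_snoc s_def algebra_simps)
  define S where "S = z * D - pred_li b (w @ [Y]) z"
  have S: "(\<lambda>n. s n * z ^ n) sums S"
    unfolding eq S_def using assms by (intro sums_diff D(2) pred_li_sums iw) auto
  \<comment> \<open>The generating function of partial sums is evaluated twice, with the index
    shifted by one. Comparison gives S = z (S + f), the source of the factor z/(1 - z).\<close>
  have "(\<lambda>n. s (Suc n) * z ^ Suc n) sums S"
    using sums_Suc_iff[of "\<lambda>n. s n * z ^ n" S] S by (simp add: s_def)
  moreover have "(\<lambda>n. s (Suc n) * z ^ Suc n) sums (z * (S + shifted_li b w z))"
  proof -
    have "(\<lambda>n. z * (s n * z ^ n + word_coeff w n $ b * z ^ n)) sums (z * (S + shifted_li b w z))"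
      unfolding shifted_li_def using assms
      by (intro sums_mult sums_add S summable_sums summable_word_coeff) auto
    then show ?thesis by (simp add: s_def algebra_simps)
  qed
  ultimately have "S = z * (S + shifted_li b w z)" by (rule sums_unique2)
  then have "S * (1 - z) = z * shifted_li b w z" by (simp add: algebra_simps)
  then have "S = z / (1 - z) * shifted_li b w z" using assms by (simp add: field_simps)
  then have "z * D = z / (1 - z) * shifted_li b w z + pred_li b (w @ [Y]) z" by (simp add: S_def)
  then have "D = (z / (1 - z) * shifted_li b w z + pred_li b (w @ [Y]) z) / z"
    using assms by (metis less_irrefl nonzero_mult_div_cancel_left)
  with D(1) show ?thesis by simp
qed

text \<open>The iterated integral from \<open>0\<close> to \<open>z\<close> of the forms \<open>dz/z\<close> for \<^const>\<open>X\<close> and \<open>dz/(1-z)\<close> for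
  \<^const>\<open>Y\<close>, the last letter being outermost and \<open>log\<close> regularizing the divergence at \<open>0\<close>:
  the words \<open>x\<^sup>m w\<close> are the coefficients of \<open>(-t)\<^sup>m\<close> in the polylogarithm of \<open>w\<close> with all summation
  variables shifted by \<open>-t\<close>.\<close>

definition log_li :: "nat \<Rightarrow> letter list \<Rightarrow> real \<Rightarrow> real" where
  "log_li m w z = (\<Sum>a\<le>m. ln z ^ a / fact a * ((- 1) ^ (m - a) * shifted_li (m - a) w z))"

definition iter_int :: "letter list \<Rightarrow> real \<Rightarrow> real" where
  "iter_int u = log_li (length (takeWhile (\<lambda>a. a = X) u)) (dropWhile (\<lambda>a. a = X) u)"

lemma dropWhile_X_in_index_words: "dropWhile (\<lambda>a. a = X) u \<in> index_words"
  by (induction u) (auto simp: index_words_Cons intro: letter.exhaust)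

lemma iter_int_replicate: "w \<in> index_words \<Longrightarrow> iter_int (replicate m X @ w) = log_li m w"
  by (cases w) (auto simp: iter_int_def index_words_Cons takeWhile_append dropWhile_append)

lemma word_X_decomp:
  obtains m w where "u = replicate m X @ w" "w \<in> index_words"
proof
  show "u = replicate (length (takeWhile (\<lambda>a. a = X) u)) X @ dropWhile (\<lambda>a. a = X) u"
    by (metis (full_types) replicate_length_same set_takeWhileD takeWhile_dropWhile_id)
  show "dropWhile (\<lambda>a. a = X) u \<in> index_words" by (rule dropWhile_X_in_index_words)
qed

lemma shifted_li_Nil: "shifted_li b [] z = (if b = 0 then 1 else 0)"
proof -
  have "word_coeff [] n $ b * z ^ n = (if n = 0 then (if b = 0 then 1 else 0) else 0)" for n
    by (simp add: word_coeff_Nil)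
  then show ?thesis
    unfolding shifted_li_def using suminf_finite[of "{0}" "\<lambda>n. word_coeff [] n $ b * z ^ n"]
    by (simp add: word_coeff_Nil)
qed

lemma log_li_Nil: "log_li m [] z = ln z ^ m / fact m"
proof -
  have "log_li m [] z = (\<Sum>a\<le>m. if a = m then ln z ^ m / fact m else 0)"
    unfolding log_li_def by (intro sum.cong refl) (auto simp: shifted_li_Nil)
  then show ?thesis by simp
qed

text \<open>With a formal variable T dual to \<open>m\<close>, \<open>log_li\<close> is the
  coefficient of T^m in z^T times the polylogarithm shifted by t = -T. The operator z d/dz produces
  T from the power and -T from the shift. These cancel, which leaves the contribution
  \<open>e\<close> of the last letter.\<close>

lemma log_li_deriv_aux:
  assumes z: "0 < z"
    and D: "\<And>b. (shifted_li b w has_real_derivative (e b + pred_li b w z) / z) (at z)"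
  shows "(log_li m w has_real_derivative
           (\<Sum>a\<le>m. ln z ^ a / fact a * ((- 1) ^ (m - a) * e (m - a))) / z) (at z)"
proof -
  define s where "s a = (- 1) ^ (m - a) * shifted_li (m - a) w z" for a
  have "(log_li m w has_real_derivative
      (\<Sum>a\<le>m. (real a * ln z ^ (a - 1) / fact a * (1 / z)) * s a +
        ln z ^ a / fact a * ((- 1) ^ (m - a) * ((e (m - a) + pred_li (m - a) w z) / z)))) (at z)"
    unfolding log_li_def s_def using z
    by (auto intro!: derivative_eq_intros D sum.cong simp: field_simps)
  moreover have "(\<Sum>a\<le>m. (real a * ln z ^ (a - 1) / fact a * (1 / z)) * s a +
        ln z ^ a / fact a * ((- 1) ^ (m - a) * ((e (m - a) + pred_li (m - a) w z) / z))) =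
      ((\<Sum>a\<le>m. real a * ln z ^ (a - 1) / fact a * s a) +
       (\<Sum>a\<le>m. ln z ^ a / fact a * ((- 1) ^ (m - a) * e (m - a))) +
       (\<Sum>a\<le>m. ln z ^ a / fact a * ((- 1) ^ (m - a) * pred_li (m - a) w z))) / z"
    unfolding sum.distrib[symmetric] sum_divide_distrib
    by (intro sum.cong refl) (simp add: add_divide_distrib ring_distribs mult_ac)
  moreover have "(\<Sum>a\<le>m. real a * ln z ^ (a - 1) / fact a * s a) +
       (\<Sum>a\<le>m. ln z ^ a / fact a * ((- 1) ^ (m - a) * pred_li (m - a) w z)) = 0"
  proof (cases m)
    case (Suc k)
    have "(\<Sum>a\<le>m. real a * ln z ^ (a - 1) / fact a * s a) =
        (\<Sum>a\<le>k. real (Suc a) * ln z ^ a / fact (Suc a) * s (Suc a))"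
      unfolding Suc by (subst sum.atMost_Suc_shift) simp
    also have "\<dots> = (\<Sum>a\<le>k. ln z ^ a / fact a * s (Suc a))"
      by (intro sum.cong refl) (simp del: of_nat_Suc)
    also have "\<dots> = (\<Sum>a\<le>k. - (ln z ^ a / fact a * ((- 1) ^ (m - a) * pred_li (m - a) w z)))"
      by (intro sum.cong refl) (auto simp: s_def Suc pred_li_def Suc_diff_le)
    finally show ?thesis unfolding Suc by (simp add: sum_negf pred_li_def)
  qed (simp add: s_def pred_li_def)
  moreover have "\<And>A B C :: real. A + C = 0 \<Longrightarrow> A + B + C = B" by simp
  ultimately show ?thesis by (simp only:)
qed

lemma iter_int_deriv_X:
  assumes "0 < z" "z < 1"
  shows "(iter_int (u @ [X]) has_real_derivative iter_int u z / z) (at z)"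
proof -
  obtain m w where u: "u = replicate m X @ w" "w \<in> index_words" by (rule word_X_decomp)
  show ?thesis
  proof (cases "w = []")
    case True
    have "u @ [X] = replicate (Suc m) X @ []" using u True by (simp add: replicate_append_same)
    then have "iter_int (u @ [X]) = log_li (Suc m) []" by (simp only: iter_int_replicate index_words_Nil)
    moreover have "iter_int u = log_li m []" using iter_int_replicate[of "[]" m] u True by simp
    moreover have "((\<lambda>z. ln z ^ Suc m / fact (Suc m)) has_real_derivative
        (1 + real m) * (1 / z * ln z ^ m) / fact (Suc m)) (at z)"
      using assms by (intro DERIV_cdivide DERIV_power_Suc DERIV_ln_divide) auto
    moreover have "(1 + real m) * (1 / z * ln z ^ m) / fact (Suc m) = ln z ^ m / fact m / z"
      by (simp add: divide_simps)
    ultimately show ?thesis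
      by (simp add: log_li_Nil[abs_def] log_li_Nil del: power_Suc fact_Suc)
  next
    case False
    have w: "w @ [X] \<in> index_words" using u False by (simp add: index_words_snoc)
    have 1: "iter_int (u @ [X]) = log_li m (w @ [X])" using iter_int_replicate[OF w, of m] u by simp
    have 2: "iter_int u = log_li m w" using iter_int_replicate u by simp
    show ?thesis unfolding 1 2 log_li_def[of m w z]
      using assms by (intro log_li_deriv_aux shifted_li_deriv_X u False)
  qed
qed

lemma iter_int_deriv_Y:
  assumes "0 < z" "z < 1"
  shows "(iter_int (u @ [Y]) has_real_derivative iter_int u z / (1 - z)) (at z)"
proof -
  obtain m w where u: "u = replicate m X @ w" "w \<in> index_words" by (rule word_X_decomp)
  have w: "w @ [Y] \<in> index_words" using u by (simp add: index_words_snoc)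
  have 1: "iter_int (u @ [Y]) = log_li m (w @ [Y])" using iter_int_replicate[OF w, of m] u by simp
  have 2: "iter_int u = log_li m w" using iter_int_replicate u by simp
  have "(iter_int (u @ [Y]) has_real_derivative
     (\<Sum>a\<le>m. ln z ^ a / fact a * ((- 1) ^ (m - a) * (z / (1 - z) * shifted_li (m - a) w z))) / z) (at z)"
    unfolding 1 using assms by (intro log_li_deriv_aux shifted_li_deriv_Y u)
  moreover have "(\<Sum>a\<le>m. ln z ^ a / fact a * ((- 1) ^ (m - a) * (z / (1 - z) * shifted_li (m - a) w z))) / z
      = log_li m w z / (1 - z)"
    unfolding log_li_def sum_divide_distrib using assms by (intro sum.cong refl) (simp add: field_simps)
  ultimately show ?thesis unfolding 2 by simp
qed

lemma iter_int_Nil [simp]: "iter_int [] z = 1"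
  using iter_int_replicate[of "[]" 0] by (simp add: log_li_Nil)

lemma iter_int_replicate_X: "iter_int (replicate m X) z = ln z ^ m / fact m"
  using iter_int_replicate[of "[]" m] by (simp add: log_li_Nil)

section \<open>Behaviour of iterated integrals at the end point 0\<close>

lemma id_times_ln_power_tendsto: "((\<lambda>z. z * ln z ^ k) \<longlongrightarrow> (0::real)) (at_right 0)"
proof -
  have "filterlim (\<lambda>z::real. - ln z) at_top (at_right 0)"
    using ln_at_0 by (simp add: filterlim_uminus_at_top)
  from tendsto_mult[OF tendsto_const filterlim_compose[OF tendsto_power_div_exp_0 this, of k]]
  have "((\<lambda>z. (- 1) ^ k * ((- ln z) ^ k / exp (- ln z))) \<longlongrightarrow> (- 1) ^ k * (0::real)) (at_right 0)" .
  moreover have "\<forall>\<^sub>F z::real in at_right 0. (- 1) ^ k * ((- ln z) ^ k / exp (- ln z)) = z * ln z ^ k"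
    using eventually_at_right_less[of 0]
    by eventually_elim (simp add: exp_minus power_minus[of "ln _"] field_simps)
  ultimately show ?thesis by (auto intro: Lim_transform_eventually)
qed

text \<open>The constant coefficient vanishes for a nonempty word, so the power series is divisible
  by z, and z absorbs any power of the logarithm.\<close>

lemma shifted_li_times_ln_power_tendsto:
  assumes "w \<in> index_words" "w \<noteq> []"
  shows "((\<lambda>z. shifted_li b w z * ln z ^ k) \<longlongrightarrow> 0) (at_right 0)"
proof -
  have "continuous_on (cball 0 (1/2)) (\<lambda>z. suminf (\<lambda>n. word_coeff w (Suc n) $ b * z ^ n))"
  proof (rule continuous_on_subset)
    show "continuous_on (ball 0 1) (\<lambda>z. suminf (\<lambda>n. word_coeff w (Suc n) $ b * (z::real) ^ n))"
    proof (intro continuous_at_imp_continuous_on ballI)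
      fix z :: real assume "z \<in> ball 0 1"
      then show "isCont (\<lambda>z. suminf (\<lambda>n. word_coeff w (Suc n) $ b * z ^ n)) z"
        using summable_word_coeff[OF assms(1), of _ b]
          summable_powser_split_head[of "\<lambda>n. word_coeff w n $ b"]
        by (intro DERIV_isCont[OF termdiffs_strong'[of 1]]) auto
    qed
  qed auto
  then have "isCont (\<lambda>z. suminf (\<lambda>n. word_coeff w (Suc n) $ b * z ^ n)) 0"
    by (rule continuous_on_interior) simp
  then have "((\<lambda>z. suminf (\<lambda>n. word_coeff w (Suc n) $ b * z ^ n)) \<longlongrightarrow>
      suminf (\<lambda>n. word_coeff w (Suc n) $ b * 0 ^ n)) (at_right 0)"
    by (rule tendsto_within_subset[OF isContD]) simp
  from tendsto_mult[OF this id_times_ln_power_tendsto[of k]]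
  have "((\<lambda>z. suminf (\<lambda>n. word_coeff w (Suc n) $ b * z ^ n) * (z * ln z ^ k)) \<longlongrightarrow> 0) (at_right 0)"
    by simp
  moreover have "\<forall>\<^sub>F z in at_right 0. suminf (\<lambda>n. word_coeff w (Suc n) $ b * z ^ n) * (z * ln z ^ k)
      = shifted_li b w z * ln z ^ k"
    using eventually_at_right_real[of 0 1, simplified]
  proof eventually_elim
    case (elim z)
    then have "shifted_li b w z = suminf (\<lambda>n. word_coeff w (Suc n) $ b * z ^ n) * z"
      using powser_split_head(1)[OF summable_word_coeff[OF assms(1), of z b]] word_coeff_zero[OF assms]
      by (simp add: shifted_li_def)
    then show ?case by simp
  qed
  ultimately show ?thesis by (rule Lim_transform_eventually)
qed

lemma iter_int_times_ln_power_tendsto: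
  assumes "Y \<in> set u"
  shows "((\<lambda>z. iter_int u z * ln z ^ k) \<longlongrightarrow> 0) (at_right 0)"
proof -
  obtain m w where u: "u = replicate m X @ w" "w \<in> index_words" by (rule word_X_decomp)
  have "w \<noteq> []" using assms u by auto
  have "((\<lambda>z. \<Sum>a\<le>m. (- 1) ^ (m - a) / fact a * (shifted_li (m - a) w z * ln z ^ (a + k))) \<longlongrightarrow>
      (\<Sum>a\<le>m. (- 1) ^ (m - a) / fact a * 0)) (at_right 0)"
    by (intro tendsto_intros shifted_li_times_ln_power_tendsto u \<open>w \<noteq> []\<close>)
  moreover have "(\<Sum>a\<le>m. (- 1) ^ (m - a) / fact a * (shifted_li (m - a) w z * ln z ^ (a + k)))
      = iter_int u z * ln z ^ k" for z
    unfolding u iter_int_replicate[OF u(2)] log_li_def sum_distrib_right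
    by (intro sum.cong refl) (simp add: power_add field_simps)
  ultimately show ?thesis by simp
qed

lemma iter_int_tendsto_zero: "Y \<in> set u \<Longrightarrow> (iter_int u \<longlongrightarrow> 0) (at_right 0)"
  using iter_int_times_ln_power_tendsto[of u 0] by simp

lemma zero_deriv_imp_zero:
  fixes f :: "real \<Rightarrow> real"
  assumes deriv: "\<And>z. 0 < z \<Longrightarrow> z < 1 \<Longrightarrow> (f has_real_derivative 0) (at z)"
    and lim: "(f \<longlongrightarrow> 0) (at_right 0)" and z: "0 < z" "z < 1"
  shows "f z = 0"
proof -
  have "\<exists>c. \<forall>x\<in>{0<..<1}. f x = c"
    using deriv by (intro has_field_derivative_zero_constant) (auto intro: has_field_derivative_at_within)
  then obtain c where c: "\<And>x. 0 < x \<Longrightarrow> x < 1 \<Longrightarrow> f x = c" by auto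
  have "\<forall>\<^sub>F x in at_right 0. c = f x"
    using eventually_at_right_real[of 0 1, simplified] by eventually_elim (use c in auto)
  from Lim_transform_eventually[OF tendsto_const this] have "(f \<longlongrightarrow> c) (at_right 0)" .
  with lim have "c = 0" by (intro tendsto_unique[of "at_right (0::real)" f]) auto
  with c z show ?thesis by simp
qed

text \<open>The usual comparison at a base point is replaced by a limit of the difference at 0,
  since the forms and the logarithms are singular there.\<close>

lemma eq_of_deriv_eq:
  fixes f g :: "real \<Rightarrow> real"
  assumes "\<And>z. 0 < z \<Longrightarrow> z < 1 \<Longrightarrow> (f has_real_derivative h z) (at z)"
    and "\<And>z. 0 < z \<Longrightarrow> z < 1 \<Longrightarrow> (g has_real_derivative h z) (at z)"
    and "((\<lambda>z. f z - g z) \<longlongrightarrow> 0) (at_right 0)" "0 < z" "z < 1"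
  shows "f z = g z"
  using zero_deriv_imp_zero[of "\<lambda>z. f z - g z" z] DERIV_diff[OF assms(1,2)] assms(3-5) by auto


section \<open>The shuffle product\<close>

definition letter_form :: "letter \<Rightarrow> real \<Rightarrow> real" where
  "letter_form a z = (case a of X \<Rightarrow> 1 / z | Y \<Rightarrow> 1 / (1 - z))"

lemma iter_int_deriv:
  "0 < z \<Longrightarrow> z < 1 \<Longrightarrow> (iter_int (u @ [a]) has_real_derivative letter_form a z * iter_int u z) (at z)"
  using iter_int_deriv_X iter_int_deriv_Y by (cases a) (simp_all add: letter_form_def)

text \<open>The product is defined by stripping first letters, whereas differentiating an iterated
  integral strips the last one. The recursion at the right end is the form that matches the Leibniz
  rule.\<close>

lemma lin_ext_shuffle_snoc:
  "lin_ext f (shuffle_product (u @ [a]) (v @ [b])) =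
     lin_ext (\<lambda>w. f (w @ [a])) (shuffle_product u (v @ [b])) +
     lin_ext (\<lambda>w. f (w @ [b])) (shuffle_product (u @ [a]) v)"
proof (induction u v arbitrary: f rule: shuffle_product.induct)
  case (1 u)
  show ?case
  proof (induction u arbitrary: f)
    case (Cons c u)
    show ?case using Cons[of "\<lambda>w. f (c # w)"]
      by (cases u) (simp_all add: lin_ext_add lin_ext_lift_linear)
  qed (simp add: lin_ext_add lin_ext_lift_linear)
next
  case (2 d v)
  have "lin_ext f (shuffle_product ([] @ [a]) (v @ [b])) =
     lin_ext (\<lambda>w. f (w @ [a])) (shuffle_product [] (v @ [b])) +
     lin_ext (\<lambda>w. f (w @ [b])) (shuffle_product ([] @ [a]) v)" for f
  proof (induction v arbitrary: f)
    case (Cons c v)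
    show ?case using Cons[of "\<lambda>w. f (c # w)"]
      by (cases v) (simp_all add: lin_ext_add lin_ext_lift_linear)
  qed (simp add: lin_ext_add lin_ext_lift_linear)
  from this[of "\<lambda>w. f (d # w)"] show ?case
    by (cases v) (simp_all add: lin_ext_add lin_ext_lift_linear)
next
  case (3 c u d v)
  show ?case
    using "3.IH"(1)[of "\<lambda>w. f (c # w)"] "3.IH"(2)[of "\<lambda>w. f (d # w)"]
    by (simp add: lin_ext_add lin_ext_lift_linear)
qed

lemma keys_shuffle_product:
  assumes "u \<in> index_words" "v \<in> index_words"
  shows "keys (shuffle_product u v) \<subseteq> index_words"
proof (cases u; cases v)
  fix a u' b v' assume eq: "u = a # u'" "v = b # v'"
  have "keys (shuffle_product u v) \<subseteq>
      keys (lift_linear ((#) Y) (shuffle_product u' v)) \<union>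
      keys (lift_linear ((#) Y) (shuffle_product u v'))"
    using Poly_Mapping.keys_add assms by (simp add: eq index_words_Cons)
  also have "\<dots> \<subseteq> range ((#) Y)"
    by (intro Un_least order_trans[OF keys_lift_linear image_mono[OF subset_UNIV]])
  finally show ?thesis by (auto simp: index_words_Cons)
qed (use assms in \<open>auto simp: basis_vec_def\<close>)

text \<open>For nonempty words both sides have the same derivative, by the induction hypothesis and
  the Leibniz rule. Both tend to 0 at 0 because the empty word does not occur in their shuffle
  product and each of its words contains a \<open>Y\<close>.\<close>

lemma lin_ext_iter_int_shuffle:
  assumes "u \<in> index_words" "v \<in> index_words" "0 < z" "z < 1"
  shows "lin_ext (\<lambda>w. iter_int w z) (shuffle_product u v) = iter_int u z * iter_int v z"
  using assms
proof (induction "length u + length v" arbitrary: u v z rule: less_induct)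
  case less
  show ?case
  proof (cases "u = [] \<or> v = []")
    case True
    then show ?thesis by (cases v) auto
  next
    case False
    then obtain u' a v' b where eq: "u = u' @ [a]" "v = v' @ [b]" by (metis rev_exhaust)
    have iw: "u' \<in> index_words" "v' \<in> index_words" using less.prems by (auto simp: eq index_words_snoc)
    show ?thesis
    proof (rule eq_of_deriv_eq[OF _ _ _ less.prems(3,4)])
      fix z :: real assume z: "0 < z" "z < 1"
      have IH: "lin_ext (\<lambda>w. iter_int w z) (shuffle_product u' v) = iter_int u' z * iter_int v z"
        "lin_ext (\<lambda>w. iter_int w z) (shuffle_product u v') = iter_int u z * iter_int v' z"
        using less.prems iw z by (auto intro!: less.hyps simp: eq)
      have deriv_lin: "((\<lambda>z. lin_ext (\<lambda>w. iter_int (w @ [c]) z) p) has_real_derivative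
          letter_form c z * lin_ext (\<lambda>w. iter_int w z) p) (at z)" for c p
      proof -
        have "((\<lambda>z. lin_ext (\<lambda>w. iter_int (w @ [c]) z) p) has_real_derivative
          (\<Sum>w\<in>keys p. of_rat (lookup p w) * (letter_form c z * iter_int w z))) (at z)"
          unfolding lin_ext_def by (intro DERIV_sum DERIV_cmult iter_int_deriv z)
        then show ?thesis by (simp add: lin_ext_def sum_distrib_left mult_ac)
      qed
      have "((\<lambda>z. lin_ext (\<lambda>w. iter_int w z) (shuffle_product u v)) has_real_derivative
          letter_form a z * lin_ext (\<lambda>w. iter_int w z) (shuffle_product u' v) +
          letter_form b z * lin_ext (\<lambda>w. iter_int w z) (shuffle_product u v')) (at z)"
        unfolding eq lin_ext_shuffle_snoc by (intro DERIV_add deriv_lin)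
      then show "((\<lambda>z. lin_ext (\<lambda>w. iter_int w z) (shuffle_product u v)) has_real_derivative
          letter_form a z * iter_int u' z * iter_int v z + iter_int u z * (letter_form b z * iter_int v' z)) (at z)"
        unfolding IH by (simp add: algebra_simps)
      show "((\<lambda>z. iter_int u z * iter_int v z) has_real_derivative
          letter_form a z * iter_int u' z * iter_int v z + iter_int u z * (letter_form b z * iter_int v' z)) (at z)"
        using DERIV_mult'[OF iter_int_deriv[OF z, of u' a] iter_int_deriv[OF z, of v' b]]
        unfolding eq by (simp add: algebra_simps)
    next
      have Y: "Y \<in> set w" if "w \<in> index_words" "w \<noteq> []" for w
        using that by (cases w) (auto simp: index_words_Cons)
      have "[] \<notin> keys (shuffle_product u v)"
      proof -
        have "lin_ext (\<lambda>w. if w = [] then 1 else 0) (shuffle_product u v) = 0"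
          unfolding eq lin_ext_shuffle_snoc by (simp add: lin_ext_def)
        then show ?thesis unfolding lookup_eq_lin_ext[symmetric] by (simp add: in_keys_iff)
      qed
      then have "((\<lambda>z. lin_ext (\<lambda>w. iter_int w z) (shuffle_product u v)) \<longlongrightarrow>
          (\<Sum>w\<in>keys (shuffle_product u v).
             of_rat (lookup (shuffle_product u v) w) * 0)) (at_right 0)"
        unfolding lin_ext_def using keys_shuffle_product[OF less.prems(1,2)]
        by (intro tendsto_sum tendsto_mult tendsto_const iter_int_tendsto_zero Y) auto
      moreover have "((\<lambda>z. iter_int u z * iter_int v z) \<longlongrightarrow> 0 * 0) (at_right 0)"
        using less.prems False by (intro tendsto_mult iter_int_tendsto_zero Y) auto
      ultimately show "((\<lambda>z. lin_ext (\<lambda>w. iter_int w z) (shuffle_product u v) -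
          iter_int u z * iter_int v z) \<longlongrightarrow> 0) (at_right 0)"
        using tendsto_diff by fastforce
    qed
  qed
qed

lemma iter_int_Y:
  assumes "0 < z" "z < 1"
  shows "iter_int [Y] z = - ln (1 - z)"
proof (rule eq_of_deriv_eq[OF _ _ _ assms])
  show "(iter_int [Y] has_real_derivative 1 / (1 - z)) (at z)" if "0 < z" "z < 1" for z
    using iter_int_deriv_Y[OF that, of "[]"] by simp
  show "((\<lambda>z. - ln (1 - z)) has_real_derivative 1 / (1 - z)) (at z)" if "0 < z" "z < 1" for z :: real
    using that by (auto intro!: derivative_eq_intros)
  have "((\<lambda>z::real. - ln (1 - z)) \<longlongrightarrow> - ln (1 - 0)) (at_right 0)"
    by (intro tendsto_intros) auto
  from tendsto_diff[OF iter_int_tendsto_zero this]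
  show "((\<lambda>z. iter_int [Y] z - - ln (1 - z)) \<longlongrightarrow> 0) (at_right 0)" by simp
qed

lemma eventually_at_left_one: "\<forall>\<^sub>F z in at_left (1::real). 0 < z \<and> z < 1"
  using eventually_at_left_real[of 0 1] by simp

lemma iter_int_Y_at_top: "filterlim (iter_int [Y]) at_top (at_left 1)"
proof -
  have "filterlim (\<lambda>z::real. 1 - z) (at_right 0) (at_left 1)"
    unfolding filterlim_at by (auto simp: eventually_at_filter intro!: tendsto_eq_intros)
  from filterlim_compose[OF ln_at_0 this] have lim: "filterlim (\<lambda>z::real. - ln (1 - z)) at_top (at_left 1)"
    by (simp add: filterlim_uminus_at_top)
  have "\<forall>\<^sub>F z in at_left (1::real). - ln (1 - z) = iter_int [Y] z"
    using eventually_at_left_one by eventually_elim (simp add: iter_int_Y)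
  from filterlim_cong[OF refl refl this] lim show ?thesis by simp
qed

lemma iter_int_index_word: "w \<in> index_words \<Longrightarrow> iter_int w z = shifted_li 0 w z"
  using iter_int_replicate[of w 0] by (simp add: log_li_def)

lemma negligible_one_minus_powr:
  assumes "0 < d" "\<forall>\<^sub>F z in at_left 1. \<bar>f z\<bar> \<le> C * (1 - z) powr d"
  shows "negligible_wrt (at_left 1) (iter_int [Y]) f"
proof (rule negligible_wrt_exp_bound[OF iter_int_Y_at_top assms(1)])
  show "\<forall>\<^sub>F z in at_left 1. \<bar>f z\<bar> \<le> C * exp (- d * iter_int [Y] z)"
    using eventually_at_left_one assms(2) by eventually_elim (simp add: powr_def iter_int_Y)
qed

lemma has_reg_iter_int_admissible:
  assumes "admissible ks"
  shows "has_reg (at_left 1) (iter_int [Y]) (iter_int (index_word ks)) (mzv ks)"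
proof (cases "ks = []")
  case True
  then show ?thesis using has_reg_const[of _ _ 1] by (simp add: iter_int_Nil[abs_def])
next
  case False
  obtain C where "\<And>z. 0 < z \<Longrightarrow> z < 1 \<Longrightarrow> \<bar>iter_int (index_word ks) z - mzv ks\<bar> \<le> C * (1 - z) powr (1/4)"
    using admissible_rates[OF assms False] unfolding iter_int_index_word[OF index_word_in_index_words] shifted_li_def
    by metis
  then show ?thesis
    by (intro has_reg_negligible negligible_one_minus_powr[of "1/4" _ C]
          eventually_mono[OF eventually_at_left_one]) auto
qed

lemma shuffle_product_Y:
  assumes "\<And>w. trailing Y w \<le> trailing Y u \<Longrightarrow> f w = 0"
  shows "lin_ext f (shuffle_product u [Y]) = real (Suc (trailing Y u)) * f (u @ [Y])"
proof (rule lin_ext_trailing_product[where P = "\<lambda>_. True"])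
  show "lin_ext f (shuffle_product (u @ [b]) [Y]) =
      lin_ext (\<lambda>w. f (w @ [b])) (shuffle_product u [Y]) + f (u @ [b, Y])" for u b and f :: "letter list \<Rightarrow> real"
    using lin_ext_shuffle_snoc[of f u b "[]" Y] by simp
qed (use assms in auto)

lemma index_word_one [simp]: "index_word [Suc 0] = [Y]"
  by (simp add: index_word_def)

interpretation shuffle: regularization_model index_words shuffle_product index_word "trailing Y"
  "at_left 1" "iter_int [Y]" iter_int
proof
  show "\<exists>ks. admissible ks \<and> w = index_word ks" if "w \<in> index_words" "trailing Y w = 0" for w
  proof -
    have "w = [] \<or> last w = X"
      using that by (cases w rule: rev_cases) (auto split: if_splits intro: letter.exhaust)
    with index_words_imp_index_word[OF that(1)] show ?thesis by blast
  qed
  show "\<exists>u\<in>index_words. trailing Y u \<le> s \<and> lookup (shuffle_product u (index_word [1])) w \<noteq> 0 \<and>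
      (\<forall>v\<in>keys (shuffle_product u (index_word [1])). v \<noteq> w \<longrightarrow> trailing Y v \<le> s)"
    if w: "w \<in> index_words" "trailing Y w = Suc s" for w s
  proof -
    obtain u where u: "w = u @ [Y]" using w by (cases w rule: rev_cases) (auto split: if_splits)
    with w have "u \<in> index_words" "trailing Y u = s" by (simp_all add: index_words_snoc)
    then show ?thesis
      unfolding u using trailing_product[of Y u "\<lambda>u. shuffle_product u [Y]"] shuffle_product_Y[of u]
      by (intro bexI[of _ u]) auto
  qed
  show "\<forall>\<^sub>F z in at_left 1. lin_ext (\<lambda>w. iter_int w z) (shuffle_product u v) = iter_int u z * iter_int v z"
    if "u \<in> index_words" "v \<in> index_words" for u v
    using eventually_at_left_one by eventually_elim (use that lin_ext_iter_int_shuffle in auto)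
qed (use keys_shuffle_product iter_int_Y_at_top has_reg_iter_int_admissible in \<open>auto simp: index_words_Cons\<close>)

lemma zeta_harmonic_eq: "ks \<in> indices \<Longrightarrow> zeta_harmonic ks = harmonic.regv ks"
  unfolding zeta_harmonic_def by (rule harmonic.the_regularization)

lemma zeta_shuffle_eq: "zeta_shuffle ks = shuffle.regv (index_word ks)"
  unfolding zeta_shuffle_def by (rule shuffle.the_regularization) simp


section \<open>Shifted multiple zeta values\<close>

definition weak_comps :: "nat \<Rightarrow> nat \<Rightarrow> nat list set" where
  "weak_comps r m = {ls. length ls = r \<and> sum_list ls = m}"

definition shift_binom :: "nat list \<Rightarrow> nat list \<Rightarrow> real" where
  "shift_binom ks ls = (\<Prod>i<length ks. real ((ks ! i + ls ! i - 1) choose (ls ! i)))"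

lemma weak_comps_zero: "weak_comps 0 m = (if m = 0 then {[]} else {})"
  by (auto simp: weak_comps_def)

lemma weak_comps_Suc:
  "weak_comps (Suc r) m = (\<lambda>(l, ls). ls @ [l]) ` (SIGMA l:{..m}. weak_comps r (m - l))"
proof (intro equalityI subsetI)
  fix ls assume ls: "ls \<in> weak_comps (Suc r) m"
  then obtain ms l where "ls = ms @ [l]" by (cases ls rule: rev_cases) (auto simp: weak_comps_def)
  with ls show "ls \<in> (\<lambda>(l, ls). ls @ [l]) ` (SIGMA l:{..m}. weak_comps r (m - l))"
    by (auto simp: weak_comps_def intro!: image_eqI[of _ _ "(l, ms)"])
qed (auto simp: weak_comps_def)

lemma finite_weak_comps [simp]: "finite (weak_comps r m)"
  by (induction r arbitrary: m) (auto simp: weak_comps_zero weak_comps_Suc)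

lemma sum_weak_comps_Suc:
  "(\<Sum>ls\<in>weak_comps (Suc r) m. f ls) = (\<Sum>l\<le>m. \<Sum>ls\<in>weak_comps r (m - l). (f (ls @ [l]) :: real))"
proof -
  have inj: "inj_on (\<lambda>(l, ls). ls @ [l]) (SIGMA l:{..m}. weak_comps r (m - l))"
    by (auto simp: inj_on_def)
  have "(\<Sum>ls\<in>weak_comps (Suc r) m. f ls) =
      (\<Sum>(l, ls)\<in>(SIGMA l:{..m}. weak_comps r (m - l)). f (ls @ [l]))"
    using sum.reindex[OF inj, of f] by (simp add: weak_comps_Suc comp_def case_prod_unfold)
  also have "\<dots> = (\<Sum>l\<le>m. \<Sum>ls\<in>weak_comps r (m - l). f (ls @ [l]))"
    by (rule sum.Sigma[symmetric]) auto
  finally show ?thesis .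
qed

lemma shift_binom_snoc:
  "length ls = length ks \<Longrightarrow>
     shift_binom (ks @ [k]) (ls @ [l]) = shift_binom ks ls * real ((k + l - 1) choose l)"
  by (simp add: shift_binom_def nth_append)

text \<open>The negative binomial series of (n - t)^(-k). It is the origin of the binomial
  coefficients in the definition of the shifted values.\<close>

lemma inverse_shift_power_nth:
  assumes "n > 0" "k > 0"
  shows "(inverse (fps_const (real n) - fps_X) ^ k) $ l = real ((k + l - 1) choose l) / real n ^ (k + l)"
proof -
  have "fps_const (real n) - fps_X = fps_const (real n) * (1 - fps_const (1 / real n) * fps_X)"
    using assms by (simp add: right_diff_distrib flip: mult.assoc)
  then have "inverse (fps_const (real n) - fps_X) =
      fps_const (1 / real n) * inverse (1 - fps_const (1 / real n) * fps_X)"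
    using assms by (simp only: fps_inverse_mult fps_const_inverse inverse_eq_divide)
  then have "inverse (fps_const (real n) - fps_X) ^ k =
      fps_const (1 / real n ^ k) * inverse ((1 - fps_const (1 / real n) * fps_X) ^ k)"
    by (simp only: fps_inverse_power power_mult_distrib fps_const_power power_one_over)
  also have "\<dots> $ l = real ((k + l - 1) choose l) / real n ^ (k + l)"
    using assms by (simp add: one_minus_const_fps_X_neg_power' power_add power_divide)
  finally show ?thesis .
qed

lemma map2_plus_snoc:
  "length ls = length ks \<Longrightarrow> map2 (+) (ks @ [k]) (ls @ [l]) = map2 (+) ks ls @ [k + l :: nat]"
  by simp

lemma fps_mult_nth_rev: "(f * g) $ m = (\<Sum>l\<le>m. f $ (m - l) * (g $ l :: real))"
  using fps_mult_nth[of g f m] by (simp add: mult.commute atLeast0AtMost)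

text \<open>Expanding every factor (n_i - t)^(-k_i) separately distributes the exponent
  \<open>m\<close> over the entries; thus the shifted values are Taylor coefficients in a common
  shift of all summation variables.\<close>

lemma word_coeff_shift:
  assumes "ks \<in> indices"
  shows "word_coeff (index_word ks) n $ m =
     (\<Sum>ls\<in>weak_comps (length ks) m. shift_binom ks ls * word_coeff (index_word (map2 (+) ks ls)) n $ 0)"
  using assms
proof (induction ks arbitrary: n m rule: rev_induct)
  case Nil
  show ?case by (simp add: word_coeff_Nil weak_comps_zero shift_binom_def)
next
  case (snoc k ks)
  then have k: "k \<ge> 1" and ks: "ks \<in> indices" by simp_all
  show ?case
  proof (cases "n = 0")
    case True
    then show ?thesis
      using word_coeff_zero[OF index_word_in_index_words, of "ks @ [k]"]
        word_coeff_zero[OF index_word_in_index_words, of "map2 (+) (ks @ [k]) ls" for ls]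
      by (intro trans[OF _ sum.neutral[symmetric]]) (auto simp: weak_comps_def length_Suc_conv)
  next
    case False
    have "word_coeff (index_word (ks @ [k])) n $ m =
        (\<Sum>l\<le>m. (\<Sum>j<n. word_coeff (index_word ks) j) $ (m - l) *
           (inverse (fps_const (real n) - fps_X) ^ k) $ l)"
      unfolding word_coeff_index_snoc_fps[OF k] by (rule fps_mult_nth_rev)
    also have "\<dots> = (\<Sum>l\<le>m. \<Sum>ls\<in>weak_comps (length ks) (m - l).
        shift_binom (ks @ [k]) (ls @ [l]) * word_coeff (index_word (map2 (+) (ks @ [k]) (ls @ [l]))) n $ 0)"
    proof (rule sum.cong[OF refl])
      fix l assume "l \<in> {..m}"
      have "(\<Sum>j<n. word_coeff (index_word ks) j) $ (m - l) =
          (\<Sum>ls\<in>weak_comps (length ks) (m - l). shift_binom ks ls * harm_sum (map2 (+) ks ls) n)"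
        unfolding fps_sum_nth snoc.IH[OF ks] harm_sum_def sum_distrib_left by (rule sum.swap)
      also have "\<dots> * (inverse (fps_const (real n) - fps_X) ^ k) $ l =
          (\<Sum>ls\<in>weak_comps (length ks) (m - l). shift_binom (ks @ [k]) (ls @ [l]) *
             word_coeff (index_word (map2 (+) (ks @ [k]) (ls @ [l]))) n $ 0)"
        unfolding sum_distrib_right
      proof (rule sum.cong[OF refl])
        fix ls assume "ls \<in> weak_comps (length ks) (m - l)"
        then have ls: "length ls = length ks" by (simp add: weak_comps_def)
        have "word_coeff (index_word (map2 (+) (ks @ [k]) (ls @ [l]))) n $ 0 =
            harm_sum (map2 (+) ks ls) n / real n ^ (k + l)"
          unfolding map2_plus_snoc[OF ls] using k by (intro word_coeff_index_snoc) simp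
        then show "shift_binom ks ls * harm_sum (map2 (+) ks ls) n *
            (inverse (fps_const (real n) - fps_X) ^ k) $ l =
          shift_binom (ks @ [k]) (ls @ [l]) * word_coeff (index_word (map2 (+) (ks @ [k]) (ls @ [l]))) n $ 0"
          using inverse_shift_power_nth[of n k l] False k by (simp add: shift_binom_snoc[OF ls])
      qed
      finally show "(\<Sum>j<n. word_coeff (index_word ks) j) $ (m - l) *
          (inverse (fps_const (real n) - fps_X) ^ k) $ l =
          (\<Sum>ls\<in>weak_comps (length ks) (m - l). shift_binom (ks @ [k]) (ls @ [l]) *
             word_coeff (index_word (map2 (+) (ks @ [k]) (ls @ [l]))) n $ 0)" .
    qed
    finally show ?thesis by (simp add: sum_weak_comps_Suc)
  qed
qed

lemma shifted_li_eq_sum: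
  assumes "ks \<in> indices" "norm z < 1"
  shows "shifted_li m (index_word ks) z =
     (\<Sum>ls\<in>weak_comps (length ks) m. shift_binom ks ls * iter_int (index_word (map2 (+) ks ls)) z)"
proof -
  have "(\<lambda>n. \<Sum>ls\<in>weak_comps (length ks) m. shift_binom ks ls *
      (word_coeff (index_word (map2 (+) ks ls)) n $ 0 * z ^ n)) sums
     (\<Sum>ls\<in>weak_comps (length ks) m. shift_binom ks ls * iter_int (index_word (map2 (+) ks ls)) z)"
    unfolding iter_int_index_word[OF index_word_in_index_words] shifted_li_def
    by (intro sums_sum sums_mult summable_sums summable_word_coeff index_word_in_index_words assms)
  then have "(\<lambda>n. word_coeff (index_word ks) n $ m * z ^ n) sums
     (\<Sum>ls\<in>weak_comps (length ks) m. shift_binom ks ls * iter_int (index_word (map2 (+) ks ls)) z)"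
    by (simp add: word_coeff_shift[OF assms(1), of _ m] sum_distrib_right mult.assoc)
  then show ?thesis unfolding shifted_li_def by (rule sums_unique[symmetric])
qed

lemma has_reg_iter_int:
  "has_reg (at_left 1) (iter_int [Y]) (iter_int (index_word ks)) (zeta_shuffle ks)"
  unfolding zeta_shuffle_eq by (rule shuffle.has_reg_regv) simp

lemma zeta_reg_shift_eq:
  "zeta_reg_shift b m ks = (\<Sum>ls\<in>weak_comps (length ks) m. shift_binom ks ls * zeta_reg b (map2 (+) ks ls))"
  by (simp add: zeta_reg_shift_def weak_comps_def shift_binom_def mult.commute)

lemma has_reg_shifted_li:
  assumes "ks \<in> indices"
  shows "has_reg (at_left 1) (iter_int [Y]) (shifted_li m (index_word ks)) (zeta_reg_shift Shuffle m ks)"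
proof -
  have ev: "\<forall>\<^sub>F z in at_left 1. shifted_li m (index_word ks) z =
     (\<Sum>ls\<in>weak_comps (length ks) m. shift_binom ks ls * iter_int (index_word (map2 (+) ks ls)) z)"
    using eventually_at_left_one by eventually_elim (use assms in \<open>simp add: shifted_li_eq_sum\<close>)
  show ?thesis
    unfolding has_reg_cong[OF ev] zeta_reg_shift_eq zeta_reg.simps
    by (intro has_reg_sum has_reg_cmult has_reg_iter_int)
qed

text \<open>At 1 the logarithm is of order 1 - z, with constant 2 because 1/z is at most 2 on the
  interval (1/2, 1).\<close>

lemma has_reg_ln: "has_reg (at_left 1) (iter_int [Y]) ln 0"
proof -
  have "\<forall>\<^sub>F z::real in at_left 1. \<bar>ln z\<bar> \<le> 2 * (1 - z) powr 1"
    using eventually_at_left_real[of "1/2" 1, simplified]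
  proof eventually_elim
    case (elim z)
    have "ln (1 / z) \<le> 1 / z - 1" using elim by (intro ln_le_minus_one) auto
    also have "\<dots> = (1 - z) / z" using elim by (simp add: field_simps)
    also have "\<dots> \<le> (1 - z) / (1 / 2)" using elim by (intro divide_left_mono) auto
    finally show ?case using elim by (simp add: ln_div)
  qed
  then show ?thesis
    by (intro has_reg_negligible negligible_one_minus_powr[of 1 _ 2]) simp_all
qed

lemma has_reg_ln_power: "has_reg (at_left 1) (iter_int [Y]) (\<lambda>z. ln z ^ a) (if a = 0 then 1 else 0)"
proof (induction a)
  case (Suc a)
  show ?case using has_reg_mult[OF has_reg_ln Suc] by simp
qed (simp add: has_reg_const)

text \<open>The logarithms that regularize the end point 0 vanish at 1, so only the summand
  \<open>a = 0\<close> of \<open>log_li\<close> contributes. The sign is that of the shift by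
  -t.\<close>

lemma has_reg_iter_int_X:
  assumes "ks \<in> indices"
  shows "has_reg (at_left 1) (iter_int [Y]) (iter_int (replicate m X @ index_word ks))
    ((- 1) ^ m * zeta_reg_shift Shuffle m ks)"
proof -
  have "has_reg (at_left 1) (iter_int [Y])
    (\<lambda>z. \<Sum>a\<le>m. (1 / fact a * ln z ^ a) * ((- 1) ^ (m - a) * shifted_li (m - a) (index_word ks) z))
    (\<Sum>a\<le>m. (1 / fact a * (if a = 0 then 1 else 0)) * ((- 1) ^ (m - a) * zeta_reg_shift Shuffle (m - a) ks))"
    by (intro has_reg_sum has_reg_mult has_reg_cmult has_reg_ln_power has_reg_shifted_li assms has_reg_const)
  moreover have "(\<Sum>a\<le>m. (1 / fact a * (if a = 0 then 1 else 0)) *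
      ((- 1) ^ (m - a) * zeta_reg_shift Shuffle (m - a) ks)) =
    (\<Sum>a\<le>m. if a = 0 then (- 1) ^ m * zeta_reg_shift Shuffle m ks else 0)"
    by (intro sum.cong refl) auto
  moreover have "(\<lambda>z. \<Sum>a\<le>m. (1 / fact a * ln z ^ a) * ((- 1) ^ (m - a) * shifted_li (m - a) (index_word ks) z))
     = iter_int (replicate m X @ index_word ks)"
    by (simp add: iter_int_replicate log_li_def[abs_def])
  ultimately show ?thesis by simp
qed

text \<open>The \<open>t\<^sup>m\<close>-coefficient of the symmetric multiple zeta value before regularization: the integral
  of the word of the index followed by \<open>y x\<^sup>m\<close> along the path that runs from \<open>0\<close> to \<open>z\<close>, encircles \<open>1\<close>
  (one letter \<open>y\<close> is spent there) and returns to \<open>0\<close>.\<close>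

definition loop_int :: "nat \<Rightarrow> nat list \<Rightarrow> real \<Rightarrow> real" where
  "loop_int m ks z = (\<Sum>i\<le>length ks. (- 1) ^ sum_list (drop i ks) * iter_int (index_word (take i ks)) z *
     ((- 1) ^ m * iter_int (replicate m X @ index_word (rev (drop i ks))) z))"

lemma has_reg_loop_int:
  assumes "ks \<in> indices"
  shows "has_reg (at_left 1) (iter_int [Y]) (loop_int m ks) (zeta_S_hat Shuffle ks $ m)"
proof -
  have drop: "rev (drop i ks) \<in> indices" for i
    using assms set_drop_subset[of i ks] by (auto simp: indices_def)
  \<comment> \<open>The two factors \<open>(- 1) ^ m\<close>, one from \<open>loop_int\<close> and
    one from the leading letters \<open>X\<close>, cancel.\<close>
  have "has_reg (at_left 1) (iter_int [Y]) (loop_int m ks)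
    (\<Sum>i\<le>length ks. (- 1) ^ sum_list (drop i ks) * zeta_shuffle (take i ks) *
     ((- 1) ^ m * ((- 1) ^ m * zeta_reg_shift Shuffle m (rev (drop i ks)))))"
    unfolding loop_int_def
    by (intro has_reg_sum has_reg_mult has_reg_cmult has_reg_const has_reg_iter_int has_reg_iter_int_X drop)
  then show ?thesis by (simp add: zeta_S_hat_def fps_sum_nth flip: mult.assoc power_mult_distrib)
qed

section \<open>Agreement of the two regularizations\<close>

lemma zeta_reg_admissible: "admissible ks \<Longrightarrow> zeta_reg b ks = mzv ks"
  by (cases b) (auto simp: zeta_harmonic_eq zeta_shuffle_eq harmonic.regv_admissible
      shuffle.regv_admissible admissible_def)

text \<open>Subtracting \<open>\<zeta>(\<^bold>k)/n\<close> from the coefficients of \<open>(\<^bold>k, 1)\<close> leaves an absolutely convergent series,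
  whose sum is the value of both regularizations.\<close>

lemma zeta_reg_snoc_one:
  assumes "admissible ks"
  shows "zeta_harmonic (ks @ [1]) = zeta_shuffle (ks @ [1])"
proof (cases "ks = []")
  case True
  then show ?thesis
    using harmonic.regv_one shuffle.regv_one zeta_harmonic_eq[of "[1]"] zeta_shuffle_eq[of "[1]"] by simp
next
  case False
  have ks: "ks \<in> indices" using assms by (simp add: admissible_def)
  define a where "a n = word_coeff (index_word (ks @ [1])) n $ 0 - mzv ks * word_coeff [Y] n $ 0" for n
  obtain C where C: "\<And>N. N > 0 \<Longrightarrow> \<bar>harm_sum ks N - mzv ks\<bar> \<le> C * real N powr (- (1/4))"
    using admissible_rates[OF assms False] by metis
  have coeff_Y: "word_coeff [Y] n $ 0 = 1 / real n" if "n > 0" for n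
    using word_coeff_index_snoc[of 1 "[]" n] that by (simp add: index_word_def harm_sum_Nil)
  have "\<bar>a n\<bar> \<le> C * real n powr (- 1 - 2 * (1/8))" if "n > 0" for n
  proof -
    have "a n = (harm_sum ks n - mzv ks) / real n"
      unfolding a_def coeff_Y[OF that] by (subst word_coeff_index_snoc) (simp_all add: diff_divide_distrib)
    then have "\<bar>a n\<bar> = \<bar>harm_sum ks n - mzv ks\<bar> / real n" by simp
    also have "\<dots> \<le> C * real n powr (- (1/4)) / real n" by (intro divide_right_mono C that) simp
    also have "\<dots> = C * (real n powr (- (1/4)) * real n powr (- 1))"
      using that powr_minus[of "real n" 1] by (simp add: field_simps)
    also have "real n powr (- (1/4)) * real n powr (- 1) = real n powr (- 1 - 2 * (1/8))"
      by (subst powr_add[symmetric]) simp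
    finally show ?thesis .
  qed
  then obtain K where K: "summable a"
    "\<And>N. N > 0 \<Longrightarrow> \<bar>(\<Sum>n<N. a n) - suminf a\<bar> \<le> K * real N powr (- (1/8))"
    "\<And>z. 0 < z \<Longrightarrow> z < 1 \<Longrightarrow> summable (\<lambda>n. a n * z ^ n) \<and>
         \<bar>suminf (\<lambda>n. a n * z ^ n) - suminf a\<bar> \<le> K * (1 - z) powr (1/8)"
    by (rule convergence_rates[of a C "1/8"]) auto
  have "has_reg sequentially (harm_sum [1]) (\<lambda>N. (\<Sum>n<N. a n) + mzv ks * harm_sum [1] N) (suminf a + mzv ks * 0)"
    by (intro has_reg_add has_reg_cmult has_reg_self has_reg_negligible negligible_powr[of "1/8" _ K] K) simp_all
  moreover have "(\<Sum>n<N. a n) + mzv ks * harm_sum [1] N = harm_sum (ks @ [1]) N" for N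
    by (simp add: a_def harm_sum_def sum_subtractf sum_distrib_left)
  ultimately have 1: "harmonic.regv (ks @ [1]) = suminf a"
    by (intro harmonic.regv_eq) simp
  have ev: "\<forall>\<^sub>F z in at_left 1. iter_int (index_word (ks @ [1])) z =
     suminf (\<lambda>n. a n * z ^ n) + mzv ks * iter_int [Y] z"
    using eventually_at_left_one
  proof eventually_elim
    case (elim z)
    have "(\<lambda>n. a n * z ^ n + mzv ks * (word_coeff [Y] n $ 0 * z ^ n)) sums
        (suminf (\<lambda>n. a n * z ^ n) + mzv ks * suminf (\<lambda>n. word_coeff [Y] n $ 0 * z ^ n))"
      using elim K(3)[of z]
      by (intro sums_add sums_mult summable_sums summable_word_coeff) (auto simp: index_words_Cons)
    moreover have "a n * z ^ n + mzv ks * (word_coeff [Y] n $ 0 * z ^ n) =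
        word_coeff (index_word (ks @ [1])) n $ 0 * z ^ n" for n
      by (simp add: a_def algebra_simps)
    ultimately have "suminf (\<lambda>n. word_coeff (index_word (ks @ [1])) n $ 0 * z ^ n) =
        suminf (\<lambda>n. a n * z ^ n) + mzv ks * suminf (\<lambda>n. word_coeff [Y] n $ 0 * z ^ n)"
      by (simp add: sums_iff)
    moreover have "[Y] \<in> index_words" by (simp add: index_words_Cons)
    ultimately show ?case
      using iter_int_index_word[OF index_word_in_index_words, of "ks @ [1]" z] iter_int_index_word[of "[Y]" z]
      by (simp only: shifted_li_def)
  qed
  have "has_reg (at_left 1) (iter_int [Y]) (\<lambda>z. suminf (\<lambda>n. a n * z ^ n) + mzv ks * iter_int [Y] z)
      (suminf a + mzv ks * 0)"
    by (intro has_reg_add has_reg_cmult has_reg_self has_reg_negligible negligible_one_minus_powr[of "1/8" _ K]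
          eventually_mono[OF eventually_at_left_one]) (use K(3) in auto)
  with has_reg_cong[OF ev] have 2: "shuffle.regv (index_word (ks @ [1])) = suminf a"
    by (intro shuffle.regv_eq) simp
  show ?thesis using 1 2 ks zeta_harmonic_eq[of "ks @ [1]"] zeta_shuffle_eq[of "ks @ [1]"] by simp
qed

text \<open>At most one trailing one: the range covered by \<open>zeta_reg_snoc_one\<close>. It is
  preserved when nonnegative integers are added to the entries, so the shifted values are covered as
  well.\<close>

definition nearly_admissible :: "nat list \<Rightarrow> bool" where
  "nearly_admissible ks \<longleftrightarrow> ks \<in> indices \<and> (admissible ks \<or> admissible (butlast ks))"

lemma zeta_reg_nearly_admissible:
  assumes "nearly_admissible ks"
  shows "zeta_reg b ks = zeta_shuffle ks"
proof (cases "admissible ks")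
  case True
  then show ?thesis using zeta_reg_admissible[of ks b] zeta_reg_admissible[of ks Shuffle] by simp
next
  case False
  with assms obtain ls l where l: "ks = ls @ [l]" "admissible ls" "l \<ge> 1"
    by (cases ks rule: rev_cases) (auto simp: nearly_admissible_def admissible_def)
  with False have "l = 1" by (auto simp: admissible_def)
  with l zeta_reg_snoc_one[of ls] show ?thesis by (cases b) auto
qed

lemma admissible_map2_plus:
  assumes "admissible ks" "length ls = length ks"
  shows "admissible (map2 (+) ks ls)"
proof -
  have "map2 (+) ks ls \<in> indices"
    using assms by (auto simp: admissible_def indices_def in_set_conv_nth Ball_def)
  moreover have "last (map2 (+) ks ls) = last ks + last ls" if "ks \<noteq> []"
    using that assms by (cases ks rule: rev_cases; cases ls rule: rev_cases) auto
  ultimately show ?thesis using assms by (cases "ks = []") (auto simp: admissible_def)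
qed

lemma nearly_admissible_map2_plus:
  assumes "nearly_admissible ks" "length ls = length ks"
  shows "nearly_admissible (map2 (+) ks ls)"
proof -
  have "butlast (map2 (+) ks ls) = map2 (+) (butlast ks) (butlast ls)"
    using assms(2) by (cases ks rule: rev_cases; cases ls rule: rev_cases) auto
  moreover have "map2 (+) ks ls \<in> indices"
    using assms by (auto simp: nearly_admissible_def indices_def in_set_conv_nth Ball_def)
  ultimately show ?thesis
    using assms admissible_map2_plus unfolding nearly_admissible_def by auto
qed

lemma zeta_reg_shift_nearly_admissible:
  assumes "nearly_admissible ks"
  shows "zeta_reg_shift b m ks = zeta_reg_shift Shuffle m ks"
  unfolding zeta_reg_shift_eq
  using assms by (intro sum.cong refl)
    (auto simp: weak_comps_def zeta_reg_nearly_admissible nearly_admissible_map2_plus)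

lemma zeta_S_hat_nearly_admissible:
  assumes "\<And>i. nearly_admissible (take i ks)" "\<And>i. nearly_admissible (rev (drop i ks))"
  shows "zeta_S_hat b ks = zeta_S_hat Shuffle ks"
  unfolding zeta_S_hat_def
  by (simp add: zeta_reg_nearly_admissible[OF assms(1)] zeta_reg_shift_nearly_admissible[OF assms(2), where b = b])

section \<open>The ring spanned by multiple zeta values\<close>

lemma mzv_mult_in_span:
  assumes "admissible u" "admissible v"
  shows "mzv u * mzv v \<in> mzv_span"
proof -
  have "mzv u * mzv v = lin_ext harmonic.regv (harmonic_product u v)"
    using assms harmonic.regv_mult[of u v] by (simp add: admissible_def harmonic.regv_admissible)
  also have "\<dots> \<in> mzv_span"
    using keys_harmonic_product_admissible[OF assms]
    by (intro mzv_span_lin_ext) (simp add: harmonic.regv_admissible mzv_span_base)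
  finally show ?thesis .
qed

lemma mzv_span_mult:
  assumes "x \<in> mzv_span" "y \<in> mzv_span"
  shows "x * y \<in> mzv_span"
proof -
  have *: "z * mzv v \<in> mzv_span" if "z \<in> mzv_span" "admissible v" for z v
    using that(1) unfolding mzv_span_def
  proof (induction rule: rat_real.span_induct_alt)
    case base
    then show ?case using mzv_span_zero by (simp add: mzv_span_def)
  next
    case (step c x y)
    then show ?case
      using mzv_mult_in_span that(2) mzv_span_add mzv_span_scale
      by (auto simp: mzv_span_def distrib_right mult.assoc)
  qed
  show ?thesis
    using assms(2) unfolding mzv_span_def
  proof (induction rule: rat_real.span_induct_alt)
    case base
    then show ?case using mzv_span_zero by (simp add: mzv_span_def)
  next
    case (step c z y)
    then show ?case
      using * assms(1) mzv_span_add mzv_span_scale[of "x * z" c]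
      by (auto simp: mzv_span_def distrib_left mult.left_commute)
  qed
qed

lemma mzv_span_of_nat_mult: "x \<in> mzv_span \<Longrightarrow> real n * x \<in> mzv_span"
  using mzv_span_scale[of x "of_nat n"] by simp

lemma mzv_span_power_minus_one_mult: "x \<in> mzv_span \<Longrightarrow> (- 1) ^ n * x \<in> mzv_span"
  using mzv_span_scale[of x "(- 1) ^ n"] by (simp add: of_rat_power of_rat_minus)

lemma zeta_reg_in_span: "ks \<in> indices \<Longrightarrow> zeta_reg b ks \<in> mzv_span"
  by (cases b) (simp_all add: zeta_harmonic_eq zeta_shuffle_eq harmonic.regv_in_span shuffle.regv_in_span)

lemma zeta_reg_shift_in_span:
  assumes "ks \<in> indices"
  shows "zeta_reg_shift b m ks \<in> mzv_span"
  unfolding zeta_reg_shift_eq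
proof (rule mzv_span_sum)
  fix ls assume "ls \<in> weak_comps (length ks) m"
  then have "map2 (+) ks ls \<in> indices"
    using assms by (auto simp: indices_def weak_comps_def in_set_conv_nth Ball_def)
  moreover have "shift_binom ks ls = real (\<Prod>i<length ks. (ks ! i + ls ! i - 1) choose (ls ! i))"
    by (simp add: shift_binom_def)
  ultimately show "shift_binom ks ls * zeta_reg b (map2 (+) ks ls) \<in> mzv_span"
    by (simp only: mzv_span_of_nat_mult zeta_reg_in_span)
qed

lemma zeta_S_hat_in_span:
  assumes "ks \<in> indices"
  shows "zeta_S_hat b ks $ m \<in> mzv_span"
proof -
  have "take i ks \<in> indices" "rev (drop i ks) \<in> indices" for i
    using assms set_drop_subset[of i ks] set_take_subset[of i ks] by (auto simp: indices_def)
  then show ?thesis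
    unfolding zeta_S_hat_def fps_sum_nth
    by (auto simp: mult.assoc intro!: mzv_span_sum mzv_span_mult mzv_span_power_minus_one_mult zeta_reg_in_span zeta_reg_shift_in_span)
qed


section \<open>Differential systems for generating series\<close>

text \<open>Differentiation in \<open>z\<close> coefficient by coefficient. The series variable s
  only counts letters, so no question of convergence in s arises.\<close>

definition fps_deriv_at :: "(real \<Rightarrow> real fps) \<Rightarrow> real fps \<Rightarrow> real \<Rightarrow> bool" where
  "fps_deriv_at F D z \<longleftrightarrow> (\<forall>n. ((\<lambda>z. F z $ n) has_real_derivative D $ n) (at z))"

lemma fps_deriv_at_add:
  "fps_deriv_at F A z \<Longrightarrow> fps_deriv_at G B z \<Longrightarrow> fps_deriv_at (\<lambda>z. F z + G z) (A + B) z"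
  by (auto simp: fps_deriv_at_def intro!: derivative_eq_intros)

lemma fps_deriv_at_diff:
  "fps_deriv_at F A z \<Longrightarrow> fps_deriv_at G B z \<Longrightarrow> fps_deriv_at (\<lambda>z. F z - G z) (A - B) z"
  by (auto simp: fps_deriv_at_def intro!: derivative_eq_intros)

lemma fps_deriv_at_const: "fps_deriv_at (\<lambda>z. C) 0 z"
  by (simp add: fps_deriv_at_def)

lemma fps_deriv_at_mult:
  assumes "fps_deriv_at F A z" "fps_deriv_at G B z"
  shows "fps_deriv_at (\<lambda>z. F z * G z) (A * G z + F z * B) z"
  unfolding fps_deriv_at_def
proof
  fix n
  have "((\<lambda>z. \<Sum>i=0..n. F z $ i * G z $ (n - i)) has_real_derivative
      (\<Sum>i=0..n. F z $ i * B $ (n - i) + A $ i * G z $ (n - i))) (at z)"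
    using assms unfolding fps_deriv_at_def by (intro DERIV_sum DERIV_mult') auto
  then show "((\<lambda>z. (F z * G z) $ n) has_real_derivative (A * G z + F z * B) $ n) (at z)"
    by (simp add: fps_mult_nth sum.distrib add.commute)
qed

lemma fps_deriv_at_cmult: "fps_deriv_at F A z \<Longrightarrow> fps_deriv_at (\<lambda>z. C * F z) (C * A) z"
  using fps_deriv_at_mult[OF fps_deriv_at_const[of C]] by simp

definition fps_flip :: "real fps \<Rightarrow> real fps" where
  "fps_flip f = Abs_fps (\<lambda>n. (- 1) ^ n * f $ n)"

lemma fps_flip_nth [simp]: "fps_flip f $ n = (- 1) ^ n * f $ n"
  by (simp add: fps_flip_def)

lemma fps_flip_diff: "fps_flip (f - g) = fps_flip f - fps_flip g"
  by (rule fps_ext) (simp add: algebra_simps)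

lemma fps_flip_one [simp]: "fps_flip 1 = 1"
  by (rule fps_ext) simp

lemma fps_flip_const [simp]: "fps_flip (fps_const c) = fps_const c"
  by (rule fps_ext) simp

lemma fps_flip_X [simp]: "fps_flip fps_X = - fps_X"
  by (rule fps_ext) (simp add: fps_X_def)

lemma fps_flip_mult: "fps_flip (f * g) = fps_flip f * fps_flip g"
proof (rule fps_ext)
  fix n
  have "(- 1) ^ n * (f $ i * g $ (n - i)) = (- 1) ^ i * f $ i * ((- 1) ^ (n - i) * g $ (n - i))"
    if "i \<in> {0..n}" for i
    using that power_add[of "- 1 :: real" i "n - i"] by simp
  then show "fps_flip (f * g) $ n = (fps_flip f * fps_flip g) $ n"
    unfolding fps_flip_nth fps_mult_nth sum_distrib_left by (intro sum.cong) auto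
qed

lemma fps_deriv_at_flip: "fps_deriv_at F A z \<Longrightarrow> fps_deriv_at (\<lambda>z. fps_flip (F z)) (fps_flip A) z"
  unfolding fps_deriv_at_def fps_flip_nth by (auto intro: DERIV_cmult)

section \<open>Asymptotics at 0 modulo terms smaller than every power of the logarithm\<close>

definition vanishing :: "(real \<Rightarrow> real fps) \<Rightarrow> bool" where
  "vanishing D \<longleftrightarrow> (\<forall>n k. ((\<lambda>z. D z $ n * ln z ^ k) \<longlongrightarrow> 0) (at_right 0))"

lemma vanishing_zero [simp]: "vanishing (\<lambda>z. 0)"
  by (simp add: vanishing_def)

lemma vanishing_add: "vanishing D \<Longrightarrow> vanishing E \<Longrightarrow> vanishing (\<lambda>z. D z + E z)"
  unfolding vanishing_def by (auto simp: distrib_right intro: tendsto_add_zero)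

lemma vanishing_tendsto: "vanishing D \<Longrightarrow> ((\<lambda>z. D z $ n) \<longlongrightarrow> 0) (at_right 0)"
  unfolding vanishing_def by (drule spec[of _ n], drule spec[of _ 0]) simp

lemma vanishing_mult:
  assumes "vanishing D" "\<And>n. ((\<lambda>z. E z $ n) \<longlongrightarrow> c n) (at_right 0)"
  shows "vanishing (\<lambda>z. D z * E z)"
  unfolding vanishing_def
proof (intro allI)
  fix n k
  have "((\<lambda>z. \<Sum>i=0..n. (D z $ i * ln z ^ k) * E z $ (n - i)) \<longlongrightarrow> (\<Sum>i=0..n. 0 * c (n - i))) (at_right 0)"
    using assms unfolding vanishing_def by (intro tendsto_sum tendsto_mult) auto
  then show "((\<lambda>z. (D z * E z) $ n * ln z ^ k) \<longlongrightarrow> 0) (at_right 0)"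
    by (simp add: fps_mult_nth sum_distrib_left sum_distrib_right mult_ac)
qed

lemma vanishing_mult_const: "vanishing D \<Longrightarrow> vanishing (\<lambda>z. D z * C)"
  by (rule vanishing_mult[where c = "\<lambda>n. C $ n"]) simp_all

lemma vanishing_mult_ln:
  assumes "vanishing D"
  shows "vanishing (\<lambda>z. D z * fps_const (ln z))"
  unfolding vanishing_def
proof (intro allI)
  fix n k
  have "((\<lambda>z. D z $ n * ln z ^ Suc k) \<longlongrightarrow> 0) (at_right 0)"
    using assms unfolding vanishing_def by blast
  then show "((\<lambda>z. (D z * fps_const (ln z)) $ n * ln z ^ k) \<longlongrightarrow> 0) (at_right 0)"
    by (simp add: mult_ac)
qed

lemma vanishing_flip: "vanishing D \<Longrightarrow> vanishing (\<lambda>z. fps_flip (D z))"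
  unfolding vanishing_def fps_flip_nth mult.assoc by (auto intro: tendsto_mult_right_zero)

definition multiplier :: "(real \<Rightarrow> real fps) \<Rightarrow> bool" where
  "multiplier F \<longleftrightarrow> (\<forall>D. vanishing D \<longrightarrow> vanishing (\<lambda>z. D z * F z))"

lemma multiplier_const: "multiplier (\<lambda>z. C)"
  by (simp add: multiplier_def vanishing_mult_const)

lemma multiplier_ln: "multiplier (\<lambda>z. fps_const (ln z))"
  by (simp add: multiplier_def vanishing_mult_ln)

lemma multiplier_mult: "multiplier F \<Longrightarrow> multiplier G \<Longrightarrow> multiplier (\<lambda>z. F z * G z)"
  unfolding multiplier_def by (simp flip: mult.assoc)

lemma multiplier_add: "multiplier F \<Longrightarrow> multiplier G \<Longrightarrow> multiplier (\<lambda>z. F z + G z)"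
  unfolding multiplier_def by (simp add: distrib_left vanishing_add)

lemma multiplier_uminus: "multiplier F \<Longrightarrow> multiplier (\<lambda>z. - F z)"
  using multiplier_mult[OF multiplier_const[of "- 1"], of F] by simp

text \<open>Some leading terms diverge like powers of log z, so errors must be able to absorb them
  in products. Requiring \<open>G\<close> to be a \<open>multiplier\<close> is what makes the
  relation compatible with multiplication.\<close>

definition log_equiv :: "(real \<Rightarrow> real fps) \<Rightarrow> (real \<Rightarrow> real fps) \<Rightarrow> bool" where
  "log_equiv F G \<longleftrightarrow> vanishing (\<lambda>z. F z - G z) \<and> multiplier G"

lemma log_equiv_const: "log_equiv (\<lambda>z. C) (\<lambda>z. C)"
  by (simp add: log_equiv_def multiplier_const)

lemma log_equiv_add: "log_equiv F F0 \<Longrightarrow> log_equiv G G0 \<Longrightarrow> log_equiv (\<lambda>z. F z + G z) (\<lambda>z. F0 z + G0 z)"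
  unfolding log_equiv_def using vanishing_add[of "\<lambda>z. F z - F0 z" "\<lambda>z. G z - G0 z"]
  by (simp add: algebra_simps multiplier_add)

lemma log_equiv_mult:
  assumes "log_equiv F F0" "log_equiv G G0"
  shows "log_equiv (\<lambda>z. F z * G z) (\<lambda>z. F0 z * G0 z)"
proof -
  have D: "vanishing (\<lambda>z. F z - F0 z)" "vanishing (\<lambda>z. G z - G0 z)"
    using assms by (simp_all add: log_equiv_def)
  have "vanishing (\<lambda>z. (F z - F0 z) * G0 z)" "vanishing (\<lambda>z. (G z - G0 z) * F0 z)"
    using assms by (simp_all add: log_equiv_def multiplier_def)
  then have "vanishing (\<lambda>z. (F z - F0 z) * (G z - G0 z) + ((F z - F0 z) * G0 z + (G z - G0 z) * F0 z))"
    by (intro vanishing_add vanishing_mult[OF D(1) vanishing_tendsto[OF D(2)]])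
  then show ?thesis
    using assms unfolding log_equiv_def by (simp add: algebra_simps multiplier_mult)
qed

lemma log_equiv_diff: "log_equiv F F0 \<Longrightarrow> log_equiv G G0 \<Longrightarrow> log_equiv (\<lambda>z. F z - G z) (\<lambda>z. F0 z - G0 z)"
  using log_equiv_add[of F F0 "\<lambda>z. (- 1) * G z" "\<lambda>z. (- 1) * G0 z"] log_equiv_mult[OF log_equiv_const[of "- 1"], of G G0]
  by simp

lemma vanishing_diff_if_log_equiv: "log_equiv F H \<Longrightarrow> log_equiv G H \<Longrightarrow> vanishing (\<lambda>z. F z - G z)"
  using log_equiv_diff[of F H G H] by (simp add: log_equiv_def)

subsection \<open>The two-dimensional system of the alternating words\<close>

definition alt_system :: "(real \<Rightarrow> real fps) \<Rightarrow> (real \<Rightarrow> real fps) \<Rightarrow> bool" where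
  "alt_system F G \<longleftrightarrow> (\<forall>z. 0 < z \<longrightarrow> z < 1 \<longrightarrow>
     fps_deriv_at F (fps_const (letter_form X z) * (fps_X * G z)) z \<and>
     fps_deriv_at G (fps_const (letter_form Y z) * F z) z)"

definition cyc_system :: "(real \<Rightarrow> real fps) \<Rightarrow> (real \<Rightarrow> real fps) \<Rightarrow> (real \<Rightarrow> real fps) \<Rightarrow>
    (real \<Rightarrow> real fps) \<Rightarrow> bool" where
  "cyc_system U1 U2 U3 U4 \<longleftrightarrow> (\<forall>z. 0 < z \<longrightarrow> z < 1 \<longrightarrow>
     fps_deriv_at U1 (fps_const (letter_form Y z) * U4 z) z \<and>
     fps_deriv_at U2 (fps_const (letter_form X z) * (- 2 * fps_X * U1 z)) z \<and>
     fps_deriv_at U3 (fps_const (letter_form X z) * (fps_X * U2 z)) z \<and>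
     fps_deriv_at U4 (fps_const (letter_form Y z) * (2 * U3 z)) z)"

text \<open>The tensor product of the two-dimensional system with its image under \<open>s \<mapsto> - s\<close> is the
  four-dimensional system whose words are the factors of \<open>\<dots>yyxxyyxx\<dots>\<close>.\<close>

lemma cyc_system_tensor:
  assumes "alt_system F G" "alt_system H K"
  shows "cyc_system (\<lambda>z. G z * fps_flip (K z)) (\<lambda>z. G z * fps_flip (H z) - F z * fps_flip (K z))
    (\<lambda>z. F z * fps_flip (H z)) (\<lambda>z. F z * fps_flip (K z) + G z * fps_flip (H z))"
  unfolding cyc_system_def
proof (intro allI impI)
  fix z :: real assume z: "0 < z" "z < 1"
  define a b where "a = fps_const (letter_form X z)" and "b = fps_const (letter_form Y z)"
  have F: "fps_deriv_at F (a * (fps_X * G z)) z" and G: "fps_deriv_at G (b * F z) z"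
    using assms(1) z by (auto simp: alt_system_def a_def b_def)
  have "fps_deriv_at (\<lambda>z. fps_flip (H z)) (fps_flip (a * (fps_X * K z))) z"
    "fps_deriv_at (\<lambda>z. fps_flip (K z)) (fps_flip (b * H z)) z"
    using assms(2) z by (auto simp: alt_system_def a_def b_def intro: fps_deriv_at_flip)
  then have H: "fps_deriv_at (\<lambda>z. fps_flip (H z)) (- (a * (fps_X * fps_flip (K z)))) z"
    and K: "fps_deriv_at (\<lambda>z. fps_flip (K z)) (b * fps_flip (H z)) z"
    by (simp_all add: fps_flip_mult a_def b_def)
  show "fps_deriv_at (\<lambda>z. G z * fps_flip (K z))
        (fps_const (letter_form Y z) * (F z * fps_flip (K z) + G z * fps_flip (H z))) z \<and>
      fps_deriv_at (\<lambda>z. G z * fps_flip (H z) - F z * fps_flip (K z))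
        (fps_const (letter_form X z) * (- 2 * fps_X * (G z * fps_flip (K z)))) z \<and>
      fps_deriv_at (\<lambda>z. F z * fps_flip (H z))
        (fps_const (letter_form X z) * (fps_X * (G z * fps_flip (H z) - F z * fps_flip (K z)))) z \<and>
      fps_deriv_at (\<lambda>z. F z * fps_flip (K z) + G z * fps_flip (H z))
        (fps_const (letter_form Y z) * (2 * (F z * fps_flip (H z)))) z"
    unfolding a_def[symmetric] b_def[symmetric]
    using fps_deriv_at_mult[OF G K]
      fps_deriv_at_diff[OF fps_deriv_at_mult[OF G H] fps_deriv_at_mult[OF F K]]
      fps_deriv_at_mult[OF F H]
      fps_deriv_at_add[OF fps_deriv_at_mult[OF F K] fps_deriv_at_mult[OF G H]]
    by (simp add: algebra_simps)
qed

lemma cyc_system_add_mult: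
  assumes "cyc_system U1 U2 U3 U4" "cyc_system V1 V2 V3 V4"
  shows "cyc_system (\<lambda>z. U1 z + c * V1 z) (\<lambda>z. U2 z + c * V2 z) (\<lambda>z. U3 z + c * V3 z) (\<lambda>z. U4 z + c * V4 z)"
proof -
  have *: "fps_deriv_at (\<lambda>z. U z + c * V z) (k * (l * (A + c * B))) z"
    if "fps_deriv_at U (k * (l * A)) z" "fps_deriv_at V (k * (l * B)) z" for U V A B k l z
    using fps_deriv_at_add[OF that(1) fps_deriv_at_cmult[OF that(2), of c]] by (simp add: algebra_simps)
  show ?thesis
    unfolding cyc_system_def
  proof (intro allI impI conjI)
    fix z :: real assume z: "0 < z" "z < 1"
    note UV = assms(1)[unfolded cyc_system_def, rule_format, OF z] assms(2)[unfolded cyc_system_def, rule_format, OF z]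
    show "fps_deriv_at (\<lambda>z. U1 z + c * V1 z) (fps_const (letter_form Y z) * (U4 z + c * V4 z)) z"
      by (rule *[where l = 1, unfolded mult_1]) (use UV in blast)+
  qed (rule *; use assms in \<open>simp add: cyc_system_def\<close>)+
qed

text \<open>The system is triangular degree by degree: both equations for the letter
  \<open>X\<close> carry a factor \<open>fps_X\<close>, so in degree \<open>n\<close> their
  right-hand sides vanish by induction. Hence \<open>U2\<close> and \<open>U3\<close> are constant
  and vanish, then \<open>U4\<close> does, and finally \<open>U1\<close>.\<close>

lemma cyc_system_vanishing_imp_zero:
  assumes sys: "cyc_system U1 U2 U3 U4"
    and "vanishing U1" "vanishing U2" "vanishing U3" "vanishing U4"
    and z: "0 < z" "z < 1"
  shows "U3 z = 0" "U4 z = 0"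
proof -
  have "\<forall>z. 0 < z \<longrightarrow> z < 1 \<longrightarrow> U1 z $ n = 0 \<and> U2 z $ n = 0 \<and> U3 z $ n = 0 \<and> U4 z $ n = 0" for n
  proof (induction n rule: less_induct)
    case (less n)
    have deriv: "((\<lambda>z. U1 z $ n) has_real_derivative letter_form Y z * U4 z $ n) (at z)"
      "((\<lambda>z. U4 z $ n) has_real_derivative letter_form Y z * (2 * U3 z) $ n) (at z)"
      "((\<lambda>z. U3 z $ n) has_real_derivative 0) (at z)"
      "((\<lambda>z. U2 z $ n) has_real_derivative 0) (at z)" if z: "0 < z" "z < 1" for z
    proof -
      have "(fps_X * U2 z) $ n = 0" "(- 2 * fps_X * U1 z) $ n = 0"
        using less.IH[of "n - 1"] z by (simp_all add: mult.assoc numeral_fps_const)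
      moreover have "fps_deriv_at U1 (fps_const (letter_form Y z) * U4 z) z"
        "fps_deriv_at U2 (fps_const (letter_form X z) * (- 2 * fps_X * U1 z)) z"
        "fps_deriv_at U3 (fps_const (letter_form X z) * (fps_X * U2 z)) z"
        "fps_deriv_at U4 (fps_const (letter_form Y z) * (2 * U3 z)) z"
        using sys z unfolding cyc_system_def by blast+
      note this[unfolded fps_deriv_at_def, rule_format, of n]
      ultimately show
        "((\<lambda>z. U1 z $ n) has_real_derivative letter_form Y z * U4 z $ n) (at z)"
        "((\<lambda>z. U4 z $ n) has_real_derivative letter_form Y z * (2 * U3 z) $ n) (at z)"
        "((\<lambda>z. U3 z $ n) has_real_derivative 0) (at z)"
        "((\<lambda>z. U2 z $ n) has_real_derivative 0) (at z)"
        by (simp_all only: fps_mult_left_const_nth mult_zero_right)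
    qed
    have 2: "U2 z $ n = 0" and 3: "U3 z $ n = 0" if "0 < z" "z < 1" for z
      using that assms by (auto intro!: zero_deriv_imp_zero[of "\<lambda>z. U2 z $ n"]
          zero_deriv_imp_zero[of "\<lambda>z. U3 z $ n"] deriv vanishing_tendsto)
    have 4: "U4 z $ n = 0" if "0 < z" "z < 1" for z
    proof (rule zero_deriv_imp_zero[OF _ _ that, of "\<lambda>z. U4 z $ n"])
      show "((\<lambda>z. U4 z $ n) has_real_derivative 0) (at z)" if "0 < z" "z < 1" for z
        using deriv(2)[OF that] 3[OF that] by (simp add: numeral_fps_const)
    qed (use assms vanishing_tendsto in blast)
    have 1: "U1 z $ n = 0" if "0 < z" "z < 1" for z
    proof (rule zero_deriv_imp_zero[OF _ _ that, of "\<lambda>z. U1 z $ n"])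
      show "((\<lambda>z. U1 z $ n) has_real_derivative 0) (at z)" if "0 < z" "z < 1" for z
        using deriv(1)[OF that] 4[OF that] by simp
    qed (use assms vanishing_tendsto in blast)
    show ?case using 1 2 3 4 by blast
  qed
  with z show "U3 z = 0" "U4 z = 0" by (auto intro: fps_ext)
qed

lemma cyc_system_unique:
  assumes "cyc_system U1 U2 U3 U4" "cyc_system V1 V2 V3 V4"
    and "log_equiv U1 A1" "log_equiv U2 A2" "log_equiv U3 A3" "log_equiv U4 A4"
    and "log_equiv V1 A1" "log_equiv V2 A2" "log_equiv V3 A3" "log_equiv V4 A4"
    and z: "0 < z" "z < 1"
  shows "U3 z = V3 z" "U4 z = V4 z"
proof -
  have sys: "cyc_system (\<lambda>z. U1 z - V1 z) (\<lambda>z. U2 z - V2 z) (\<lambda>z. U3 z - V3 z) (\<lambda>z. U4 z - V4 z)"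
    using cyc_system_add_mult[OF assms(1,2), of "- 1"] by simp
  have "vanishing (\<lambda>z. U1 z - V1 z)" "vanishing (\<lambda>z. U2 z - V2 z)"
    "vanishing (\<lambda>z. U3 z - V3 z)" "vanishing (\<lambda>z. U4 z - V4 z)"
    using assms vanishing_diff_if_log_equiv by blast+
  from cyc_system_vanishing_imp_zero[OF sys this z] show "U3 z = V3 z" "U4 z = V4 z" by simp_all
qed

subsection \<open>Generating series of words\<close>

definition word_pow :: "letter list \<Rightarrow> nat \<Rightarrow> letter list" where
  "word_pow w n = concat (replicate n w)"

lemma word_pow_0 [simp]: "word_pow w 0 = []"
  by (simp add: word_pow_def)

lemma word_pow_Suc: "word_pow w (Suc n) = word_pow w n @ w"
  by (simp add: word_pow_def flip: replicate_append_same)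

lemma word_pow_Suc': "word_pow w (Suc n) = w @ word_pow w n"
  by (simp add: word_pow_def)

definition alt_p :: "real \<Rightarrow> real fps" where
  "alt_p z = Abs_fps (\<lambda>j. iter_int (word_pow [Y, X] j) z)"

definition alt_py :: "real \<Rightarrow> real fps" where
  "alt_py z = Abs_fps (\<lambda>j. iter_int (word_pow [Y, X] j @ [Y]) z)"

text \<open>Each letter \<open>X\<close> of the alternating system carries a factor s. In
  \<open>alt_p\<close> it is absorbed by counting pairs, while the additional leading
  \<open>X\<close> here raises the degree by one. With \<open>alt_py\<close> and
  \<open>alt_qy\<close> this gives the two columns of a fundamental matrix.\<close>

definition alt_q :: "real \<Rightarrow> real fps" where
  "alt_q z = fps_X * Abs_fps (\<lambda>j. iter_int (X # word_pow [Y, X] j) z)"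

definition alt_qy :: "real \<Rightarrow> real fps" where
  "alt_qy z = Abs_fps (\<lambda>j. iter_int (word_pow [X, Y] j) z)"

lemma word_pow_XY_Suc: "word_pow [X, Y] (Suc j) = X # word_pow [Y, X] j @ [Y]"
  by (induction j) (simp_all add: word_pow_Suc)

lemma word_pow_XY_append_X: "word_pow [X, Y] j @ [X] = X # word_pow [Y, X] j"
  by (induction j) (simp_all add: word_pow_Suc')

lemma alt_system_p: "alt_system alt_p alt_py"
  unfolding alt_system_def fps_deriv_at_def
proof (intro allI impI conjI)
  fix z :: real and n assume z: "0 < z" "z < 1"
  show "((\<lambda>z. alt_p z $ n) has_real_derivative (fps_const (letter_form X z) * (fps_X * alt_py z)) $ n) (at z)"
    using iter_int_deriv[OF z, of "word_pow [Y, X] (n - 1) @ [Y]" X]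
    by (cases n) (simp_all add: alt_p_def alt_py_def word_pow_Suc)
  show "((\<lambda>z. alt_py z $ n) has_real_derivative (fps_const (letter_form Y z) * alt_p z) $ n) (at z)"
    using iter_int_deriv[OF z, of "word_pow [Y, X] n" Y] by (simp add: alt_p_def alt_py_def)
qed

lemma alt_system_q: "alt_system alt_q alt_qy"
  unfolding alt_system_def fps_deriv_at_def
proof (intro allI impI conjI)
  fix z :: real and n assume z: "0 < z" "z < 1"
  show "((\<lambda>z. alt_q z $ n) has_real_derivative (fps_const (letter_form X z) * (fps_X * alt_qy z)) $ n) (at z)"
    using iter_int_deriv[OF z, of "word_pow [X, Y] (n - 1)" X]
    by (cases n) (simp_all add: alt_q_def alt_qy_def word_pow_XY_append_X)
  show "((\<lambda>z. alt_qy z $ n) has_real_derivative (fps_const (letter_form Y z) * alt_q z) $ n) (at z)"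
    using iter_int_deriv[OF z, of "X # word_pow [Y, X] (n - 1)" Y]
    by (cases n) (simp_all add: alt_q_def alt_qy_def word_pow_XY_Suc)
qed

lemma iter_int_X: "iter_int [X] z = ln z"
  using iter_int_replicate_X[of 1] by simp

lemma log_equiv_iter_int:
  assumes "\<And>n. (\<forall>z. (F z - G z) $ n = 0) \<or> (\<exists>w c. Y \<in> set w \<and> (\<forall>z. (F z - G z) $ n = c * iter_int w z))"
    and "multiplier G"
  shows "log_equiv F G"
  unfolding log_equiv_def vanishing_def
proof (intro conjI allI assms(2))
  fix n k
  show "((\<lambda>z. (F z - G z) $ n * ln z ^ k) \<longlongrightarrow> 0) (at_right 0)"
    using assms(1)[of n]
    by (auto simp: mult.assoc simp del: fps_sub_nth intro!: tendsto_mult_right_zero iter_int_times_ln_power_tendsto)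
qed

lemma log_equiv_alt_p: "log_equiv alt_p (\<lambda>z. 1)"
proof (rule log_equiv_iter_int[OF _ multiplier_const])
  show "(\<forall>z. (alt_p z - 1) $ n = 0) \<or> (\<exists>w c. Y \<in> set w \<and> (\<forall>z. (alt_p z - 1) $ n = c * iter_int w z))" for n
    by (cases n) (auto simp: alt_p_def word_pow_Suc intro!: exI[of _ "word_pow [Y, X] n"] exI[of _ 1])
qed

lemma log_equiv_alt_py: "log_equiv alt_py (\<lambda>z. 0)"
proof (rule log_equiv_iter_int[OF _ multiplier_const])
  show "(\<forall>z. (alt_py z - 0) $ n = 0) \<or> (\<exists>w c. Y \<in> set w \<and> (\<forall>z. (alt_py z - 0) $ n = c * iter_int w z))" for n
    by (intro disjI2 exI[of _ "word_pow [Y, X] n @ [Y]"] exI[of _ 1]) (simp add: alt_py_def)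
qed

lemma log_equiv_alt_q: "log_equiv alt_q (\<lambda>z. fps_X * fps_const (ln z))"
proof (rule log_equiv_iter_int)
  fix n
  consider "n = 0" | "n = 1" | k where "n = Suc (Suc k)" by (metis One_nat_def not0_implies_Suc)
  then show "(\<forall>z. (alt_q z - fps_X * fps_const (ln z)) $ n = 0) \<or>
      (\<exists>w c. Y \<in> set w \<and> (\<forall>z. (alt_q z - fps_X * fps_const (ln z)) $ n = c * iter_int w z))"
  proof cases
    case (3 k)
    then show ?thesis
      by (intro disjI2 exI[of _ "X # word_pow [Y, X] (Suc k)"] exI[of _ 1]) (simp add: alt_q_def word_pow_Suc)
  qed (simp_all add: alt_q_def iter_int_X)
qed (intro multiplier_mult multiplier_const multiplier_ln)

lemma log_equiv_alt_qy: "log_equiv alt_qy (\<lambda>z. 1)"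
proof (rule log_equiv_iter_int[OF _ multiplier_const])
  show "(\<forall>z. (alt_qy z - 1) $ n = 0) \<or> (\<exists>w c. Y \<in> set w \<and> (\<forall>z. (alt_qy z - 1) $ n = c * iter_int w z))" for n
    by (cases n) (auto simp: alt_qy_def word_pow_Suc intro!: exI[of _ "word_pow [X, Y] n"] exI[of _ 1])
qed

lemma log_equiv_flip:
  assumes "log_equiv F F0" "multiplier (\<lambda>z. fps_flip (F0 z))"
  shows "log_equiv (\<lambda>z. fps_flip (F z)) (\<lambda>z. fps_flip (F0 z))"
  using assms vanishing_flip[of "\<lambda>z. F z - F0 z"] by (simp add: log_equiv_def fps_flip_diff)

lemma fps_flip_zero [simp]: "fps_flip 0 = 0"
  by (rule fps_ext) simp

lemma log_equiv_flip_alt: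
  "log_equiv (\<lambda>z. fps_flip (alt_p z)) (\<lambda>z. 1)"
  "log_equiv (\<lambda>z. fps_flip (alt_py z)) (\<lambda>z. 0)"
  "log_equiv (\<lambda>z. fps_flip (alt_q z)) (\<lambda>z. - fps_X * fps_const (ln z))"
  "log_equiv (\<lambda>z. fps_flip (alt_qy z)) (\<lambda>z. 1)"
  using log_equiv_flip[OF log_equiv_alt_p] log_equiv_flip[OF log_equiv_alt_py] log_equiv_flip[OF log_equiv_alt_q]
    log_equiv_flip[OF log_equiv_alt_qy]
  by (simp_all add: fps_flip_mult multiplier_const multiplier_mult multiplier_ln multiplier_uminus)

text \<open>The coefficient matrix of the alternating system has zero diagonal, so the determinant
  of the fundamental matrix is constant in \<open>z\<close>; its limit at 0 is 1.\<close>

lemma alt_wronskian: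
  assumes "0 < z" "z < 1"
  shows "alt_p z * alt_qy z - alt_q z * alt_py z = 1"
proof (rule fps_ext)
  fix n
  have "((\<lambda>z. (alt_p z * alt_qy z - alt_q z * alt_py z) $ n - 1 $ n) has_real_derivative 0) (at z)"
    if z: "0 < z" "z < 1" for z
  proof -
    have "fps_deriv_at (\<lambda>z. alt_p z * alt_qy z - alt_q z * alt_py z) 0 z"
    proof -
      have D: "fps_deriv_at alt_p (fps_const (letter_form X z) * (fps_X * alt_py z)) z"
        "fps_deriv_at alt_py (fps_const (letter_form Y z) * alt_p z) z"
        "fps_deriv_at alt_q (fps_const (letter_form X z) * (fps_X * alt_qy z)) z"
        "fps_deriv_at alt_qy (fps_const (letter_form Y z) * alt_q z) z"
        using alt_system_p alt_system_q z by (simp_all add: alt_system_def)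
      show ?thesis
        using fps_deriv_at_diff[OF fps_deriv_at_mult[OF D(1,4)] fps_deriv_at_mult[OF D(3,2)]]
        by (simp add: algebra_simps)
    qed
    then have "((\<lambda>z. (alt_p z * alt_qy z - alt_q z * alt_py z) $ n) has_real_derivative 0) (at z)"
      unfolding fps_deriv_at_def by simp
    from DERIV_diff[OF this DERIV_const[of "1 $ n"]] show ?thesis by simp
  qed
  moreover have "((\<lambda>z. (alt_p z * alt_qy z - alt_q z * alt_py z) $ n - 1 $ n) \<longlongrightarrow> 0) (at_right 0)"
    using vanishing_tendsto[of "\<lambda>z. alt_p z * alt_qy z - alt_q z * alt_py z - 1" n]
      log_equiv_diff[OF log_equiv_mult[OF log_equiv_alt_p log_equiv_alt_qy] log_equiv_mult[OF log_equiv_alt_q log_equiv_alt_py]]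
    by (simp add: log_equiv_def)
  ultimately have "(alt_p z * alt_qy z - alt_q z * alt_py z) $ n - 1 $ n = 0"
    by (rule zero_deriv_imp_zero) (use assms in auto)
  then show "(alt_p z * alt_qy z - alt_q z * alt_py z) $ n = 1 $ n" by simp
qed

text \<open>A cycle of four letters contributes the factor \<open>-4 s\<^sup>2\<close>.\<close>

definition cyc_series :: "(nat \<Rightarrow> real) \<Rightarrow> real fps" where
  "cyc_series f = Abs_fps (\<lambda>n. (- 4) ^ n * f n) oo (fps_X ^ 2)"

lemma cyc_series_nth: "cyc_series f $ n = (if even n then (- 4) ^ (n div 2) * f (n div 2) else 0)"
  by (simp add: cyc_series_def fps_nth_compose_X_power)

lemma cyc_series_mult: "cyc_series f * cyc_series g = cyc_series (\<lambda>n. \<Sum>j\<le>n. f j * g (n - j))"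
proof -
  have "Abs_fps (\<lambda>n. (- 4) ^ n * f n) * Abs_fps (\<lambda>n. (- 4) ^ n * g n) =
      Abs_fps (\<lambda>n. (- 4 :: real) ^ n * (\<Sum>j\<le>n. f j * g (n - j)))"
  proof (rule fps_ext)
    fix n
    have *: "(- 4) ^ j * f j * ((- 4) ^ (n - j) * g (n - j)) = (- 4) ^ n * (f j * g (n - j))"
      if "j \<in> {..n}" for j
      using that power_add[of "- 4 :: real" j "n - j"] by simp
    show "(Abs_fps (\<lambda>n. (- 4) ^ n * f n) * Abs_fps (\<lambda>n. (- 4) ^ n * g n)) $ n =
        Abs_fps (\<lambda>n. (- 4 :: real) ^ n * (\<Sum>j\<le>n. f j * g (n - j))) $ n"
      unfolding fps_mult_nth fps_nth_Abs_fps atLeast0AtMost sum_distrib_left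
      by (rule sum.cong[OF refl *])
  qed
  then show ?thesis
    unfolding cyc_series_def by (subst fps_compose_mult_distrib[symmetric]) simp_all
qed

lemma cyc_series_add: "cyc_series f + cyc_series g = cyc_series (\<lambda>n. f n + g n)"
  by (rule fps_ext) (simp add: cyc_series_nth algebra_simps)

lemma cyc_series_shift:
  "(- 4 * fps_X ^ 2) ^ s * cyc_series f = cyc_series (\<lambda>n. if n < s then 0 else f (n - s))"
proof (rule fps_ext)
  fix n
  have "- 4 * fps_X ^ 2 = fps_const (- 4 :: real) * fps_X ^ 2" by (simp add: numeral_fps_const)
  then have eq: "(- 4 * fps_X ^ 2) ^ s * cyc_series f = fps_const ((- 4) ^ s) * (fps_X ^ (2 * s) * cyc_series f)"
    by (simp only: power_mult_distrib fps_const_power mult.assoc power_mult)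
  have "((- 4 * fps_X ^ 2) ^ s * cyc_series f) $ n =
      (if n < 2 * s then 0 else (- 4) ^ s * cyc_series f $ (n - 2 * s))"
    unfolding eq by (simp add: fps_X_power_mult_nth)
  also have "\<dots> = cyc_series (\<lambda>n. if n < s then 0 else f (n - s)) $ n"
  proof (cases "even n \<and> n \<ge> 2 * s")
    case True
    then obtain k where k: "n = 2 * k" "k \<ge> s" by auto
    then have "2 * k - 2 * s = 2 * (k - s)" "(- 4 :: real) ^ s * (- 4) ^ (k - s) = (- 4) ^ k"
      by (simp_all flip: power_add)
    with k show ?thesis by (simp add: cyc_series_nth mult.assoc[symmetric])
  qed (auto simp: cyc_series_nth)
  finally show "((- 4 * fps_X ^ 2) ^ s * cyc_series f) $ n =
      cyc_series (\<lambda>n. if n < s then 0 else f (n - s)) $ n" .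
qed

definition word_series :: "(nat \<Rightarrow> letter list) \<Rightarrow> real \<Rightarrow> real fps" where
  "word_series W z = cyc_series (\<lambda>n. iter_int (W n) z)"

lemma word_series_deriv:
  assumes V: "\<And>n. V (n + s) = W n @ [a]" "\<And>n. n < s \<Longrightarrow> V n = []" and z: "0 < z" "z < 1"
  shows "fps_deriv_at (word_series V)
     (fps_const (letter_form a z) * ((- 4 * fps_X ^ 2) ^ s * word_series W z)) z"
  unfolding fps_deriv_at_def
proof
  fix n :: nat
  define k where "k = n div 2"
  have "((\<lambda>z. iter_int (V k) z) has_real_derivative
      (if k < s then 0 else letter_form a z * iter_int (W (k - s)) z)) (at z)"
    using V(1)[of "k - s"] V(2)[of k] iter_int_deriv[OF z] by auto
  then have "((\<lambda>z. (- 4) ^ k * iter_int (V k) z) has_real_derivative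
      (- 4) ^ k * (if k < s then 0 else letter_form a z * iter_int (W (k - s)) z)) (at z)"
    by (rule DERIV_cmult)
  then show "((\<lambda>z. word_series V z $ n) has_real_derivative
      (fps_const (letter_form a z) * ((- 4 * fps_X ^ 2) ^ s * word_series W z)) $ n) (at z)"
    unfolding word_series_def cyc_series_shift by (auto simp: cyc_series_nth k_def mult_ac)
qed

text \<open>Two word sequences that are consecutive components of the four-dimensional system: the
  words of \<open>V\<close> extend those of \<open>W\<close> by a letter, \<open>V\<close> being ahead by \<open>s\<close> periods.\<close>

definition cyc_edge :: "nat \<Rightarrow> letter \<Rightarrow> real fps \<Rightarrow> real fps \<Rightarrow> (nat \<Rightarrow> letter list) \<Rightarrow> real fps \<Rightarrow>
    (nat \<Rightarrow> letter list) \<Rightarrow> bool" where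
  "cyc_edge s a k c W d V \<longleftrightarrow> (\<forall>n. V (n + s) = W n @ [a]) \<and> (\<forall>n<s. V n = []) \<and>
     d * (- 4 * fps_X ^ 2) ^ s = k * c"

lemma cyc_edge_deriv:
  assumes "cyc_edge s a k c W d V" "0 < z" "z < 1"
  shows "fps_deriv_at (\<lambda>z. d * word_series V z) (fps_const (letter_form a z) * (k * (c * word_series W z))) z"
proof -
  have s: "\<And>n. V (n + s) = W n @ [a]" "\<And>n. n < s \<Longrightarrow> V n = []"
    "d * (- 4 * fps_X ^ 2) ^ s = k * c"
    using assms(1) by (simp_all add: cyc_edge_def)
  have eq: "d * (fps_const (letter_form a z) * ((- 4 * fps_X ^ 2) ^ s * word_series W z)) =
      fps_const (letter_form a z) * (d * (- 4 * fps_X ^ 2) ^ s * word_series W z)"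
    by (simp only: mult_ac)
  show ?thesis
    using fps_deriv_at_cmult[OF word_series_deriv[of V s W a, OF s(1,2) assms(2,3)], of d]
    unfolding eq unfolding s(3) unfolding mult.assoc .
qed

text \<open>The leading behaviour at 0: a word containing \<open>Y\<close> is negligible, and a word
  in \<open>X\<close> alone is exactly a divided power of the logarithm.\<close>

definition word_init :: "letter list \<Rightarrow> real \<Rightarrow> real" where
  "word_init w z = (if Y \<in> set w then 0 else ln z ^ length w / fact (length w))"

lemma iter_int_eq_word_init: "Y \<notin> set w \<Longrightarrow> iter_int w z = word_init w z"
proof -
  assume "Y \<notin> set w"
  then have "w = replicate (length w) X"
    by (intro replicate_length_same[symmetric]) (metis letter.exhaust)
  with \<open>Y \<notin> set w\<close> show ?thesis using iter_int_replicate_X[of "length w" z] by (simp add: word_init_def)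
qed

lemma multiplier_word_init: "multiplier (\<lambda>z. fps_const (word_init w z))"
proof -
  have "multiplier (\<lambda>z. fps_const (ln z ^ k))" for k :: nat
  proof (induction k)
    case (Suc k)
    from multiplier_mult[OF multiplier_ln this] show ?case by simp
  qed (simp add: multiplier_const)
  from multiplier_mult[OF multiplier_const[of "fps_const (1 / fact (length w))"] this]
  show ?thesis by (cases "Y \<in> set w") (simp_all add: word_init_def multiplier_const)
qed

lemma log_equiv_word_series:
  assumes "\<And>n. n > 0 \<Longrightarrow> Y \<in> set (W n)"
  shows "log_equiv (\<lambda>z. c * word_series W z) (\<lambda>z. c * fps_const (word_init (W 0) z))"
proof -
  have "log_equiv (word_series W) (\<lambda>z. fps_const (word_init (W 0) z))"
  proof (rule log_equiv_iter_int[OF _ multiplier_word_init])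
    fix n
    show "(\<forall>z. (word_series W z - fps_const (word_init (W 0) z)) $ n = 0) \<or>
      (\<exists>w c. Y \<in> set w \<and> (\<forall>z. (word_series W z - fps_const (word_init (W 0) z)) $ n = c * iter_int w z))"
    proof (cases "even n \<and> Y \<in> set (W (n div 2))")
      case True
      then show ?thesis
        by (intro disjI2 exI[of _ "W (n div 2)"] exI[of _ "(- 4) ^ (n div 2)"])
           (auto simp: word_series_def cyc_series_nth word_init_def)
    next
      case False
      then show ?thesis using assms[of "n div 2"]
        by (intro disjI1) (auto simp: word_series_def cyc_series_nth iter_int_eq_word_init)
    qed
  qed
  from log_equiv_mult[OF log_equiv_const this] show ?thesis .
qed

lemma log_equiv_cong: "log_equiv F A \<Longrightarrow> (\<And>z. A z = B z) \<Longrightarrow> log_equiv F B"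
  by (metis ext)

text \<open>The coefficients \<open>a\<close>, \<open>b\<close>, \<open>c\<close>, \<open>d\<close>
  are coordinates with respect to the four tensor products of the columns p, q with their flipped
  copies, in the order pp, pq, qp, qq.\<close>

definition mix :: "real fps \<Rightarrow> real fps \<Rightarrow> real fps \<Rightarrow> real fps \<Rightarrow> (real \<Rightarrow> real fps) \<Rightarrow> (real \<Rightarrow> real fps) \<Rightarrow>
    (real \<Rightarrow> real fps) \<Rightarrow> (real \<Rightarrow> real fps) \<Rightarrow> real \<Rightarrow> real fps" where
  "mix a b c d F G H K z = a * (F z * fps_flip (H z)) + b * (F z * fps_flip (K z)) +
     c * (G z * fps_flip (H z)) + d * (G z * fps_flip (K z))"

lemma cyc_system_mix:
  "cyc_system (mix a b c d alt_py alt_qy alt_py alt_qy)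
     (\<lambda>z. mix a b c d alt_py alt_qy alt_p alt_q z - mix a b c d alt_p alt_q alt_py alt_qy z)
     (mix a b c d alt_p alt_q alt_p alt_q)
     (\<lambda>z. mix a b c d alt_p alt_q alt_py alt_qy z + mix a b c d alt_py alt_qy alt_p alt_q z)"
proof -
  note p = alt_system_p and q = alt_system_q
  have "cyc_system (\<lambda>z. 0) (\<lambda>z. 0) (\<lambda>z. 0) (\<lambda>z. 0)"
    by (simp add: cyc_system_def fps_deriv_at_const)
  from cyc_system_add_mult[OF this cyc_system_tensor[OF p p], of a]
  have "cyc_system (\<lambda>z. a * (alt_py z * fps_flip (alt_py z)))
     (\<lambda>z. a * (alt_py z * fps_flip (alt_p z) - alt_p z * fps_flip (alt_py z)))
     (\<lambda>z. a * (alt_p z * fps_flip (alt_p z)))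
     (\<lambda>z. a * (alt_p z * fps_flip (alt_py z) + alt_py z * fps_flip (alt_p z)))" by simp
  from cyc_system_add_mult[OF cyc_system_add_mult[OF cyc_system_add_mult[OF this
    cyc_system_tensor[OF p q], of b] cyc_system_tensor[OF q p], of c] cyc_system_tensor[OF q q], of d]
  show ?thesis by (simp add: mix_def[abs_def] algebra_simps)
qed

text \<open>A solution of the four-dimensional system is determined by its behaviour at \<open>0\<close>, where
  the alternating series are \<open>1\<close>, \<open>0\<close>, \<open>s log z\<close> and \<open>1\<close> up to negligible terms.\<close>

lemma word_series_eq_mix:
  fixes c1 c2 c3 c4 a b c d :: "real fps"
  assumes edges: "cyc_edge s1 Y 1 c4 W4 c1 W1" "cyc_edge s2 X (- 2 * fps_X) c1 W1 c2 W2"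
      "cyc_edge s3 X fps_X c2 W2 c3 W3" "cyc_edge s4 Y 2 c3 W3 c4 W4"
    and Y: "\<And>n. n > 0 \<Longrightarrow> Y \<in> set (W1 n) \<inter> set (W2 n) \<inter> set (W3 n) \<inter> set (W4 n)"
    and init: "\<And>z. c1 * fps_const (word_init (W1 0) z) = d"
      "\<And>z. c2 * fps_const (word_init (W2 0) z) = c - b - 2 * d * (fps_X * fps_const (ln z))"
      "\<And>z. c3 * fps_const (word_init (W3 0) z) =
         a + (c - b) * (fps_X * fps_const (ln z)) - d * (fps_X * fps_const (ln z)) ^ 2"
      "\<And>z. c4 * fps_const (word_init (W4 0) z) = b + c"
    and z: "0 < z" "z < 1"
  shows "c3 * word_series W3 z = mix a b c d alt_p alt_q alt_p alt_q z \<and>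
    c4 * word_series W4 z = mix a b c d alt_p alt_q alt_py alt_qy z + mix a b c d alt_py alt_qy alt_p alt_q z"
proof -
  have "cyc_system (\<lambda>z. c1 * word_series W1 z) (\<lambda>z. c2 * word_series W2 z)
     (\<lambda>z. c3 * word_series W3 z) (\<lambda>z. c4 * word_series W4 z)"
    unfolding cyc_system_def using edges[THEN cyc_edge_deriv] by simp
  note unique = cyc_system_unique[OF this cyc_system_mix[of a b c d]]
  have words: "log_equiv (\<lambda>z. c1 * word_series W1 z) (\<lambda>z. d)"
    "log_equiv (\<lambda>z. c2 * word_series W2 z) (\<lambda>z. c - b - 2 * d * (fps_X * fps_const (ln z)))"
    "log_equiv (\<lambda>z. c3 * word_series W3 z)
       (\<lambda>z. a + (c - b) * (fps_X * fps_const (ln z)) - d * (fps_X * fps_const (ln z)) ^ 2)"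
    "log_equiv (\<lambda>z. c4 * word_series W4 z) (\<lambda>z. b + c)"
    by (rule log_equiv_cong, rule log_equiv_word_series, use Y in blast, rule init)+
  note intros = log_equiv_add log_equiv_diff log_equiv_mult log_equiv_const log_equiv_alt_p log_equiv_alt_py
    log_equiv_alt_q log_equiv_alt_qy log_equiv_flip_alt
  have "log_equiv (mix a b c d alt_py alt_qy alt_py alt_qy) (\<lambda>z. d)"
    "log_equiv (\<lambda>z. mix a b c d alt_py alt_qy alt_p alt_q z - mix a b c d alt_p alt_q alt_py alt_qy z)
       (\<lambda>z. c - b - 2 * d * (fps_X * fps_const (ln z)))"
    "log_equiv (mix a b c d alt_p alt_q alt_p alt_q)
       (\<lambda>z. a + (c - b) * (fps_X * fps_const (ln z)) - d * (fps_X * fps_const (ln z)) ^ 2)"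
    "log_equiv (\<lambda>z. mix a b c d alt_p alt_q alt_py alt_qy z + mix a b c d alt_py alt_qy alt_p alt_q z) (\<lambda>z. b + c)"
    unfolding mix_def[abs_def]
    by (rule log_equiv_cong, (rule intros)+, simp add: algebra_simps power2_eq_square)+
  from unique[OF words this z] show ?thesis by blast
qed

section \<open>The four families of words, sorted by the component that contains the empty
  word\<close>

abbreviation cyc :: "nat \<Rightarrow> letter list" where
  "cyc \<equiv> word_pow [Y, Y, X, X]"

abbreviation cyc' :: "nat \<Rightarrow> letter list" where
  "cyc' \<equiv> word_pow [Y, X, X, Y]"

lemma Y_in_word_pow: "n > 0 \<Longrightarrow> Y \<in> set w \<Longrightarrow> Y \<in> set (word_pow w n)"
  by (cases n) (simp_all add: word_pow_Suc)

lemmas word_edge_simps = cyc_edge_def word_pow_Suc Y_in_word_pow word_init_def power2_eq_square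

text \<open>The empty word lies in the third component, whence \<open>a = 1\<close> and no other
  coordinate. The factors of the remaining components are products of the edge constants met on the
  way from there: 2 for the fourth and the first, then \<open>- 4 * fps_X\<close> for the
  second.\<close>

lemma word_series_cyc:
  assumes "0 < z" "z < 1"
  shows "word_series cyc z = alt_p z * fps_flip (alt_p z)"
    and "2 * word_series (\<lambda>n. cyc n @ [Y]) z = alt_p z * fps_flip (alt_py z) + alt_py z * fps_flip (alt_p z)"
proof -
  have "1 * word_series cyc z = mix 1 0 0 0 alt_p alt_q alt_p alt_q z \<and>
      2 * word_series (\<lambda>n. cyc n @ [Y]) z =
        mix 1 0 0 0 alt_p alt_q alt_py alt_qy z + mix 1 0 0 0 alt_py alt_qy alt_p alt_q z"
    by (rule word_series_eq_mix[where ?W1.0 = "\<lambda>n. cyc n @ [Y, Y]" and ?W2.0 = "\<lambda>n. cyc n @ [Y, Y, X]"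
          and ?c1.0 = 2 and ?c2.0 = "- 4 * fps_X" and ?s1.0 = 0 and ?s2.0 = 0 and ?s3.0 = 1 and ?s4.0 = 0,
        OF _ _ _ _ _ _ _ _ _ assms]; simp add: word_edge_simps)
  then show "word_series cyc z = alt_p z * fps_flip (alt_p z)"
    "2 * word_series (\<lambda>n. cyc n @ [Y]) z = alt_p z * fps_flip (alt_py z) + alt_py z * fps_flip (alt_p z)"
    by (simp_all add: mix_def)
qed

text \<open>The empty word lies in the second component. With the normalization 2 there, the
  conditions \<open>c - b = 2\<close> and \<open>b + c = 0\<close> have the integral solution
  \<open>b = - 1\<close>, \<open>c = 1\<close>.\<close>

lemma word_series_X_cyc:
  assumes "0 < z" "z < 1"
  shows "2 * fps_X * word_series (\<lambda>n. X # cyc n) z =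
      alt_q z * fps_flip (alt_p z) - alt_p z * fps_flip (alt_q z)"
    and "4 * fps_X * word_series (\<lambda>n. X # cyc n @ [Y]) z =
      (alt_q z * fps_flip (alt_py z) + alt_qy z * fps_flip (alt_p z)) -
      (alt_p z * fps_flip (alt_qy z) + alt_py z * fps_flip (alt_q z))"
proof -
  \<comment> \<open>The empty word is placed at index 0, which moves the other words of this
    component up by one period; this is the reason for the offset 1 on the edge into it.\<close>
  define W where "W n = (case n of 0 \<Rightarrow> [] | Suc k \<Rightarrow> X # cyc k @ [Y, Y, X])" for n
  have W: "W 0 = []" "W (Suc n) = X # cyc n @ [Y, Y, X]" "n > 0 \<Longrightarrow> Y \<in> set (W n)" "X # cyc n = W n @ [X]" for n
    by (cases n; simp add: W_def word_pow_Suc)+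
  have "2 * fps_X * word_series (\<lambda>n. X # cyc n) z = mix 0 (- 1) 1 0 alt_p alt_q alt_p alt_q z \<and>
      4 * fps_X * word_series (\<lambda>n. X # cyc n @ [Y]) z =
        mix 0 (- 1) 1 0 alt_p alt_q alt_py alt_qy z + mix 0 (- 1) 1 0 alt_py alt_qy alt_p alt_q z"
    by (rule word_series_eq_mix[where ?W1.0 = "\<lambda>n. X # cyc n @ [Y, Y]" and ?W2.0 = W
          and ?c1.0 = "4 * fps_X" and ?c2.0 = 2 and ?s1.0 = 0 and ?s2.0 = 1 and ?s3.0 = 0 and ?s4.0 = 0,
        OF _ _ _ _ _ _ _ _ _ assms]; simp add: word_edge_simps W)
  then show "2 * fps_X * word_series (\<lambda>n. X # cyc n) z =
      alt_q z * fps_flip (alt_p z) - alt_p z * fps_flip (alt_q z)"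
    "4 * fps_X * word_series (\<lambda>n. X # cyc n @ [Y]) z =
      (alt_q z * fps_flip (alt_py z) + alt_qy z * fps_flip (alt_p z)) -
      (alt_p z * fps_flip (alt_qy z) + alt_py z * fps_flip (alt_q z))"
    by (simp_all add: mix_def)
qed

text \<open>The empty word lies in the first component, so the solution is the pure tensor with
  \<open>d = 1\<close>. Its third component starts with the word XX, which accounts for the term in
  the square of log z.\<close>

lemma word_series_XX_cyc:
  assumes "0 < z" "z < 1"
  shows "- 2 * fps_X ^ 2 * word_series (\<lambda>n. X # X # cyc n) z = alt_q z * fps_flip (alt_q z)"
    and "- 4 * fps_X ^ 2 * word_series (\<lambda>n. X # X # cyc n @ [Y]) z =
      alt_q z * fps_flip (alt_qy z) + alt_qy z * fps_flip (alt_q z)"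
proof -
  define W where "W n = (case n of 0 \<Rightarrow> [] | Suc k \<Rightarrow> X # X # cyc k @ [Y, Y])" for n
  have W: "W 0 = []" "W (Suc n) = X # X # cyc n @ [Y, Y]" "n > 0 \<Longrightarrow> Y \<in> set (W n)"
    "X # X # cyc n = W n @ [X, X]" for n
    by (cases n; simp add: W_def word_pow_Suc)+
  have half: "2 * fps_const (x / 2 :: real) = fps_const x" for x by (simp add: numeral_fps_const)
  have "- 2 * fps_X ^ 2 * word_series (\<lambda>n. X # X # cyc n) z = mix 0 0 0 1 alt_p alt_q alt_p alt_q z \<and>
      - 4 * fps_X ^ 2 * word_series (\<lambda>n. X # X # cyc n @ [Y]) z =
        mix 0 0 0 1 alt_p alt_q alt_py alt_qy z + mix 0 0 0 1 alt_py alt_qy alt_p alt_q z"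
    by (rule word_series_eq_mix[where ?W1.0 = W and ?W2.0 = "\<lambda>n. W n @ [X]"
          and ?c1.0 = 1 and ?c2.0 = "- 2 * fps_X" and ?s1.0 = 1 and ?s2.0 = 0 and ?s3.0 = 0 and ?s4.0 = 0,
        OF _ _ _ _ _ _ _ _ _ assms]; simp add: word_edge_simps W half)
  then show "- 2 * fps_X ^ 2 * word_series (\<lambda>n. X # X # cyc n) z = alt_q z * fps_flip (alt_q z)"
    "- 4 * fps_X ^ 2 * word_series (\<lambda>n. X # X # cyc n @ [Y]) z =
      alt_q z * fps_flip (alt_qy z) + alt_qy z * fps_flip (alt_q z)"
    by (simp_all add: mix_def)
qed

text \<open>The empty word lies in the fourth component; the conditions \<open>b + c = 2\<close> and
  \<open>c - b = 0\<close> select the symmetric combination \<open>b = c = 1\<close>.\<close>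

lemma word_series_cyc':
  assumes "0 < z" "z < 1"
  shows "2 * word_series cyc' z = (alt_p z * fps_flip (alt_qy z) + alt_py z * fps_flip (alt_q z)) +
      (alt_q z * fps_flip (alt_py z) + alt_qy z * fps_flip (alt_p z))"
    and "- 4 * fps_X ^ 2 * word_series (\<lambda>n. cyc' n @ [Y, X, X]) z =
      alt_p z * fps_flip (alt_q z) + alt_q z * fps_flip (alt_p z)"
proof -
  have "- 4 * fps_X ^ 2 * word_series (\<lambda>n. cyc' n @ [Y, X, X]) z = mix 0 1 1 0 alt_p alt_q alt_p alt_q z \<and>
      2 * word_series cyc' z = mix 0 1 1 0 alt_p alt_q alt_py alt_qy z + mix 0 1 1 0 alt_py alt_qy alt_p alt_q z"
    by (rule word_series_eq_mix[where ?W1.0 = "\<lambda>n. cyc' n @ [Y]" and ?W2.0 = "\<lambda>n. cyc' n @ [Y, X]"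
          and ?c1.0 = 2 and ?c2.0 = "- 4 * fps_X" and ?s1.0 = 0 and ?s2.0 = 0 and ?s3.0 = 0 and ?s4.0 = 1,
        OF _ _ _ _ _ _ _ _ _ assms]; simp add: word_edge_simps)
  then show "2 * word_series cyc' z = (alt_p z * fps_flip (alt_qy z) + alt_py z * fps_flip (alt_q z)) +
      (alt_q z * fps_flip (alt_py z) + alt_qy z * fps_flip (alt_p z))"
    "- 4 * fps_X ^ 2 * word_series (\<lambda>n. cyc' n @ [Y, X, X]) z =
      alt_p z * fps_flip (alt_q z) + alt_q z * fps_flip (alt_p z)"
    by (simp_all add: mix_def add_ac)
qed

section \<open>The index \<open>{3,1}\<^sup>n\<close>\<close>

definition rep :: "nat list \<Rightarrow> nat \<Rightarrow> nat list" where
  "rep ks n = concat (replicate n ks)"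

lemma rep_0 [simp]: "rep ks 0 = []"
  by (simp add: rep_def)

lemma rep_Suc: "rep ks (Suc n) = ks @ rep ks n"
  by (simp add: rep_def)

lemma rep_add: "rep ks (m + n) = rep ks m @ rep ks n"
  by (simp add: rep_def replicate_add)

lemma length_rep [simp]: "length (rep ks n) = n * length ks"
  by (induction n) (simp_all add: rep_Suc)

lemma sum_list_rep [simp]: "sum_list (rep ks n) = n * sum_list ks"
  by (induction n) (simp_all add: rep_Suc)

lemma rev_rep: "rev (rep ks n) = rep (rev ks) n"
  by (simp add: rep_def rev_concat)

lemma index_word_rep: "index_word (rep ks n) = word_pow (index_word ks) n"
  by (induction n) (simp_all add: rep_Suc word_pow_Suc' index_word_append)

lemma indices_rep: "ks \<in> indices \<Longrightarrow> rep ks n \<in> indices"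
  by (induction n) (simp_all add: rep_Suc)

lemma index_words_31:
  "index_word (rep [3, 1] n) = cyc' n" "index_word (rep [3, 1] n @ [3]) = cyc' n @ [Y, X, X]"
  "index_word (rep [1, 3] n) = cyc n" "index_word (rep [1, 3] n @ [1]) = cyc n @ [Y]"
  by (simp_all add: index_word_append index_word_rep) (simp_all add: index_word_def numeral_3_eq_3)

lemma splits_even:
  assumes "j \<le> n"
  shows "take (2 * j) (rep [3, 1] n) = rep [3, 1] j"
    and "drop (2 * j) (rep [3, 1] n) = rep [3, 1] (n - j)"
proof -
  have "rep [3, 1] n = rep [3, 1] j @ rep [3, 1] (n - j)"
    using assms rep_add[of "[3, 1]" j "n - j"] by simp
  then show "take (2 * j) (rep [3, 1] n) = rep [3, 1] j"
    "drop (2 * j) (rep [3, 1] n) = rep [3, 1] (n - j)" by simp_all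
qed

lemma splits_odd:
  assumes "j < n"
  shows "take (2 * j + 1) (rep [3, 1] n) = rep [3, 1] j @ [3]"
    and "drop (2 * j + 1) (rep [3, 1] n) = 1 # rep [3, 1] (n - 1 - j)"
proof -
  have "rep [3, 1] n = rep [3, 1] j @ 3 # 1 # rep [3, 1] (n - 1 - j)"
    using assms rep_add[of "[3, 1]" j "Suc (n - 1 - j)"] by (simp add: rep_Suc)
  then show "take (2 * j + 1) (rep [3, 1] n) = rep [3, 1] j @ [3]"
    "drop (2 * j + 1) (rep [3, 1] n) = 1 # rep [3, 1] (n - 1 - j)" by simp_all
qed

lemma sum_even_odd: "(\<Sum>i\<le>2 * n. f i) = (\<Sum>j\<le>n. f (2 * j)) + (\<Sum>j<n. f (2 * j + 1))"
  for f :: "nat \<Rightarrow> 'a :: comm_monoid_add"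
  by (induction n) (simp_all add: ac_simps)

text \<open>A cut at an even position leaves a remainder of weight divisible by 4, and a cut at an
  odd position one of weight 1 modulo 4. The second sum therefore gets a minus sign.\<close>

lemma loop_int_31:
  "(- 1) ^ m * loop_int m (rep [3, 1] n) z =
     (\<Sum>j\<le>n. iter_int (cyc' j) z * iter_int (replicate m X @ cyc (n - j)) z) -
     (\<Sum>j<n. iter_int (cyc' j @ [Y, X, X]) z * iter_int (replicate m X @ cyc (n - 1 - j) @ [Y]) z)"
proof -
  define g where "g i = (- 1) ^ sum_list (drop i (rep [3, 1] n)) * iter_int (index_word (take i (rep [3, 1] n))) z *
     iter_int (replicate m X @ index_word (rev (drop i (rep [3, 1] n)))) z" for i
  have len: "length (rep [3, 1] n) = 2 * n" by simp
  have "(- 1) ^ m * loop_int m (rep [3, 1] n) z = (\<Sum>i\<le>2 * n. g i)"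
    unfolding loop_int_def len by (simp add: g_def sum_distrib_left mult_ac flip: power_mult_distrib)
  also have "\<dots> = (\<Sum>j\<le>n. g (2 * j)) + (\<Sum>j<n. g (2 * j + 1))" by (rule sum_even_odd)
  also have "(\<Sum>j\<le>n. g (2 * j)) = (\<Sum>j\<le>n. iter_int (cyc' j) z * iter_int (replicate m X @ cyc (n - j)) z)"
    by (intro sum.cong refl) (simp add: g_def splits_even rev_rep index_words_31 del: One_nat_def)
  also have "(\<Sum>j<n. g (2 * j + 1)) =
      (\<Sum>j<n. - (iter_int (cyc' j @ [Y, X, X]) z * iter_int (replicate m X @ cyc (n - 1 - j) @ [Y]) z))"
  proof (rule sum.cong[OF refl])
    fix j assume "j \<in> {..<n}"
    then have j: "j < n" by simp
    have "g (2 * j + 1) = - (iter_int (index_word (rep [3, 1] j @ [3])) z *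
        iter_int (replicate m X @ index_word (rep [1, 3] (n - 1 - j) @ [1])) z)"
      unfolding g_def splits_odd[OF j] by (simp add: rev_rep)
    then show "g (2 * j + 1) =
        - (iter_int (cyc' j @ [Y, X, X]) z * iter_int (replicate m X @ cyc (n - 1 - j) @ [Y]) z)"
      by (simp only: index_words_31)
  qed
  finally show ?thesis by (simp add: sum_negf)
qed

text \<open>Both sums are Cauchy products. At an odd cut the two pieces contain only n - 1 full
  periods together, and the factor \<open>- 4 * fps_X ^ 2\<close> accounts for the broken
  one.\<close>

lemma cyc_series_loop_int:
  "cyc_series (\<lambda>n. (- 1) ^ m * loop_int m (rep [3, 1] n) z) =
     word_series cyc' z * word_series (\<lambda>n. replicate m X @ cyc n) z -
     (- 4 * fps_X ^ 2 * word_series (\<lambda>n. cyc' n @ [Y, X, X]) z) *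
       word_series (\<lambda>n. replicate m X @ cyc n @ [Y]) z"
proof -
  define f g where "f n = iter_int (cyc' n @ [Y, X, X]) z"
    and "g n = iter_int (replicate m X @ cyc n @ [Y]) z" for n
  have "(\<Sum>j<n. f j * g (n - 1 - j)) = (if n < 1 then 0 else (\<Sum>j\<le>n - 1. f j * g (n - 1 - j)))" for n
    by (cases n) (simp_all add: lessThan_Suc_atMost)
  then have 1: "cyc_series (\<lambda>n. \<Sum>j<n. f j * g (n - 1 - j)) = - 4 * fps_X ^ 2 * (cyc_series f * cyc_series g)"
    using cyc_series_shift[of 1 "\<lambda>n. \<Sum>j\<le>n. f j * g (n - j)"] by (simp add: cyc_series_mult del: mult_minus_left)
  have 2: "cyc_series (\<lambda>n. (- 1) ^ m * loop_int m (rep [3, 1] n) z) +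
      cyc_series (\<lambda>n. \<Sum>j<n. f j * g (n - 1 - j)) =
      cyc_series (\<lambda>n. \<Sum>j\<le>n. iter_int (cyc' j) z * iter_int (replicate m X @ cyc (n - j)) z)"
    unfolding cyc_series_add loop_int_31 f_def g_def by simp
  have "cyc_series (\<lambda>n. (- 1) ^ m * loop_int m (rep [3, 1] n) z) =
      cyc_series (\<lambda>n. \<Sum>j\<le>n. iter_int (cyc' j) z * iter_int (replicate m X @ cyc (n - j)) z) -
      - 4 * fps_X ^ 2 * (cyc_series f * cyc_series g)"
    using 2 unfolding 1 by (simp add: algebra_simps)
  moreover have "cyc_series f = word_series (\<lambda>n. cyc' n @ [Y, X, X]) z"
    "cyc_series g = word_series (\<lambda>n. replicate m X @ cyc n @ [Y]) z"
    by (simp_all add: word_series_def f_def[abs_def] g_def[abs_def])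
  moreover have "cyc_series (\<lambda>n. \<Sum>j\<le>n. iter_int (cyc' j) z * iter_int (replicate m X @ cyc (n - j)) z) =
      word_series cyc' z * word_series (\<lambda>n. replicate m X @ cyc n) z"
    by (simp add: word_series_def cyc_series_mult)
  ultimately show ?thesis by (simp only: mult.assoc)
qed

lemma alt_wronskian_flip:
  assumes "0 < z" "z < 1"
  shows "fps_flip (alt_p z) * fps_flip (alt_qy z) - fps_flip (alt_q z) * fps_flip (alt_py z) = 1"
  using arg_cong[OF alt_wronskian[OF assms], of fps_flip] by (simp add: fps_flip_diff fps_flip_mult)

text \<open>The loop integrals of \<open>{3,1}\<^sup>n\<close> reduce to products of two alternating ones: in the tensor
  product the logarithm of the monodromy acts by the Leibniz rule, and the Wronskian is \<open>1\<close>.\<close>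

lemma loop_int_31_eq:
  assumes z: "0 < z" "z < 1"
  shows "(- 4) ^ n * loop_int 0 (rep [3, 1] n) z = (alt_p z * alt_p z) $ (2 * n)"
    and "(- 4) ^ n * loop_int 1 (rep [3, 1] n) z = - (alt_q z * alt_p z) $ (2 * n + 1)"
    and "2 * (- 4) ^ n * loop_int 2 (rep [3, 1] n) z = (alt_q z * alt_q z) $ (2 * n + 2)"
proof -
  define p py q qy where "p = alt_p z" and "py = alt_py z" and "q = alt_q z" and "qy = alt_qy z"
  define p' py' q' qy' where "p' = fps_flip p" and "py' = fps_flip py" and "q' = fps_flip q" and "qy' = fps_flip qy"
  note defs = p_def py_def q_def qy_def p'_def py'_def q'_def qy'_def
  have w: "p * qy - q * py = 1" "p' * qy' - q' * py' = 1"
    using alt_wronskian[OF z] alt_wronskian_flip[OF z] by (simp_all add: defs)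
  define A B where "A = word_series cyc' z"
    and "B = - 4 * fps_X ^ 2 * word_series (\<lambda>n. cyc' n @ [Y, X, X]) z"
  have A: "2 * A = (p * qy' + py * q') + (q * py' + qy * p')" and B: "B = p * q' + q * p'"
    using word_series_cyc'[OF z] by (simp_all add: A_def B_def defs)
  define L where "L m = cyc_series (\<lambda>n. (- 1) ^ m * loop_int m (rep [3, 1] n) z)" for m

  have "2 * L 0 = p * p + p' * p'"
  proof -
    define C D where "C = word_series cyc z" and "D = word_series (\<lambda>n. cyc n @ [Y]) z"
    have C: "C = p * p'" and D: "2 * D = p * py' + py * p'"
      using word_series_cyc[OF z] by (simp_all add: C_def D_def defs)
    have "2 * L 0 = (2 * A) * C - B * (2 * D)"
      using cyc_series_loop_int[of 0 z] by (simp add: L_def A_def B_def C_def D_def algebra_simps)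
    \<comment> \<open>The terms with \<open>py * q'\<close> and with \<open>q * py'\<close> occur in
      both products and cancel; the rest groups into the two Wronskians.\<close>
    also have "\<dots> = p * p * (p' * qy' - q' * py') + p' * p' * (p * qy - q * py)"
      unfolding A B C D by (simp add: algebra_simps)
    finally show ?thesis by (simp add: w)
  qed
  \<comment> \<open>A series plus its image under s -> -s has doubled even coefficients.\<close>
  from arg_cong[OF this, of "\<lambda>f. f $ (2 * n)"]
  show "(- 4) ^ n * loop_int 0 (rep [3, 1] n) z = (alt_p z * alt_p z) $ (2 * n)"
    by (simp add: L_def cyc_series_nth p'_def numeral_fps_const flip: fps_flip_mult p_def)

  have "2 * fps_X * L 1 = q * p - q' * p'"
  proof -
    define C D where "C = word_series (\<lambda>n. X # cyc n) z" and "D = word_series (\<lambda>n. X # cyc n @ [Y]) z"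
    have C: "2 * fps_X * C = q * p' - p * q'"
      and D: "4 * fps_X * D = (q * py' + qy * p') - (p * qy' + py * q')"
      using word_series_X_cyc[OF z] by (simp_all add: C_def D_def defs)
    \<comment> \<open>The additional factor 2 allows the formulas for \<open>2 * A\<close> and
      \<open>4 * fps_X * D\<close> to be inserted without fractions.\<close>
    have "2 * (2 * fps_X * L 1) = (2 * A) * (2 * fps_X * C) - B * (4 * fps_X * D)"
      using cyc_series_loop_int[of 1 z] by (simp add: L_def A_def B_def C_def D_def algebra_simps)
    also have "\<dots> = 2 * (q * p * (p' * qy' - q' * py') - q' * p' * (p * qy - q * py))"
      unfolding A B C D by (simp add: algebra_simps)
    finally have "2 * (2 * fps_X * L 1) = 2 * (q * p - q' * p')" by (simp only: w mult_1_right)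
    moreover have "(2 :: real fps) \<noteq> 0" by simp
    ultimately show ?thesis by (simp only: mult_cancel_left simp_thms)
  qed
  \<comment> \<open>Here the difference with the flipped series doubles the odd coefficients, and
    the \<open>fps_X\<close> on the left moves degree 2n to 2n + 1.\<close>
  from arg_cong[OF this, of "\<lambda>f. f $ (2 * n + 1)"]
  show "(- 4) ^ n * loop_int 1 (rep [3, 1] n) z = - (alt_q z * alt_p z) $ (2 * n + 1)"
    by (simp add: L_def cyc_series_nth p'_def q'_def numeral_fps_const mult.assoc
        flip: fps_flip_mult p_def q_def)

  have "4 * fps_X ^ 2 * L 2 = q * q + q' * q'"
  proof -
    define C D where "C = word_series (\<lambda>n. X # X # cyc n) z" and "D = word_series (\<lambda>n. X # X # cyc n @ [Y]) z"
    have C: "- 2 * fps_X ^ 2 * C = q * q'" and D: "- 4 * fps_X ^ 2 * D = q * qy' + qy * q'"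
      using word_series_XX_cyc[OF z] by (simp_all add: C_def D_def defs)
    have "- (4 * fps_X ^ 2 * L 2) = (2 * A) * (- 2 * fps_X ^ 2 * C) - B * (- 4 * fps_X ^ 2 * D)"
      using cyc_series_loop_int[of 2 z]
      by (simp add: L_def A_def B_def C_def D_def algebra_simps numeral_2_eq_2)
    also have "\<dots> = - (q * q * (p' * qy' - q' * py') + q' * q' * (p * qy - q * py))"
      unfolding A B C D by (simp add: algebra_simps)
    finally have "- (4 * fps_X ^ 2 * L 2) = - (q * q + q' * q')" by (simp only: w mult_1_right)
    then show ?thesis by (simp only: neg_equal_iff_equal)
  qed
  from arg_cong[OF this, of "\<lambda>f. f $ (2 * n + 2)"]
  show "2 * (- 4) ^ n * loop_int 2 (rep [3, 1] n) z = (alt_q z * alt_q z) $ (2 * n + 2)"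
    by (simp add: L_def cyc_series_nth q'_def numeral_fps_const mult.assoc fps_X_power_mult_nth
        flip: fps_flip_mult q_def)
qed


section \<open>Evaluation of the alternating words\<close>

definition zeta_twos :: "real fps" where
  "zeta_twos = Abs_fps (\<lambda>j. mzv (rep [2] j))"

definition zeta_twos_shift :: "real fps" where
  "zeta_twos_shift = Abs_fps (\<lambda>j. zeta_reg_shift Shuffle 1 (rep [2] j))"

text \<open>The logarithmic derivative in t at 0 of the product of 1 + s/(n - t)^2 over n, expanded
  in s. It has no constant term, which is how the convention for \<open>riemann_zeta 1\<close>
  enters.\<close>

definition odd_zeta_series :: "real fps" where
  "odd_zeta_series = Abs_fps (\<lambda>k. - 2 * (- 1) ^ k * riemann_zeta (2 * k + 1))"

lemma index_word_rep_2: "index_word (rep [2] j) = word_pow [Y, X] j"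
  unfolding index_word_rep by (simp add: index_word_def)

lemma rep_Suc': "rep ks (Suc n) = rep ks n @ ks"
  using rep_add[of ks n 1] by (simp add: rep_Suc)

lemma admissible_rep_2: "admissible (rep [2] j)"
  by (cases j) (simp_all add: admissible_def rep_Suc' indices_rep)

text \<open>A series in t. For \<open>N > 0\<close> it is the coefficient of s^j in the product of 1
  + s/(n - t)^2 over 1 <= n < N: each entry 2 of the index selects one factor.\<close>

definition trunc :: "nat \<Rightarrow> nat \<Rightarrow> real fps" where
  "trunc N j = (\<Sum>n<N. word_coeff (word_pow [Y, X] j) n)"

lemma trunc_zero: "N > 0 \<Longrightarrow> trunc N 0 = 1"
  by (simp add: trunc_def word_coeff_Nil)

lemma trunc_one: "trunc (Suc 0) j = (if j = 0 then 1 else 0)"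
proof (cases j)
  case (Suc i)
  have "word_pow [Y, X] j \<in> index_words" "word_pow [Y, X] j \<noteq> []"
    by (simp_all add: Suc word_pow_Suc' index_words_Cons)
  from word_coeff_zero[OF this] show ?thesis by (simp add: trunc_def Suc)
qed (simp add: trunc_def word_coeff_Nil)

lemma trunc_Suc:
  "trunc (Suc N) (Suc j) = trunc N (Suc j) + trunc N j * inverse (fps_const (real N) - fps_X) ^ 2"
proof -
  have "word_pow [Y, X] (Suc j) = (word_pow [Y, X] j @ [Y]) @ [X]" by (simp add: word_pow_Suc)
  then have "word_coeff (word_pow [Y, X] (Suc j)) N = trunc N j * inverse (fps_const (real N) - fps_X) ^ 2"
    unfolding trunc_def by (simp only: word_coeff_snoc) (simp add: word_step_def power2_eq_square mult.assoc)
  then show ?thesis by (simp add: trunc_def)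
qed

text \<open>Exchanges the two variables: a series in s formed from the coefficients of t^0, and of
  t^1 in the companion \<open>trunc1\<close>.\<close>

definition trunc0 :: "nat \<Rightarrow> real fps" where
  "trunc0 N = Abs_fps (\<lambda>j. trunc N j $ 0)"

definition trunc1 :: "nat \<Rightarrow> real fps" where
  "trunc1 N = Abs_fps (\<lambda>j. trunc N j $ 1)"

lemma weight_nth:
  assumes "N > 0"
  shows "(inverse (fps_const (real N) - fps_X) ^ 2) $ 0 = 1 / real N ^ 2"
    and "(inverse (fps_const (real N) - fps_X) ^ 2) $ Suc 0 = 2 / real N ^ 3"
  using inverse_shift_power_nth[OF assms, of 2 0] inverse_shift_power_nth[OF assms, of 2 1] by simp_all

lemma trunc0_Suc:
  assumes "N > 0"
  shows "trunc0 (Suc N) = trunc0 N * (1 + fps_const (1 / real N ^ 2) * fps_X)"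
proof (rule fps_ext)
  fix j
  show "trunc0 (Suc N) $ j = (trunc0 N * (1 + fps_const (1 / real N ^ 2) * fps_X)) $ j"
    using assms
    by (cases j) (simp_all add: trunc0_def trunc_zero trunc_Suc weight_nth distrib_left flip: mult.assoc)
qed

lemma trunc1_Suc:
  assumes "N > 0"
  shows "trunc1 (Suc N) = trunc1 N * (1 + fps_const (1 / real N ^ 2) * fps_X) +
     trunc0 N * (fps_const (2 / real N ^ 3) * fps_X)"
proof (rule fps_ext)
  fix j
  show "trunc1 (Suc N) $ j = (trunc1 N * (1 + fps_const (1 / real N ^ 2) * fps_X) +
     trunc0 N * (fps_const (2 / real N ^ 3) * fps_X)) $ j"
    using assms
    by (cases j) (simp_all add: trunc0_def trunc1_def trunc_zero trunc_Suc weight_nth distrib_left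
        fps_mult_nth_1 flip: mult.assoc)
qed

definition log_deriv :: "nat \<Rightarrow> real fps" where
  "log_deriv N = (\<Sum>n\<in>{1..<N}. fps_const (2 / real n ^ 3) * fps_X *
     inverse (1 + fps_const (1 / real n ^ 2) * fps_X))"

text \<open>The generating series of the truncated sums is \<open>\<Prod> (1 + s/(n - t)\<^sup>2)\<close>; its derivative in \<open>t\<close> at
  \<open>0\<close> is a logarithmic derivative.\<close>

lemma trunc1_eq: "trunc1 (Suc N) = trunc0 (Suc N) * log_deriv (Suc N)"
proof (induction N)
  case 0
  have "trunc1 (Suc 0) = 0" by (rule fps_ext) (simp add: trunc1_def trunc_one)
  then show ?case by (simp add: log_deriv_def)
next
  case (Suc N)
  define u where "u = 1 + fps_const (1 / real (Suc N) ^ 2) * fps_X"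
  have u: "u * inverse u = 1" by (intro inverse_mult_eq_1') (simp add: u_def)
  have "log_deriv (Suc (Suc N)) = log_deriv (Suc N) + fps_const (2 / real (Suc N) ^ 3) * fps_X * inverse u"
    by (simp add: log_deriv_def u_def)
  then have "trunc0 (Suc (Suc N)) * log_deriv (Suc (Suc N)) =
      trunc0 (Suc N) * log_deriv (Suc N) * u +
      trunc0 (Suc N) * (fps_const (2 / real (Suc N) ^ 3) * fps_X) * (u * inverse u)"
    unfolding trunc0_Suc[OF zero_less_Suc] u_def[symmetric] by (simp add: algebra_simps)
  also have "\<dots> = trunc1 (Suc (Suc N))"
    unfolding u unfolding Suc[symmetric] trunc1_Suc[OF zero_less_Suc] u_def by simp
  finally show ?case by simp
qed

lemma log_deriv_nth:
  "log_deriv N $ k = (if k = 0 then 0 else 2 * (- 1) ^ (k - 1) * (\<Sum>n\<in>{1..<N}. 1 / real n ^ (2 * k + 1)))"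
proof -
  have "inverse (1 + fps_const c * fps_X) = Abs_fps (\<lambda>k. (- c) ^ k)" for c :: real
  proof -
    have e: "1 - fps_const (- c) * fps_X = 1 + fps_const c * fps_X"
      by (simp del: fps_const_neg flip: fps_const_neg)
    show ?thesis using one_minus_const_fps_X_neg_power'[of 1 "- c"] unfolding e by simp
  qed
  then have "(fps_const (2 / real n ^ 3) * fps_X * inverse (1 + fps_const (1 / real n ^ 2) * fps_X)) $ k =
      (if k = 0 then 0 else 2 * (- 1) ^ (k - 1) * (1 / real n ^ (2 * k + 1)))" for n
  proof (cases k)
    case (Suc i)
    have "(- (1 / real n ^ 2)) ^ i = (- 1) ^ i * (1 / real n ^ (2 * i))"
      by (simp add: power_minus[of "1 / _"] power_one_over flip: power_mult)
    moreover have "real n ^ (2 * Suc i + 1) = real n ^ 3 * real n ^ (2 * i)"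
      by (simp add: power3_eq_cube mult_ac)
    ultimately show ?thesis
      using \<open>\<And>c. inverse (1 + fps_const c * fps_X) = Abs_fps (\<lambda>k. (- c) ^ k)\<close>
      by (simp only: Suc mult.assoc) simp
  qed (simp add: mult.assoc)
  then show ?thesis by (simp add: log_deriv_def fps_sum_nth sum_distrib_left)
qed

lemma log_deriv_tendsto: "(\<lambda>N. log_deriv N $ k) \<longlonglongrightarrow> odd_zeta_series $ k"
proof (cases "k = 0")
  case True
  then show ?thesis by (simp add: log_deriv_nth odd_zeta_series_def riemann_zeta_def)
next
  case False
  have "summable (\<lambda>n. inverse (real n ^ (2 * k + 1)))"
    using False by (intro inverse_power_summable) simp
  then have "summable (\<lambda>n. 1 / real (Suc n) ^ (2 * k + 1))"
    by (subst (asm) summable_Suc_iff[symmetric]) (simp only: inverse_eq_divide)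
  from summable_LIMSEQ[OF this]
  have "(\<lambda>N. \<Sum>n<N. 1 / real (Suc n) ^ (2 * k + 1)) \<longlonglongrightarrow> riemann_zeta (2 * k + 1)"
    using False by (simp add: riemann_zeta_def)
  moreover have "(\<Sum>n<N. 1 / real (Suc n) ^ (2 * k + 1)) = (\<Sum>n\<in>{1..<Suc N}. 1 / real n ^ (2 * k + 1))" for N
    by (simp only: One_nat_def sum.shift_bounds_Suc_ivl atLeast0LessThan)
  ultimately have "(\<lambda>N. \<Sum>n\<in>{1..<Suc N}. 1 / real n ^ (2 * k + 1)) \<longlonglongrightarrow> riemann_zeta (2 * k + 1)"
    by simp
  then have "(\<lambda>N. \<Sum>n\<in>{1..<N}. 1 / real n ^ (2 * k + 1)) \<longlonglongrightarrow> riemann_zeta (2 * k + 1)"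
    by (subst (asm) filterlim_sequentially_Suc)
  then have "(\<lambda>N. 2 * (- 1) ^ (k - 1) * (\<Sum>n\<in>{1..<N}. 1 / real n ^ (2 * k + 1))) \<longlonglongrightarrow>
      2 * (- 1) ^ (k - 1) * riemann_zeta (2 * k + 1)"
    by (intro tendsto_mult tendsto_const)
  moreover have "2 * (- 1) ^ (k - 1) * riemann_zeta (2 * k + 1) = odd_zeta_series $ k"
    using False by (cases k) (simp_all add: odd_zeta_series_def)
  ultimately show ?thesis using False by (simp only: log_deriv_nth if_False)
qed

lemma harm_sum_tendsto: "admissible ks \<Longrightarrow> harm_sum ks \<longlonglongrightarrow> mzv ks"
proof (cases "ks = []")
  case True
  show ?thesis
    by (rule tendsto_eventually) (auto simp: True harm_sum_Nil eventually_at_top_linorder intro!: exI[of _ 1])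
next
  case False
  assume "admissible ks"
  then obtain C where "\<And>N. N > 0 \<Longrightarrow> \<bar>harm_sum ks N - mzv ks\<bar> \<le> C * real N powr (- (1/4))"
    using admissible_rates False by metis
  then have "negligible_wrt sequentially (harm_sum [1]) (\<lambda>N. harm_sum ks N - mzv ks)"
    by (intro negligible_powr[of "1/4" _ C]) auto
  from negligible_wrt_tendsto[OF this] show ?thesis by (simp add: LIM_zero_iff)
qed

lemma trunc0_tendsto: "(\<lambda>N. trunc0 N $ j) \<longlonglongrightarrow> zeta_twos $ j"
  using harm_sum_tendsto[OF admissible_rep_2, of j]
  by (simp add: trunc0_def trunc_def zeta_twos_def harm_sum_def[abs_def] index_word_rep_2 fps_sum_nth)

lemma trunc1_tendsto: "(\<lambda>N. trunc1 N $ j) \<longlonglongrightarrow> zeta_twos_shift $ j"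
proof -
  let ?ks = "rep [2] j"
  have "trunc1 N $ j = (\<Sum>ls\<in>weak_comps (length ?ks) 1. shift_binom ?ks ls * harm_sum (map2 (+) ?ks ls) N)" for N
  proof -
    have "trunc1 N $ j = (\<Sum>n<N. word_coeff (index_word ?ks) n $ 1)"
      by (simp add: trunc1_def trunc_def index_word_rep_2 fps_sum_nth)
    also have "\<dots> = (\<Sum>n<N. \<Sum>ls\<in>weak_comps (length ?ks) 1. shift_binom ?ks ls *
        word_coeff (index_word (map2 (+) ?ks ls)) n $ 0)"
      by (intro sum.cong refl word_coeff_shift indices_rep) simp
    also have "\<dots> = (\<Sum>ls\<in>weak_comps (length ?ks) 1. shift_binom ?ks ls * harm_sum (map2 (+) ?ks ls) N)"
      unfolding harm_sum_def sum_distrib_left by (rule sum.swap)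
    finally show ?thesis .
  qed
  moreover have "(\<lambda>N. \<Sum>ls\<in>weak_comps (length ?ks) 1. shift_binom ?ks ls * harm_sum (map2 (+) ?ks ls) N) \<longlonglongrightarrow>
      (\<Sum>ls\<in>weak_comps (length ?ks) 1. shift_binom ?ks ls * mzv (map2 (+) ?ks ls))"
    by (intro tendsto_sum tendsto_mult tendsto_const harm_sum_tendsto admissible_map2_plus admissible_rep_2)
       (simp add: weak_comps_def)
  moreover have "(\<Sum>ls\<in>weak_comps (length ?ks) 1. shift_binom ?ks ls * mzv (map2 (+) ?ks ls)) = zeta_twos_shift $ j"
    unfolding zeta_twos_shift_def zeta_reg_shift_eq fps_nth_Abs_fps
    by (intro sum.cong refl, subst zeta_reg_admissible)
       (auto simp: weak_comps_def intro: admissible_map2_plus admissible_rep_2)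
  ultimately show ?thesis by simp
qed

text \<open>The identity \<open>trunc1_eq\<close> for truncated products passes to the limit, since
  each coefficient of a product of series is a finite sum of products of convergent
  coefficients.\<close>

lemma zeta_twos_shift_eq: "zeta_twos_shift = zeta_twos * odd_zeta_series"
proof (rule fps_ext)
  fix j
  have "(\<lambda>N. \<Sum>i=0..j. trunc0 (Suc N) $ i * log_deriv (Suc N) $ (j - i)) \<longlonglongrightarrow>
      (\<Sum>i=0..j. zeta_twos $ i * odd_zeta_series $ (j - i))"
    by (intro tendsto_sum tendsto_mult LIMSEQ_Suc trunc0_tendsto log_deriv_tendsto)
  moreover have "(\<Sum>i=0..j. trunc0 (Suc N) $ i * log_deriv (Suc N) $ (j - i)) = trunc1 (Suc N) $ j" for N
    by (simp add: trunc1_eq fps_mult_nth)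
  ultimately have "(\<lambda>N. trunc1 (Suc N) $ j) \<longlonglongrightarrow> (zeta_twos * odd_zeta_series) $ j"
    by (simp add: fps_mult_nth)
  with LIMSEQ_Suc[OF trunc1_tendsto[of j]] show "zeta_twos_shift $ j = (zeta_twos * odd_zeta_series) $ j"
    by (rule LIMSEQ_unique)
qed

section \<open>The values at {2}^j from Euler's sine product\<close>

definition trunc_poly :: "nat \<Rightarrow> real poly" where
  "trunc_poly N = (\<Prod>n\<in>{1..N}. [:1, 1 / real n ^ 2:])"

lemma coeff_trunc_poly: "coeff (trunc_poly N) j = trunc0 (Suc N) $ j"
proof (induction N arbitrary: j)
  case 0
  show ?case by (cases j) (simp_all add: trunc_poly_def trunc0_def trunc_one)
next
  case (Suc N)
  have "trunc_poly (Suc N) = trunc_poly N * [:1, 1 / real (Suc N) ^ 2:]"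
    by (simp add: trunc_poly_def mult.commute)
  then show ?case
    unfolding trunc0_Suc[of "Suc N", simplified]
    by (cases j) (simp_all add: Suc distrib_left flip: mult.assoc)
qed

lemma poly_trunc_poly: "poly (trunc_poly N) x = (\<Prod>n\<in>{1..N}. 1 + x / real n ^ 2)"
  by (simp add: trunc_poly_def poly_prod)

lemma trunc0_nonneg: "0 \<le> trunc0 N $ j"
proof -
  have "word_pow [Y, X] j \<in> index_words" by (cases j) (simp_all add: word_pow_Suc' index_words_Cons)
  then show ?thesis by (simp add: trunc0_def trunc_def fps_sum_nth sum_nonneg word_coeff_nonneg)
qed

text \<open>The coefficients are nonnegative, so each is at most the value at s = 1, a product of 1
  + 1/n^2 bounded by the exponential of the sum of inverse squares. Uniformity in \<open>N\<close>
  provides the majorant for Tannery's theorem.\<close>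

lemma trunc0_bounded: "\<exists>K. \<forall>N j. trunc0 (Suc N) $ j \<le> K"
proof -
  have sm: "summable (\<lambda>n. 1 / real (Suc n) ^ 2)"
    using inverse_squares_sums by (simp add: sums_iff)
  have "trunc0 (Suc N) $ j \<le> exp (suminf (\<lambda>n. 1 / real (Suc n) ^ 2))" for N j
  proof -
    let ?p = "trunc_poly N"
    have "coeff ?p j \<le> poly ?p 1"
    proof (cases "j \<le> degree ?p")
      case True
      have "coeff ?p j \<le> (\<Sum>i\<le>degree ?p. coeff ?p i)"
        using True trunc0_nonneg by (intro member_le_sum) (auto simp: coeff_trunc_poly)
      then show ?thesis by (simp add: poly_altdef)
    next
      case False
      then show ?thesis by (simp add: coeff_eq_0 poly_trunc_poly prod_nonneg)
    qed
    also have "poly ?p 1 \<le> (\<Prod>n\<in>{1..N}. exp (1 / real n ^ 2))"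
      unfolding poly_trunc_poly by (intro prod_mono) (auto intro: exp_ge_add_one_self)
    also have "\<dots> = exp (\<Sum>n<N. 1 / real (Suc n) ^ 2)"
      by (simp add: exp_sum sum.atLeast1_atMost_eq prod.atLeast1_atMost_eq)
    also have "\<dots> \<le> exp (suminf (\<lambda>n. 1 / real (Suc n) ^ 2))"
      using sm by (simp add: sum_le_suminf)
    finally show ?thesis by (simp add: coeff_trunc_poly)
  qed
  then show ?thesis by blast
qed

text \<open>The real sine product yields information at x = -y^2 only, hence the one-sided interval.
  After division by x^j the coefficient of index \<open>j\<close> is the left limit of the series at
  0.\<close>

lemma powser_zero_on_interval_imp_zero:
  fixes d :: "nat \<Rightarrow> real"
  assumes "\<And>x. - 1 < x \<Longrightarrow> x < 0 \<Longrightarrow> (\<lambda>n. d n * x ^ n) sums 0"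
  shows "d j = 0"
proof (induction j rule: less_induct)
  case (less j)
  have sums: "(\<lambda>n. d (n + j) * x ^ n) sums 0" if x: "- 1 < x" "x < 0" for x
  proof -
    have "(\<lambda>n. d (n + j) * x ^ (n + j)) sums (0 - (\<Sum>i<j. d i * x ^ i))"
      using sums_split_initial_segment[OF assms[OF x], of j] by simp
    then have "(\<lambda>n. x ^ j * (d (n + j) * x ^ n)) sums (x ^ j * 0)"
      using less by (simp add: power_add mult_ac)
    then show ?thesis using x by (subst (asm) sums_mult_iff) auto
  qed
  have "summable (\<lambda>n. d (n + j) * x ^ n)" if "\<bar>x\<bar> < 1 / 2" for x
  proof (rule powser_inside[of "\<lambda>n. d (n + j)" "- 1 / 2" x])
    show "summable (\<lambda>n. d (n + j) * (- 1 / 2) ^ n)" using sums[of "- 1 / 2"] by (simp add: sums_iff)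
  qed (use that in simp)
  then have "(\<lambda>n. d (n + j) * x ^ n) sums suminf (\<lambda>n. d (n + j) * x ^ n)" if "norm x < 1 / 2" for x
    using that by (simp add: summable_sums)
  from powser_limit_0[of "1 / 2", OF _ this] have "((\<lambda>x. suminf (\<lambda>n. d (n + j) * x ^ n)) \<longlongrightarrow> d j) (at 0)" by simp
  then have "((\<lambda>x. suminf (\<lambda>n. d (n + j) * x ^ n)) \<longlongrightarrow> d j) (at_left 0)"
    by (rule tendsto_within_subset) simp
  moreover have "\<forall>\<^sub>F x in at_left (0::real). suminf (\<lambda>n. d (n + j) * x ^ n) = 0"
    using eventually_at_left_real[of "- 1" 0, simplified]
    by eventually_elim (use sums sums_unique in fastforce)
  then have "((\<lambda>x. suminf (\<lambda>n. d (n + j) * x ^ n)) \<longlongrightarrow> 0) (at_left 0)"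
    by (rule tendsto_eventually)
  ultimately show "d j = 0" by (intro tendsto_unique[of "at_left (0::real)"]) auto
qed

lemma zeta_twos_nth: "zeta_twos $ j = pi ^ (2 * j) / fact (2 * j + 1)"
proof -
  obtain K where K: "\<And>N j. trunc0 (Suc N) $ j \<le> K" using trunc0_bounded by blast
  have "(\<lambda>n. (zeta_twos $ n - pi ^ (2 * n) / fact (2 * n + 1)) * x ^ n) sums 0"
    if x: "- 1 < x" "x < 0" for x
  proof -
    define y where "y = sqrt (- x)"
    have y: "y > 0" "x = - (y ^ 2)" using x by (simp_all add: y_def)
    have lim: "(\<lambda>N. trunc0 (Suc N) $ k * x ^ k) \<longlonglongrightarrow> zeta_twos $ k * x ^ k" for k
      by (intro tendsto_mult tendsto_const LIMSEQ_Suc trunc0_tendsto)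
    have bound: "eventually (\<lambda>(k, N). norm (trunc0 (Suc N) $ k * x ^ k) \<le> K * \<bar>x\<bar> ^ k)
        (at_top \<times>\<^sub>F sequentially)"
      using K trunc0_nonneg by (intro always_eventually) (auto simp: abs_mult power_abs mult_right_mono)
    have sm: "summable (\<lambda>k. K * \<bar>x\<bar> ^ k)" using x by (intro summable_mult summable_geometric) simp
    have T: "summable (\<lambda>k. norm (zeta_twos $ k * x ^ k))"
      "(\<lambda>N. suminf (\<lambda>k. trunc0 (Suc N) $ k * x ^ k)) \<longlonglongrightarrow> suminf (\<lambda>k. zeta_twos $ k * x ^ k)"
      using tannerys_theorem[OF lim bound sm] by simp_all
    have "suminf (\<lambda>k. trunc0 (Suc N) $ k * x ^ k) = (\<Prod>k=1..N. 1 - y ^ 2 / of_nat k ^ 2)" for N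
    proof -
      have "suminf (\<lambda>k. coeff (trunc_poly N) k * x ^ k) = (\<Sum>k\<le>degree (trunc_poly N). coeff (trunc_poly N) k * x ^ k)"
        by (rule suminf_finite) (auto simp: coeff_eq_0)
      also have "\<dots> = (\<Prod>k=1..N. 1 - y ^ 2 / of_nat k ^ 2)"
        by (simp add: poly_trunc_poly y(2) flip: poly_altdef)
      finally show ?thesis by (simp add: coeff_trunc_poly)
    qed
    with T(2) have "(\<lambda>N. \<Prod>k=1..N. 1 - y ^ 2 / of_nat k ^ 2) \<longlonglongrightarrow> suminf (\<lambda>k. zeta_twos $ k * x ^ k)"
      by simp
    moreover have "y \<noteq> 0" using y(1) by simp
    ultimately have eq: "suminf (\<lambda>k. zeta_twos $ k * x ^ k) = sin (pi * y) / (pi * y)"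
      using sin_product_formula_real'[of y] by (metis LIMSEQ_unique)
    have 1: "(\<lambda>k. zeta_twos $ k * x ^ k) sums (sin (pi * y) / (pi * y))"
      unfolding eq[symmetric] by (intro summable_sums summable_norm_cancel[OF T(1)])
    have "(\<lambda>n. ((- 1) ^ n / fact (2 * n + 1) * (pi * y) ^ (2 * n + 1)) / (pi * y)) sums (sin (pi * y) / (pi * y))"
      by (intro sums_divide sin_paired)
    moreover have "((- 1) ^ n / fact (2 * n + 1) * (pi * y) ^ (2 * n + 1)) / (pi * y) =
        pi ^ (2 * n) / fact (2 * n + 1) * x ^ n" for n
    proof -
      have "x ^ n = (- 1) ^ n * y ^ (2 * n)" by (simp add: y(2) power_minus[of "y ^ 2"] flip: power_mult)
      then show ?thesis using y(1) by (simp add: power_mult_distrib)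
    qed
    ultimately have 2: "(\<lambda>n. pi ^ (2 * n) / fact (2 * n + 1) * x ^ n) sums (sin (pi * y) / (pi * y))"
      by simp
    from sums_diff[OF 1 2] show ?thesis by (simp add: left_diff_distrib)
  qed
  from powser_zero_on_interval_imp_zero[OF this, of j] show ?thesis by simp
qed

text \<open>This is the square of sinh(pi sqrt s)/(pi sqrt s), that is (cosh(2 pi sqrt s) - 1)/(2
  pi^2 s). On coefficients it amounts to the sum of the binomial coefficients with odd lower
  entry.\<close>

lemma zeta_twos_square_nth:
  "(zeta_twos * zeta_twos) $ k = 2 ^ (2 * k + 1) * pi ^ (2 * k) / fact (2 * k + 2)"
proof -
  have odd: "(\<Sum>i\<le>2 * k + 1. f i) = (\<Sum>j\<le>k. f (2 * j)) + (\<Sum>j\<le>k. f (2 * j + 1))" for f :: "nat \<Rightarrow> real"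
    by (induction k) (simp_all add: ac_simps)
  have "2 * (\<Sum>i\<le>2 * k + 2. if odd i then real ((2 * k + 2) choose i) else 0) = 2 ^ (2 * k + 2)"
    by (rule choose_odd_sum) simp
  then have "(\<Sum>i\<le>2 * k + 2. if odd i then real ((2 * k + 2) choose i) else 0) = 2 ^ (2 * k + 1)"
    by simp
  moreover have "(\<Sum>i\<le>2 * k + 2. if odd i then real ((2 * k + 2) choose i) else 0) =
      (\<Sum>i\<le>2 * k + 1. if odd i then real ((2 * k + 2) choose i) else 0)"
    using sum.atMost_Suc[of "\<lambda>i. if odd i then real ((2 * k + 2) choose i) else 0" "2 * k + 1"] by simp
  ultimately have choose: "(\<Sum>j\<le>k. real ((2 * k + 2) choose (2 * j + 1))) = 2 ^ (2 * k + 1)"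
    unfolding odd by simp
  have "(zeta_twos * zeta_twos) $ k = (\<Sum>j\<le>k. zeta_twos $ j * zeta_twos $ (k - j))"
    by (simp add: fps_mult_nth atLeast0AtMost)
  also have "\<dots> = (\<Sum>j\<le>k. pi ^ (2 * k) / fact (2 * k + 2) * real ((2 * k + 2) choose (2 * j + 1)))"
  proof (rule sum.cong[OF refl])
    fix j assume j: "j \<in> {..k}"
    have "real ((2 * k + 2) choose (2 * j + 1)) = fact (2 * k + 2) / (fact (2 * j + 1) * fact (2 * (k - j) + 1))"
    proof -
      have "2 * k + 2 - (2 * j + 1) = 2 * (k - j) + 1" using j by auto
      then show ?thesis using j binomial_fact[of "2 * j + 1" "2 * k + 2", where 'a = real] by simp
    qed
    moreover have "pi ^ (2 * k) = pi ^ (2 * j) * pi ^ (2 * (k - j))"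
    proof -
      have "2 * k = 2 * j + 2 * (k - j)" using j by auto
      then show ?thesis by (metis power_add)
    qed
    ultimately show "zeta_twos $ j * zeta_twos $ (k - j) =
        pi ^ (2 * k) / fact (2 * k + 2) * real ((2 * k + 2) choose (2 * j + 1))"
      unfolding zeta_twos_nth by (simp del: fact_Suc add: mult_ac)
  qed
  also have "\<dots> = 2 ^ (2 * k + 1) * pi ^ (2 * k) / fact (2 * k + 2)"
    unfolding sum_distrib_left[symmetric] choose by (simp add: mult_ac)
  finally show ?thesis .
qed


section \<open>The theorem\<close>

lemma has_reg_fps_mult:
  assumes "\<And>n. has_reg F L (\<lambda>z. A z $ n) (a $ n)" "\<And>n. has_reg F L (\<lambda>z. B z $ n) (b $ n)"
  shows "has_reg F L (\<lambda>z. (A z * B z) $ n) ((a * b) $ n)"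
  unfolding fps_mult_nth by (intro has_reg_sum has_reg_mult assms)

lemma has_reg_alt_p: "has_reg (at_left 1) (iter_int [Y]) (\<lambda>z. alt_p z $ j) (zeta_twos $ j)"
  using has_reg_iter_int_admissible[OF admissible_rep_2, of j]
  by (simp add: alt_p_def zeta_twos_def index_word_rep_2)

text \<open>One leading \<open>X\<close> before the word of {2}^i is the case m = 1 of
  \<open>has_reg_iter_int_X\<close>; this explains the minus sign and the first order shift.\<close>

lemma has_reg_alt_q: "has_reg (at_left 1) (iter_int [Y]) (\<lambda>z. alt_q z $ j) ((fps_X * - zeta_twos_shift) $ j)"
proof (cases j)
  case (Suc i)
  show ?thesis
    using has_reg_iter_int_X[of "rep [2] i" 1] indices_rep[of "[2]" i]
    by (simp add: Suc alt_q_def zeta_twos_shift_def index_word_rep_2)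
qed (simp add: alt_q_def has_reg_const)

lemma has_reg_value:
  assumes "has_reg (at_left 1) (iter_int [Y]) f a" "has_reg (at_left 1) (iter_int [Y]) g b"
    and "\<And>z. 0 < z \<Longrightarrow> z < 1 \<Longrightarrow> f z = g z"
  shows "a = b"
proof -
  have "\<forall>\<^sub>F z in at_left 1. f z = g z"
    using eventually_at_left_one by eventually_elim (use assms(3) in auto)
  from assms(1)[unfolded has_reg_cong[OF this]] assms(2) show ?thesis
    by (rule has_reg_unique'[rotated 2]) (simp_all add: iter_int_Y_at_top)
qed

text \<open>Write A for \<open>zeta_twos\<close> and B for \<open>odd_zeta_series\<close>: p
  regularizes to A and q to -s A B. The three coefficients become A^2, A^2 B and A^2 B^2 / 2; the
  minus sign in the second part of \<open>loop_int_31_eq\<close> cancels that of q.\<close>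

lemma zeta_S_hat_31:
  "(- 4) ^ n * zeta_S_hat Shuffle (rep [3, 1] n) $ 0 = (zeta_twos * zeta_twos) $ (2 * n)"
  "(- 4) ^ n * zeta_S_hat Shuffle (rep [3, 1] n) $ 1 = (zeta_twos * zeta_twos * odd_zeta_series) $ (2 * n)"
  "2 * (- 4) ^ n * zeta_S_hat Shuffle (rep [3, 1] n) $ 2 =
     (zeta_twos * zeta_twos * (odd_zeta_series * odd_zeta_series)) $ (2 * n)"
proof -
  have loop: "has_reg (at_left 1) (iter_int [Y]) (\<lambda>z. c * loop_int m (rep [3, 1] n) z)
      (c * zeta_S_hat Shuffle (rep [3, 1] n) $ m)" for c m
    by (intro has_reg_cmult has_reg_loop_int indices_rep) (simp add: indices_def)
  show "(- 4) ^ n * zeta_S_hat Shuffle (rep [3, 1] n) $ 0 = (zeta_twos * zeta_twos) $ (2 * n)"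
    by (rule has_reg_value[OF loop has_reg_fps_mult[OF has_reg_alt_p has_reg_alt_p] loop_int_31_eq(1)])
  have "has_reg (at_left 1) (iter_int [Y]) (\<lambda>z. - (alt_q z * alt_p z) $ (2 * n + 1))
      (- (fps_X * - zeta_twos_shift * zeta_twos) $ (2 * n + 1))"
    using has_reg_cmult[OF has_reg_fps_mult[OF has_reg_alt_q has_reg_alt_p], of "- 1"] by simp
  from has_reg_value[OF loop this loop_int_31_eq(2)]
  have "(- 4) ^ n * zeta_S_hat Shuffle (rep [3, 1] n) $ 1 = - (fps_X * - zeta_twos_shift * zeta_twos) $ (2 * n + 1)" .
  also have "\<dots> = (zeta_twos * zeta_twos * odd_zeta_series) $ (2 * n)"
    by (simp add: zeta_twos_shift_eq mult_ac)
  finally show "(- 4) ^ n * zeta_S_hat Shuffle (rep [3, 1] n) $ 1 =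
      (zeta_twos * zeta_twos * odd_zeta_series) $ (2 * n)" .
  from has_reg_value[OF loop has_reg_fps_mult[OF has_reg_alt_q has_reg_alt_q] loop_int_31_eq(3)]
  have "2 * (- 4) ^ n * zeta_S_hat Shuffle (rep [3, 1] n) $ 2 =
      (fps_X * - zeta_twos_shift * (fps_X * - zeta_twos_shift)) $ (2 * n + 2)" .
  also have "fps_X * - zeta_twos_shift * (fps_X * - zeta_twos_shift) =
      fps_X ^ 2 * (zeta_twos * zeta_twos * (odd_zeta_series * odd_zeta_series))"
    by (simp add: zeta_twos_shift_eq power2_eq_square mult_ac)
  finally show "2 * (- 4) ^ n * zeta_S_hat Shuffle (rep [3, 1] n) $ 2 =
      (zeta_twos * zeta_twos * (odd_zeta_series * odd_zeta_series)) $ (2 * n)"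
    by (simp add: fps_X_power_mult_nth)
qed

lemma nearly_admissible_31:
  "nearly_admissible (rep [3, 1] j)" "nearly_admissible (rep [3, 1] j @ [3])"
  "nearly_admissible (rep [1, 3] j)" "nearly_admissible (rep [1, 3] j @ [1])"
proof -
  have idx: "rep [3, 1] j \<in> indices" "rep [1, 3] j \<in> indices" for j
    by (rule indices_rep; simp add: indices_def)+
  show "nearly_admissible (rep [3, 1] j)"
    using idx by (cases j) (auto simp: nearly_admissible_def admissible_def rep_Suc' butlast_append indices_def)
  show "nearly_admissible (rep [3, 1] j @ [3])"
    using idx by (simp add: nearly_admissible_def admissible_def)
  have adm: "admissible (rep [1, 3] j)"
    using idx by (cases j) (auto simp: admissible_def rep_Suc' indices_def)
  then show "nearly_admissible (rep [1, 3] j)" "nearly_admissible (rep [1, 3] j @ [1])"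
    by (auto simp: nearly_admissible_def admissible_def)
qed

lemma zeta_S_hat_31_reg: "zeta_S_hat b (rep [3, 1] n) = zeta_S_hat Shuffle (rep [3, 1] n)"
proof (rule zeta_S_hat_nearly_admissible)
  fix i
  have "nearly_admissible (take i (rep [3, 1] n)) \<and> nearly_admissible (rev (drop i (rep [3, 1] n)))"
  proof (cases "i \<le> 2 * n")
    case True
    show ?thesis
    proof (cases "even i")
      case True
      then obtain j where "i = 2 * j" by blast
      with \<open>i \<le> 2 * n\<close> show ?thesis
        using splits_even[of j n] nearly_admissible_31 by (simp add: rev_rep)
    next
      case False
      then obtain j where "i = 2 * j + 1" by (blast elim: oddE)
      with \<open>i \<le> 2 * n\<close> show ?thesis
        using splits_odd[of j n] nearly_admissible_31 by (simp add: rev_rep)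
    qed
  next
    case False
    then show ?thesis using nearly_admissible_31(1)[of n] nearly_admissible_31(1)[of 0] by simp
  qed
  then show "nearly_admissible (take i (rep [3, 1] n))" "nearly_admissible (rev (drop i (rep [3, 1] n)))"
    by blast+
qed

section \<open>Reindexing the sums and collecting the constants\<close>

lemma sum_pairs: "(\<Sum>(i, j)\<in>{(i, j). i + j = N}. f i j) = (\<Sum>i\<le>N. f i (N - i))"
  for f :: "nat \<Rightarrow> nat \<Rightarrow> real"
proof -
  have "{(i, j). i + j = N} = (\<lambda>i. (i, N - i)) ` {..N}" by (auto simp: image_iff)
  moreover have "inj_on (\<lambda>i. (i, N - i)) {..N}" by (simp add: inj_on_def)
  ultimately show ?thesis by (simp add: sum.reindex)
qed

lemma sum_triples:
  "(\<Sum>(i, j, k)\<in>{(i, j, k). i + j + k = N}. f i j k) = (\<Sum>i\<le>N. \<Sum>j\<le>N - i. f i j (N - i - j))"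
  for f :: "nat \<Rightarrow> nat \<Rightarrow> nat \<Rightarrow> real"
proof -
  let ?g = "\<lambda>(i, j). (i, j, N - i - j)"
  have "{(i, j, k). i + j + k = N} = ?g ` (SIGMA i:{..N}. {..N - i})"
    by (auto simp: image_iff)
  moreover have "inj_on ?g (SIGMA i:{..N}. {..N - i})" by (auto simp: inj_on_def)
  ultimately have "(\<Sum>(i, j, k)\<in>{(i, j, k). i + j + k = N}. f i j k) =
      (\<Sum>(i, j)\<in>(SIGMA i:{..N}. {..N - i}). f i j (N - i - j))"
    by (simp add: sum.reindex case_prod_unfold)
  also have "\<dots> = (\<Sum>i\<le>N. \<Sum>j\<le>N - i. f i j (N - i - j))"
    by (rule sum.Sigma[symmetric]) auto
  finally show ?thesis .
qed

text \<open>The exponent equals 2 n0 + 2 - 2n and may be negative. So the power of 2 in each summand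
  comes from the square of \<open>zeta_twos\<close>, up to a factor 4^n common to all
  summands.\<close>

lemma powi_two:
  assumes "n0 + k = 2 * n"
  shows "(2 :: real) powi (int n0 - int k + 2) = 2 ^ (2 * n0 + 2) / 4 ^ n"
proof -
  have "int n0 - int k + 2 = int (2 * n0 + 2) - int (2 * n)" using assms by simp
  also have "(2 :: real) powi \<dots> = 2 powi int (2 * n0 + 2) / 2 powi int (2 * n)"
    by (rule power_int_diff) simp
  also have "\<dots> = 2 ^ (2 * n0 + 2) / 4 ^ n"
    by (simp only: power_int_of_nat power_mult) simp
  finally show ?thesis .
qed

lemma minus_one_power_eq: "n0 + k = 2 * n \<Longrightarrow> (- 1 :: real) ^ k = (- 1) ^ n0"
  by (metis even_add even_mult_iff even_numeral neg_one_even_power neg_one_odd_power)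

lemma zeta_S_hat_31_0: "zeta_S_hat b (rep [3, 1] n) $ 0 = 2 * (-4) ^ n / fact (4 * n + 2) * pi ^ (4 * n)"
proof -
  have "(- 4) ^ n * zeta_S_hat b (rep [3, 1] n) $ 0 = 2 ^ (4 * n + 1) * pi ^ (4 * n) / fact (4 * n + 2)"
    using zeta_S_hat_31(1)[of n] unfolding zeta_S_hat_31_reg[of b] zeta_twos_square_nth by (simp add: mult.assoc[symmetric])
  moreover have "(2 :: real) ^ (4 * n + 1) = (- 4) ^ n * (2 * (- 4) ^ n)"
    by (simp add: power_mult flip: power_mult_distrib)
  ultimately have "(- 4) ^ n * zeta_S_hat b (rep [3, 1] n) $ 0 =
      (- 4) ^ n * (2 * (-4) ^ n / fact (4 * n + 2) * pi ^ (4 * n))"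
    by (simp only: mult_ac times_divide_eq_right times_divide_eq_left)
  then show ?thesis by (subst (asm) mult_cancel_left) simp
qed

lemma zeta_S_hat_31_1:
  "zeta_S_hat b (rep [3, 1] n) $ 1 = (-1) ^ (n + 1) *
     (\<Sum>(n0, n1) \<in> {(n0, n1). n0 + n1 = 2 * n}.
       (-1) ^ n0 * 2 powi (int n0 - int n1 + 2) / fact (2 * n0 + 2) * pi ^ (2 * n0) * riemann_zeta (2 * n1 + 1))"
proof -
  define g where "g n0 n1 = (-1) ^ n0 * 2 powi (int n0 - int n1 + 2) / fact (2 * n0 + 2) * pi ^ (2 * n0) *
     riemann_zeta (2 * n1 + 1)" for n0 n1 :: nat
  have "(- 4) ^ n * zeta_S_hat b (rep [3, 1] n) $ 1 =
      (\<Sum>i\<le>2 * n. (zeta_twos * zeta_twos) $ i * odd_zeta_series $ (2 * n - i))"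
    unfolding zeta_S_hat_31_reg[of b] zeta_S_hat_31(2) by (simp add: fps_mult_nth[of "zeta_twos * zeta_twos"] atLeast0AtMost)
  also have "\<dots> = (\<Sum>i\<le>2 * n. (- 4) ^ n * ((- 1) ^ (n + 1) * g i (2 * n - i)))"
  proof (rule sum.cong[OF refl])
    fix i assume "i \<in> {..2 * n}"
    then have i: "i + (2 * n - i) = 2 * n" by simp
    have "(- 4 :: real) ^ n = (- 1) ^ n * 4 ^ n" by (simp flip: power_mult_distrib)
    moreover define F :: real where "F = fact (2 * i + 2)"
    moreover have "F \<noteq> 0" by (simp add: F_def del: fact_Suc)
    ultimately show "(zeta_twos * zeta_twos) $ i * odd_zeta_series $ (2 * n - i) =
        (- 4) ^ n * ((- 1) ^ (n + 1) * g i (2 * n - i))"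
      unfolding g_def powi_two[OF i] zeta_twos_square_nth odd_zeta_series_def fps_nth_Abs_fps
        minus_one_power_eq[OF i] F_def[symmetric]
      by (simp add: field_simps flip: power_add)
  qed
  also have "\<dots> = (- 4) ^ n * ((- 1) ^ (n + 1) * (\<Sum>(n0, n1) \<in> {(n0, n1). n0 + n1 = 2 * n}. g n0 n1))"
    unfolding sum_pairs by (simp only: sum_distrib_left)
  finally show ?thesis unfolding g_def by (subst (asm) mult_cancel_left) simp
qed

lemma zeta_S_hat_31_2:
  "zeta_S_hat b (rep [3, 1] n) $ 2 = (-1) ^ n *
     (\<Sum>(n0, n1, n2) \<in> {(n0, n1, n2). n0 + n1 + n2 = 2 * n}.
       (-1) ^ n0 * 2 powi (int n0 - int n1 - int n2 + 2) / fact (2 * n0 + 2)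
       * pi ^ (2 * n0) * riemann_zeta (2 * n1 + 1) * riemann_zeta (2 * n2 + 1))"
proof -
  define g where "g n0 n1 n2 = (-1) ^ n0 * 2 powi (int n0 - int n1 - int n2 + 2) / fact (2 * n0 + 2) * pi ^ (2 * n0) *
     riemann_zeta (2 * n1 + 1) * riemann_zeta (2 * n2 + 1)" for n0 n1 n2 :: nat
  have "2 * (- 4) ^ n * zeta_S_hat b (rep [3, 1] n) $ 2 =
      (\<Sum>i\<le>2 * n. \<Sum>j\<le>2 * n - i. (zeta_twos * zeta_twos) $ i * (odd_zeta_series $ j * odd_zeta_series $ (2 * n - i - j)))"
    unfolding zeta_S_hat_31_reg[of b] zeta_S_hat_31(3)
    by (simp add: fps_mult_nth[of "zeta_twos * zeta_twos"] fps_mult_nth[of odd_zeta_series] atLeast0AtMost sum_distrib_left)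
  also have "\<dots> = (\<Sum>i\<le>2 * n. \<Sum>j\<le>2 * n - i. 2 * (- 4) ^ n * ((- 1) ^ n * g i j (2 * n - i - j)))"
  proof (intro sum.cong refl)
    fix i j assume "i \<in> {..2 * n}" "j \<in> {..2 * n - i}"
    define k where "k = 2 * n - i - j"
    have i: "i + (j + k) = 2 * n" using \<open>i \<in> _\<close> \<open>j \<in> _\<close> by (simp add: k_def)
    have "int i - int j - int k = int i - int (j + k)" by simp
    then have powi: "(2 :: real) powi (int i - int j - int k + 2) = 2 ^ (2 * i + 2) / 4 ^ n"
      by (simp only: powi_two[OF i])
    have sign: "(- 1 :: real) ^ j * (- 1) ^ k = (- 1) ^ i"
      using minus_one_power_eq[OF i] by (simp add: power_add)
    have "(zeta_twos * zeta_twos) $ i * (odd_zeta_series $ j * odd_zeta_series $ k) =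
        2 ^ (2 * i + 1) * pi ^ (2 * i) / fact (2 * i + 2) * 4 * ((- 1) ^ j * (- 1) ^ k) *
          riemann_zeta (2 * j + 1) * riemann_zeta (2 * k + 1)"
      unfolding zeta_twos_square_nth odd_zeta_series_def fps_nth_Abs_fps by (simp add: mult_ac)
    also have "\<dots> = 2 * (- 4) ^ n * ((- 1) ^ n * g i j k)"
    proof -
      have "(- 4 :: real) ^ n = (- 1) ^ n * 4 ^ n" by (simp flip: power_mult_distrib)
      moreover define F :: real where "F = fact (2 * i + 2)"
      moreover have "F \<noteq> 0" by (simp add: F_def del: fact_Suc)
      ultimately show ?thesis
        unfolding g_def powi sign F_def[symmetric] by (simp add: field_simps flip: power_add)
    qed
    finally show "(zeta_twos * zeta_twos) $ i * (odd_zeta_series $ j * odd_zeta_series $ (2 * n - i - j)) =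
        2 * (- 4) ^ n * ((- 1) ^ n * g i j (2 * n - i - j))" by (simp only: k_def)
  qed
  also have "\<dots> = 2 * (- 4) ^ n * ((- 1) ^ n * (\<Sum>(n0, n1, n2) \<in> {(n0, n1, n2). n0 + n1 + n2 = 2 * n}. g n0 n1 n2))"
    unfolding sum_triples by (simp only: sum_distrib_left)
  finally show ?thesis unfolding g_def by simp
qed

text \<open>The ideal is generated inside the ring of series with coefficients in
  \<open>mzv_span\<close>. The tail \<open>fps_shift m f\<close> must therefore lie in that ring
  before it can be absorbed, which is where the first hypothesis enters.\<close>

lemma mod_t_eqI:
  assumes "\<And>n. f $ n \<in> mzv_span" "\<And>n. n < m \<Longrightarrow> f $ n = g $ n" "\<And>n. n \<ge> m \<Longrightarrow> g $ n = 0"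
  shows "mod_t m f = mod_t m g"
proof -
  have "f = g + fps_shift m f * fps_X ^ m"
    using assms by (intro fps_ext) (auto simp: fps_X_power_mult_right_nth)
  then have f: "f = fps_shift m f * fps_X ^ m + g" by (simp add: add.commute)
  define K where "K = {h :: real fps. \<forall>n. h $ n \<in> mzv_span}"
  have shift: "fps_shift m f \<in> K" using assms(1) by (simp add: K_def)
  have plus: "h + k \<in> K" if "h \<in> K" "k \<in> K" for h k
    using that mzv_span_add by (simp add: K_def)
  have minus: "h - k \<in> K" if "h \<in> K" "k \<in> K" for h k
    using that mzv_span_add[of "h $ n" "of_rat (- 1) * k $ n" for n] mzv_span_scale[of _ "- 1"]
    by (simp add: K_def of_rat_minus)
  have coset: "mod_t m f = {h * fps_X ^ m + f | h. h \<in> K}" for f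
    unfolding mod_t_def t_ideal_def cgenideal_def a_r_coset_def' mzv_fps_ring_def K_def by auto
  have "{h * fps_X ^ m + f | h. h \<in> K} = {h * fps_X ^ m + g | h. h \<in> K}"
  proof (intro equalityI subsetI)
    fix x assume "x \<in> {h * fps_X ^ m + f | h. h \<in> K}"
    then obtain h where h: "h \<in> K" "x = h * fps_X ^ m + f" by blast
    then have "x = (h + fps_shift m f) * fps_X ^ m + g" by (subst (asm) f) (simp add: algebra_simps)
    with plus[OF h(1) shift] show "x \<in> {h * fps_X ^ m + g | h. h \<in> K}" by blast
  next
    fix x assume "x \<in> {h * fps_X ^ m + g | h. h \<in> K}"
    then obtain h where h: "h \<in> K" "x = h * fps_X ^ m + g" by blast
    then have "x = (h - fps_shift m f) * fps_X ^ m + (fps_shift m f * fps_X ^ m + g)"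
      by (simp add: algebra_simps)
    then have "x = (h - fps_shift m f) * fps_X ^ m + f" unfolding f[symmetric] .
    with minus[OF h(1) shift] show "x \<in> {h * fps_X ^ m + f | h. h \<in> K}" by blast
  qed
  then show ?thesis by (simp add: coset)
qed

theorem theorem1p3:
  fixes b :: regularization and n :: nat
  shows "zeta_S b 3 (concat (replicate n [3, 1])) \<in> carrier (mzv_fps_ring Quot t_ideal 3) \<and>
    zeta_S b 3 (concat (replicate n [3, 1])) =
      mod_t 3
       (fps_const (2 * (-4) ^ n / fact (4 * n + 2) * pi ^ (4 * n))
      + fps_const ((-1) ^ (n + 1) *
          (\<Sum>(n0, n1) \<in> {(n0, n1). n0 + n1 = 2 * n}.
             (-1) ^ n0 * 2 powi (int n0 - int n1 + 2) / fact (2 * n0 + 2)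
             * pi ^ (2 * n0) * riemann_zeta (2 * n1 + 1))) * fps_X
      + fps_const ((-1) ^ n *
          (\<Sum>(n0, n1, n2) \<in> {(n0, n1, n2). n0 + n1 + n2 = 2 * n}.
             (-1) ^ n0 * 2 powi (int n0 - int n1 - int n2 + 2) / fact (2 * n0 + 2)
             * pi ^ (2 * n0) * riemann_zeta (2 * n1 + 1) * riemann_zeta (2 * n2 + 1))) * fps_X ^ 2)"
proof -
  have span: "zeta_S_hat b (rep [3, 1] n) $ m \<in> mzv_span" for m
    by (intro zeta_S_hat_in_span indices_rep) (simp add: indices_def)
  \<comment> \<open>The explicit constants are folded back into coefficients of
    \<open>zeta_S_hat\<close>, so that the claim becomes the truncation of this series modulo
    t^3.\<close>
  show ?thesis
    unfolding zeta_S_hat_31_0[of b n, symmetric] zeta_S_hat_31_1[of b n, symmetric]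
      zeta_S_hat_31_2[of b n, symmetric] rep_def[symmetric] zeta_S_def
  proof
    show "mod_t 3 (zeta_S_hat b (rep [3, 1] n)) \<in> carrier (mzv_fps_ring Quot t_ideal 3)"
      unfolding FactRing_def A_RCOSETS_def' mod_t_def using span by (auto simp: mzv_fps_ring_def)
    show "mod_t 3 (zeta_S_hat b (rep [3, 1] n)) =
      mod_t 3 (fps_const (zeta_S_hat b (rep [3, 1] n) $ 0) +
        fps_const (zeta_S_hat b (rep [3, 1] n) $ 1) * fps_X +
        fps_const (zeta_S_hat b (rep [3, 1] n) $ 2) * fps_X ^ 2)"
    proof (rule mod_t_eqI[OF span])
      fix k :: nat assume "k < 3"
      then consider "k = 0" | "k = 1" | "k = 2" by linarith
      then show "zeta_S_hat b (rep [3, 1] n) $ k =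
        (fps_const (zeta_S_hat b (rep [3, 1] n) $ 0) +
        fps_const (zeta_S_hat b (rep [3, 1] n) $ 1) * fps_X +
        fps_const (zeta_S_hat b (rep [3, 1] n) $ 2) * fps_X ^ 2) $ k"
        by cases (simp_all add: fps_X_power_nth)
    qed (simp add: fps_X_power_nth fps_X_nth)
  qed
qed

end
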